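(* Let $k$ be a differential field of characteristic $0$ with non-trivial derivation $a\mapsto a'$ and field of constants $C\subsetneq k$, let $R=k[\partial;1,{}']$, let $n\geq 1$, and let $A\in\mathrm{M}(n,R)$. Let $M:=R^n/R^nA=R^s\oplus M_{\mathrm{tors}}$, let $l$ be a Picard–Vessiot extension of $k$ for $M_{\mathrm{tors}}$ or, alternatively, a universal differential field extension of $k$, and let $V:=\mathrm{Hom}_R(M,l)$ be the contravariant solution space of $M$. Then $$\dim_C V=\dim_k M=\deg\det A ,$$ as elements of $\mathbb{N}\cup\{\infty\}$.
   Context: A differential field is a field $k$ with an additive map (derivation) $k\to k$, $a\mapsto a'$, satisfying $(ab)'=a'b+ab'$; its field of constants is $C=\{a\in k: a'=0\}$. The ring $R=k[\partial;1,{}']$ is the skew polynomial ring of expressions $a_0+a_1\partial+\dots+a_m\partial^m$ with $a_i\in k$ and multiplication determined by $\partial a=a\partial+a'$ for $a\in k$. Every differential field extension $l$ of $k$ is a left $R$-module, with $k$ acting by multiplication and $\partial$ acting by the derivation of $l$. A matrix $A=\sum_i A_i\partial^i\in\mathrm{M}(n,R)$ ($n\times n$ matrices over $R$), with $A_i\in\mathrm{M}(n,k)$, corresponds to the homogeneous linear matrix differential equation $\sum_i A_iy^{(i)}=0$, that is $Ay=0$; the leading coefficient matrix is not required to be invertible. $R^n$ denotes row vectors, and $M=R^n/R^nA$ is a left $R$-module. It decomposes as $M=R^s\oplus M_{\mathrm{tors}}$ with $s\ge0$ and $M_{\mathrm{tors}}$ the torsion submodule, which is finite-dimensional over $k$.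 Choose a $k$-basis $e_1,\dots,e_m$ of $M_{\mathrm{tors}}$ and write $\partial e_i=\sum_j B_{ij}e_j$ with $B=(B_{ij})\in\mathrm{M}(m,k)$. A Picard–Vessiot extension of $k$ for $M_{\mathrm{tors}}$ is a differential field extension $l\supset k$ with field of constants $C$, such that there is $F\in\mathrm{GL}(m,l)$ with $F'=BF$ (entrywise derivative) and $l$ is generated as a field over $k$ by the entries of $F$. A universal differential field extension of $k$ is a differential field extension $l\supset k$ with field of constants $C$ such that for every $m$ and every $B\in \mathrm{M}(m,k)$ there is $F\in\mathrm{GL}(m,l)$ with $F'=BF$, and $l$ is generated as a field over $k$ by the entries of all such $F$. The ring $R$ is a left principal ideal domain, hence left Ore, with skew field of fractions $Q$ consisting of the fractions $r/s$ (meaning $s^{-1}r$), $r,s\in R$, $s\neq0$. The usual degree in $\partial$ on $R\setminus\{0\}$ extends to $\deg:Q\to\mathbb{Z}\cup\{\infty\}$ by $\deg(r/s)=\deg(r)-\deg(s)$ and $\deg(0)=\infty$. It satisfies $\deg(tu)=\deg(t)+\deg(u)$ and hence factors through $Q^{\mathrm{ab}}:=Q^\times/[Q^\times,Q^\times]\cup\{0\}$. The Dieudonné determinant is the multiplicative map $\det:\mathrm{M}(n,Q)\to Q^{\mathrm{ab}}$ that sends non-invertible matrices to $0$, elementary matrices to $1$, and $\mathrm{diag}(1,\dots,1,q)$ with $q\in Q^\times$ to the class of $q$; $\deg\det A$ is the degree of $\det(A)$. An infinite dimension is written $\infty$. *)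

theory Defs
  imports
    "Jordan_Normal_Form.VS_Connect"
    "Jordan_Normal_Form.Gauss_Jordan_Elimination"
    "HOL-Algebra.Generated_Fields"
    "HOL-Algebra.Generated_Groups"
    "HOL-Library.Extended_Real"
begin

hide_const (open) UnivPoly.coeff UnivPoly.monom up_ring.coeff up_ring.monom

section \<open>Differential fields\<close>

class differential_field = field +
  fixes der :: "'a \<Rightarrow> 'a"
  assumes der_add: "der (a + b) = der a + der b"
    and der_mult: "der (a * b) = der a * b + a * der b"

lemma der_0 [simp]: "der 0 = (0 :: 'a :: differential_field)"
  using der_add[of "0::'a" 0] by (metis add_cancel_right_right add_0)

lemma der_1 [simp]: "der 1 = (0 :: 'a :: differential_field)"
  using der_mult[of "1::'a" 1] by (metis add_cancel_right_right mult_1 mult_1_right)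

lemma der_minus: "der (- a) = - der (a :: 'a :: differential_field)"
  using der_add[of a "- a"] by (simp add: eq_neg_iff_add_eq_0 add.commute)

definition constants :: "'a :: differential_field set" where
  "constants = {a. der a = 0}"

definition constant_field :: "'a :: differential_field ring" where
  "constant_field = (class_ring :: 'a ring)\<lparr>carrier := constants\<rparr>"

definition differential_extension ::
    "('k :: differential_field \<Rightarrow> 'l :: differential_field) \<Rightarrow> bool" where
  "differential_extension emb \<longleftrightarrow> field_hom emb \<and> (\<forall>a. emb (der a) = der (emb a))"


section \<open>The ring of differential operators\<close>

text \<open>A differential operator \<open>a\<^sub>0 + a\<^sub>1 \<partial> + \<dots> + a\<^sub>m \<partial>\<^sup>m\<close> is stored as
  the coefficient sequence of an ordinary polynomial. Only the additive structure and the degree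
  are those of ordinary polynomials.\<close>

typedef (overloaded) 'a diffop = "UNIV :: 'a :: differential_field poly set"
  morphisms poly_of_diffop Diffop ..

setup_lifting type_definition_diffop

lift_definition dcoeff :: "'a :: differential_field diffop \<Rightarrow> nat \<Rightarrow> 'a" is coeff .
lift_definition ddegree :: "'a :: differential_field diffop \<Rightarrow> nat" is degree .
lift_definition dconst :: "'a :: differential_field \<Rightarrow> 'a diffop" is "\<lambda>a. [:a:]" .
lift_definition ddel :: "'a :: differential_field diffop" is "[:0, 1:]" .

text \<open>Left multiplication by \<open>\<partial>\<close>: \<open>\<partial> (\<Sum> b\<^sub>j \<partial>\<^sup>j) = \<Sum> b\<^sub>j \<partial>\<^sup>j\<^sup>+\<^sup>1 + \<Sum> b\<^sub>j' \<partial>\<^sup>j\<close>.\<close>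

definition del_left :: "'a :: differential_field poly \<Rightarrow> 'a poly" where
  "del_left q = pCons 0 q + map_poly der q"

definition skew_mult :: "'a :: differential_field poly \<Rightarrow> 'a poly \<Rightarrow> 'a poly" where
  "skew_mult p q = (\<Sum>i\<le>degree p. Polynomial.smult (coeff p i) ((del_left ^^ i) q))"

lemma del_left_add: "del_left (p + q) = del_left p + del_left q"
  unfolding del_left_def by (rule poly_eqI) (simp add: coeff_map_poly der_add coeff_pCons split: nat.split)

lemma del_left_smult: "del_left (Polynomial.smult a p) = Polynomial.smult (der a) p + Polynomial.smult a (del_left p)"
  unfolding del_left_def
  by (rule poly_eqI) (simp add: coeff_map_poly der_mult coeff_pCons algebra_simps split: nat.split)

lemma del_left_0 [simp]: "del_left 0 = 0"
  unfolding del_left_def by simp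

lemma del_left_pow_0 [simp]: "(del_left ^^ i) 0 = 0"
  by (induction i) auto

lemma del_left_pow_add: "(del_left ^^ i) (p + q) = (del_left ^^ i) p + (del_left ^^ i) q"
  by (induction i) (auto simp: del_left_add)

lemma del_left_sum: "del_left (sum f A) = (\<Sum>i\<in>A. del_left (f i))"
  by (induction A rule: infinite_finite_induct) (auto simp: del_left_add)

lemma del_left_pow_1: "(del_left ^^ i) 1 = monom 1 i"
  by (induction i) (auto simp: del_left_def monom_Suc map_poly_monom)

lemma skew_mult_bound:
  assumes "degree p \<le> n"
  shows "skew_mult p q = (\<Sum>i\<le>n. Polynomial.smult (coeff p i) ((del_left ^^ i) q))"
  unfolding skew_mult_def
  by (rule sum.mono_neutral_left) (use assms in \<open>auto simp: coeff_eq_0\<close>)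

lemma skew_mult_add_left: "skew_mult (p + q) r = skew_mult p r + skew_mult q r"
proof -
  let ?n = "max (degree p) (degree q)"
  have "degree (p + q) \<le> ?n" by (rule degree_add_le) auto
  then show ?thesis
    by (simp add: skew_mult_bound[of _ ?n] smult_add_left sum.distrib)
qed

lemma skew_mult_add_right: "skew_mult p (q + r) = skew_mult p q + skew_mult p r"
  by (simp add: skew_mult_def del_left_pow_add smult_add_right sum.distrib)

lemma skew_mult_0_left [simp]: "skew_mult 0 q = 0"
  by (simp add: skew_mult_def)

lemma skew_mult_0_right [simp]: "skew_mult p 0 = 0"
  by (simp add: skew_mult_def)

lemma smult_sum_right: "Polynomial.smult a (sum f A) = (\<Sum>i\<in>A. Polynomial.smult a (f i))"
  by (induction A rule: infinite_finite_induct) (auto simp: smult_add_right)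

lemma skew_mult_smult: "skew_mult (Polynomial.smult a p) q = Polynomial.smult a (skew_mult p q)"
proof -
  have "degree (Polynomial.smult a p) \<le> degree p" by simp
  then have "skew_mult (Polynomial.smult a p) q = (\<Sum>i\<le>degree p. Polynomial.smult (a * coeff p i) ((del_left ^^ i) q))"
    by (subst skew_mult_bound) auto
  also have "\<dots> = Polynomial.smult a (skew_mult p q)"
    by (simp add: skew_mult_def smult_sum_right)
  finally show ?thesis .
qed

lemma skew_mult_1_left: "skew_mult 1 q = q"
  by (simp add: skew_mult_def)

lemma skew_mult_1_right: "skew_mult p 1 = p"
  by (simp add: skew_mult_def del_left_pow_1 smult_monom poly_as_sum_of_monoms)

lemma skew_mult_del_left: "skew_mult (del_left p) q = del_left (skew_mult p q)"
proof -
  let ?m = "\<lambda>i. (del_left ^^ i) q"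
  have "skew_mult (pCons 0 p) q = (\<Sum>i\<le>Suc (degree p). Polynomial.smult (coeff (pCons 0 p) i) (?m i))"
    by (rule skew_mult_bound) (rule degree_pCons_le)
  also have "\<dots> = (\<Sum>i\<le>degree p. Polynomial.smult (coeff p i) (?m (Suc i)))"
    by (subst sum.atMost_Suc_shift) simp
  finally have 1: "skew_mult (pCons 0 p) q = (\<Sum>i\<le>degree p. Polynomial.smult (coeff p i) (del_left (?m i)))"
    by simp
  have "skew_mult (map_poly der p) q = (\<Sum>i\<le>degree p. Polynomial.smult (coeff (map_poly der p) i) (?m i))"
    by (rule skew_mult_bound) (simp add: degree_le coeff_map_poly coeff_eq_0)
  then have 2: "skew_mult (map_poly der p) q = (\<Sum>i\<le>degree p. Polynomial.smult (der (coeff p i)) (?m i))"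
    by (simp add: coeff_map_poly)
  have "del_left (skew_mult p q) = (\<Sum>i\<le>degree p. Polynomial.smult (der (coeff p i)) (?m i))
      + (\<Sum>i\<le>degree p. Polynomial.smult (coeff p i) (del_left (?m i)))"
    by (simp add: skew_mult_def del_left_sum del_left_smult sum.distrib)
  then show ?thesis
    unfolding del_left_def[of p] skew_mult_add_left 1 2 by simp
qed

lemma skew_mult_del_left_pow: "skew_mult ((del_left ^^ i) p) q = (del_left ^^ i) (skew_mult p q)"
  by (induction i) (auto simp: skew_mult_del_left)

lemma skew_mult_sum_left: "skew_mult (sum f A) q = (\<Sum>i\<in>A. skew_mult (f i) q)"
  by (induction A rule: infinite_finite_induct) (auto simp: skew_mult_add_left)

lemma skew_mult_assoc: "skew_mult (skew_mult p q) r = skew_mult p (skew_mult q r)"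
  by (simp add: skew_mult_def[of p] skew_mult_sum_left skew_mult_smult skew_mult_del_left_pow)

instantiation diffop :: (differential_field) ring_1
begin

lift_definition zero_diffop :: "'a diffop" is 0 .
lift_definition one_diffop :: "'a diffop" is 1 .
lift_definition plus_diffop :: "'a diffop \<Rightarrow> 'a diffop \<Rightarrow> 'a diffop" is "(+)" .
lift_definition minus_diffop :: "'a diffop \<Rightarrow> 'a diffop \<Rightarrow> 'a diffop" is "(-)" .
lift_definition uminus_diffop :: "'a diffop \<Rightarrow> 'a diffop" is uminus .
lift_definition times_diffop :: "'a diffop \<Rightarrow> 'a diffop \<Rightarrow> 'a diffop" is skew_mult .

instance
  by standard (transfer, simp add: skew_mult_assoc skew_mult_1_left skew_mult_1_right
      skew_mult_add_left skew_mult_add_right algebra_simps)+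

end

lemma ddel_dconst: "ddel * dconst a = dconst a * ddel + dconst (der a)"
  by transfer (simp add: skew_mult_def del_left_def map_poly_pCons)

lemma dconst_ring_hom:
  "dconst (a + b) = dconst a + dconst b" "dconst (a * b) = dconst a * dconst b"
  "dconst 0 = 0" "dconst 1 = 1"
  by (transfer, simp add: skew_mult_def)+

lemma diffop_expand: "r = (\<Sum>i\<le>ddegree r. dconst (dcoeff r i) * ddel ^ i)"
proof -
  have pow: "poly_of_diffop (ddel ^ i) = monom 1 i" for i
  proof (induction i)
    case (Suc i)
    then show ?case
      by (simp add: times_diffop.rep_eq ddel.rep_eq skew_mult_def del_left_def monom_Suc
          map_poly_monom)
  qed (simp add: one_diffop.rep_eq)
  have sm: "poly_of_diffop (sum f A) = (\<Sum>i\<in>A. poly_of_diffop (f i))"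
    for f :: "nat \<Rightarrow> 'a diffop" and A
    by (induction A rule: infinite_finite_induct) (auto simp: zero_diffop.rep_eq plus_diffop.rep_eq)
  show ?thesis
    by (rule poly_of_diffop_inject[THEN iffD1])
      (simp add: sm times_diffop.rep_eq pow dconst.rep_eq dcoeff.rep_eq ddegree.rep_eq
        skew_mult_def smult_monom poly_as_sum_of_monoms)
qed


section \<open>Left modules\<close>

text \<open>Left modules over the non-commutative ring of differential operators are represented by the
  record type \<open>module\<close> of HOL-Algebra. Its fields for multiplication and one are
  not used. The locale \<open>module\<close> cannot be used over that ring since it requires
  commutative scalars; it does apply after restriction of scalars to the field.\<close>

definition left_module :: "('r :: ring_1, 'm) module \<Rightarrow> bool" where
  "left_module M \<longleftrightarrow> abelian_group M \<and>
    (\<forall>r. \<forall>x\<in>carrier M. r \<odot>\<^bsub>M\<^esub> x \<in> carrier M) \<and>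
    (\<forall>x\<in>carrier M. 1 \<odot>\<^bsub>M\<^esub> x = x) \<and>
    (\<forall>r s. \<forall>x\<in>carrier M. (r * s) \<odot>\<^bsub>M\<^esub> x = r \<odot>\<^bsub>M\<^esub> (s \<odot>\<^bsub>M\<^esub> x)) \<and>
    (\<forall>r s. \<forall>x\<in>carrier M. (r + s) \<odot>\<^bsub>M\<^esub> x = r \<odot>\<^bsub>M\<^esub> x \<oplus>\<^bsub>M\<^esub> (s \<odot>\<^bsub>M\<^esub> x)) \<and>
    (\<forall>r. \<forall>x\<in>carrier M. \<forall>y\<in>carrier M.
      r \<odot>\<^bsub>M\<^esub> (x \<oplus>\<^bsub>M\<^esub> y) = r \<odot>\<^bsub>M\<^esub> x \<oplus>\<^bsub>M\<^esub> (r \<odot>\<^bsub>M\<^esub> y))"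

definition row_mult :: "'r :: ring_1 vec \<Rightarrow> 'r mat \<Rightarrow> 'r vec" where
  "row_mult v A = vec (dim_col A) (\<lambda>j. v \<bullet> col A j)"

definition quotient_module :: "('r, 'm) module \<Rightarrow> 'm set \<Rightarrow> ('r, 'm set) module" where
  "quotient_module M N = \<lparr>
    carrier = a_rcosets\<^bsub>M\<^esub> N,
    mult = undefined,
    one = undefined,
    zero = N,
    add = set_add M,
    smult = (\<lambda>r X. \<Union>x\<in>X. N +>\<^bsub>M\<^esub> (r \<odot>\<^bsub>M\<^esub> x))\<rparr>"

definition cokernel_module :: "nat \<Rightarrow> 'r :: ring_1 mat \<Rightarrow> ('r, 'r vec set) module" where
  "cokernel_module n A =
    quotient_module (module_vec TYPE('r) n) ((\<lambda>v. row_mult v A) ` carrier_vec n)"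

definition torsion_module :: "('r :: ring_1, 'm) module \<Rightarrow> ('r, 'm) module" where
  "torsion_module M =
    M\<lparr>carrier := {x \<in> carrier M. \<exists>r. r \<noteq> 0 \<and> r \<odot>\<^bsub>M\<^esub> x = \<zero>\<^bsub>M\<^esub>}\<rparr>"

definition restrict_scalars :: "('k \<Rightarrow> 'r) \<Rightarrow> ('r, 'm) module \<Rightarrow> ('k, 'm) module" where
  "restrict_scalars \<phi> M = \<lparr>
    carrier = carrier M, mult = mult M, one = one M, zero = zero M, add = add M,
    smult = (\<lambda>a. smult M (\<phi> a))\<rparr>"

definition vdim :: "('k, 'b) ring_scheme \<Rightarrow> ('k, 'v, 'c) module_scheme \<Rightarrow> enat" where
  "vdim K V = (if vectorspace.fin_dim K V then enat (vectorspace.dim K V) else \<infinity>)"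

definition extension_module ::
    "('k :: differential_field \<Rightarrow> 'l :: differential_field) \<Rightarrow> ('k diffop, 'l) module" where
  "extension_module emb = \<lparr>
    carrier = UNIV, mult = undefined, one = undefined, zero = 0, add = (+),
    smult = (\<lambda>r y. \<Sum>i\<le>ddegree r. emb (dcoeff r i) * (der ^^ i) y)\<rparr>"

text \<open>\<open>Hom\<^sub>R(M, l)\<close> as a vector space over the constants of \<open>k\<close>. Homomorphisms
  are taken extensional so that they are determined by their values on the carrier of \<open>M\<close>.\<close>

definition solution_space ::
    "('k :: differential_field \<Rightarrow> 'l :: differential_field) \<Rightarrow> ('k diffop, 'm) module \<Rightarrow>
      ('k, 'm \<Rightarrow> 'l) module" where
  "solution_space emb M = \<lparr>
    carrier = LinearCombinations.module_hom (class_ring :: 'k diffop ring) M (extension_module emb)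
      \<inter> extensional (carrier M),
    mult = undefined,
    one = undefined,
    zero = (\<lambda>x\<in>carrier M. 0),
    add = (\<lambda>f g. \<lambda>x\<in>carrier M. f x + g x),
    smult = (\<lambda>c f. \<lambda>x\<in>carrier M. emb c * f x)\<rparr>"


lemma row_mult_linear:
  fixes A :: "'r :: ring_1 mat"
  assumes "A \<in> carrier_mat n n"
  shows "u \<in> carrier_vec n \<Longrightarrow> v \<in> carrier_vec n \<Longrightarrow> row_mult (u + v) A = row_mult u A + row_mult v A"
   and "u \<in> carrier_vec n \<Longrightarrow> row_mult (r \<cdot>\<^sub>v u) A = r \<cdot>\<^sub>v row_mult u A"
   and "row_mult u A \<in> carrier_vec n"
  using assms unfolding row_mult_def
  by (auto simp: add_scalar_prod_distrib[where n=n] smult_scalar_prod_distrib[where n=n])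

lemma abelian_group_module_vec: "abelian_group (module_vec TYPE('r::ring_1) n)"
  apply (rule abelian_groupI)
  apply (auto simp: module_vec_simps assoc_add_vec[of _ n] intro: comm_add_vec)
  apply (rule_tac x="-x" in bexI)
  by (auto simp: module_vec_simps)

lemma left_module_module_vec: "left_module (module_vec TYPE('r::ring_1) n)"
  unfolding left_module_def using abelian_group_module_vec
  by (auto simp: module_vec_simps smult_smult_assoc add_smult_distrib_vec smult_add_distrib_vec[of _ n])

lemma left_module_quotient_module: assumes M: "left_module M" and N: "additive_subgroup N M" 
   and s: "\<And>r x. x \<in> N \<Longrightarrow> r \<odot>\<^bsub>M\<^esub> x \<in> N"
 shows "left_module (quotient_module M N)"
proof -
  interpret abelian_group M using M by (auto simp: left_module_def)
  interpret N: abelian_subgroup N M using N by (intro abelian_subgroupI3 abelian_group_axioms)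
  let ?Q = "quotient_module M N"
  note mm = M[unfolded left_module_def]
  have sm: "r \<odot>\<^bsub>?Q\<^esub> (N +>\<^bsub>M\<^esub> x) = N +>\<^bsub>M\<^esub> (r \<odot>\<^bsub>M\<^esub> x)" if x: "x \<in> carrier M" for r x
  proof -
    have "N +>\<^bsub>M\<^esub> (r \<odot>\<^bsub>M\<^esub> y) = N +>\<^bsub>M\<^esub> (r \<odot>\<^bsub>M\<^esub> x)" if y: "y \<in> N +>\<^bsub>M\<^esub> x" for y
    proof -
      obtain h where h: "h \<in> N" "y = h \<oplus>\<^bsub>M\<^esub> x" using y by (auto simp: a_r_coset_def')
      have "r \<odot>\<^bsub>M\<^esub> y = r \<odot>\<^bsub>M\<^esub> h \<oplus>\<^bsub>M\<^esub> r \<odot>\<^bsub>M\<^esub> x" using mm h x by (auto dest: N.a_Hcarr)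
      then have "r \<odot>\<^bsub>M\<^esub> y \<in> N +>\<^bsub>M\<^esub> (r \<odot>\<^bsub>M\<^esub> x)" using s[OF h(1)] by (auto simp: a_r_coset_def')
      then show ?thesis using a_repr_independence[OF _ _ N.a_subgroup] mm x by blast
    qed
    moreover have "x \<in> N +>\<^bsub>M\<^esub> x" using x N.a_rcos_self by blast
    ultimately have "(\<Union>y\<in>N +>\<^bsub>M\<^esub> x. N +>\<^bsub>M\<^esub> (r \<odot>\<^bsub>M\<^esub> y)) = N +>\<^bsub>M\<^esub> (r \<odot>\<^bsub>M\<^esub> x)"
      by (intro UN_constant_eq[of x]) blast+
    then show ?thesis by (simp add: quotient_module_def)
  qed
  have cl: "X \<in> carrier ?Q \<longleftrightarrow> (\<exists>x\<in>carrier M. X = N +>\<^bsub>M\<^esub> x)" for X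
    by (auto simp: quotient_module_def A_RCOSETS_def')
  have ad: "(N +>\<^bsub>M\<^esub> x) \<oplus>\<^bsub>?Q\<^esub> (N +>\<^bsub>M\<^esub> y) = N +>\<^bsub>M\<^esub> (x \<oplus>\<^bsub>M\<^esub> y)" if "x \<in> carrier M" "y \<in> carrier M" for x y
    using N.a_rcos_sum that by (auto simp: quotient_module_def)
  have "N +>\<^bsub>M\<^esub> \<zero>\<^bsub>M\<^esub> = N" using N.a_Hcarr by (auto simp: a_r_coset_def')
  then have z: "zero ?Q = N +>\<^bsub>M\<^esub> \<zero>\<^bsub>M\<^esub>" by (simp add: quotient_module_def)
  have "abelian_group ?Q"
  proof (rule abelian_groupI)
    fix X assume "X \<in> carrier ?Q"
    then obtain x where x: "x \<in> carrier M" "X = N +>\<^bsub>M\<^esub> x" using cl by auto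
    show "\<exists>Y\<in>carrier ?Q. Y \<oplus>\<^bsub>?Q\<^esub> X = \<zero>\<^bsub>?Q\<^esub>"
      by (rule bexI[of _ "N +>\<^bsub>M\<^esub> (\<ominus>\<^bsub>M\<^esub> x)"]) (use x cl in \<open>auto simp: z ad l_neg\<close>)
    show "\<zero>\<^bsub>?Q\<^esub> \<oplus>\<^bsub>?Q\<^esub> X = X" using x by (simp add: z ad)
    fix Y assume "Y \<in> carrier ?Q"
    then obtain y where y: "y \<in> carrier M" "Y = N +>\<^bsub>M\<^esub> y" using cl by auto
    show "X \<oplus>\<^bsub>?Q\<^esub> Y \<in> carrier ?Q" using x y cl by (auto simp: ad)
    show "X \<oplus>\<^bsub>?Q\<^esub> Y = Y \<oplus>\<^bsub>?Q\<^esub> X" using x y by (simp add: ad a_comm)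
    fix Z assume "Z \<in> carrier ?Q"
    then obtain w where w: "w \<in> carrier M" "Z = N +>\<^bsub>M\<^esub> w" using cl by auto
    show "X \<oplus>\<^bsub>?Q\<^esub> Y \<oplus>\<^bsub>?Q\<^esub> Z = X \<oplus>\<^bsub>?Q\<^esub> (Y \<oplus>\<^bsub>?Q\<^esub> Z)" using x y w by (simp add: ad a_assoc)
  qed (use cl z in auto)
  note ag = this
  have m1: "r \<odot>\<^bsub>M\<^esub> x \<in> carrier M" if "x \<in> carrier M" for r x using mm that by blast
  have m2: "1 \<odot>\<^bsub>M\<^esub> x = x" if "x \<in> carrier M" for x using mm that by blast
  have m3: "(r * t) \<odot>\<^bsub>M\<^esub> x = r \<odot>\<^bsub>M\<^esub> (t \<odot>\<^bsub>M\<^esub> x)" if "x \<in> carrier M" for r t x using mm that by blast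
  have m4: "(r + t) \<odot>\<^bsub>M\<^esub> x = r \<odot>\<^bsub>M\<^esub> x \<oplus>\<^bsub>M\<^esub> (t \<odot>\<^bsub>M\<^esub> x)" if "x \<in> carrier M" for r t x using mm that by blast
  have m5: "r \<odot>\<^bsub>M\<^esub> (x \<oplus>\<^bsub>M\<^esub> y) = r \<odot>\<^bsub>M\<^esub> x \<oplus>\<^bsub>M\<^esub> (r \<odot>\<^bsub>M\<^esub> y)" if "x \<in> carrier M" "y \<in> carrier M" for r x y using mm that by blast
  have cE: thesis if "X \<in> carrier ?Q" "\<And>x. x \<in> carrier M \<Longrightarrow> X = N +>\<^bsub>M\<^esub> x \<Longrightarrow> thesis" for X thesis
    using that cl by blast
  have cI: "N +>\<^bsub>M\<^esub> x \<in> carrier ?Q" if "x \<in> carrier M" for x using that cl by blast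
  show ?thesis unfolding left_module_def
  proof (intro conjI allI ballI)
    show "abelian_group ?Q" by (rule ag)
  next
    fix r X assume "X \<in> carrier ?Q" then show "r \<odot>\<^bsub>?Q\<^esub> X \<in> carrier ?Q"
      by (elim cE) (simp only: sm cI m1)
  next
    fix X assume "X \<in> carrier ?Q" then show "1 \<odot>\<^bsub>?Q\<^esub> X = X"
      by (elim cE) (simp only: sm m2)
  next
    fix r t X assume "X \<in> carrier ?Q" then show "(r * t) \<odot>\<^bsub>?Q\<^esub> X = r \<odot>\<^bsub>?Q\<^esub> (t \<odot>\<^bsub>?Q\<^esub> X)"
      by (elim cE) (simp only: sm m1 m3)
  next
    fix r t X assume "X \<in> carrier ?Q" then show "(r + t) \<odot>\<^bsub>?Q\<^esub> X = r \<odot>\<^bsub>?Q\<^esub> X \<oplus>\<^bsub>?Q\<^esub> (t \<odot>\<^bsub>?Q\<^esub> X)"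
      by (elim cE) (simp only: sm ad m1 m4)
  next
    fix r X Y assume "X \<in> carrier ?Q" "Y \<in> carrier ?Q"
    then show "r \<odot>\<^bsub>?Q\<^esub> (X \<oplus>\<^bsub>?Q\<^esub> Y) = r \<odot>\<^bsub>?Q\<^esub> X \<oplus>\<^bsub>?Q\<^esub> (r \<odot>\<^bsub>?Q\<^esub> Y)"
      by (elim cE) (simp only: sm ad m1 m5 a_closed)
  qed
qed

lemma left_module_cokernel_module: fixes A :: "'r::ring_1 mat" assumes A: "A \<in> carrier_mat n n" shows "left_module (cokernel_module n A)"
  unfolding cokernel_module_def
proof (rule left_module_quotient_module[OF left_module_module_vec])
  interpret abelian_group "module_vec TYPE('r) n" by (rule abelian_group_module_vec)
  note r = row_mult_linear[OF A]
  have i: "\<ominus>\<^bsub>module_vec TYPE('r) n\<^esub> x = (-1) \<cdot>\<^sub>v x" if x: "x \<in> carrier_vec n" for x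
    by (rule minus_equality) (use x in \<open>auto simp: module_vec_simps\<close>)
  let ?V = "module_vec TYPE('r) n" and ?N = "(\<lambda>v. row_mult v A) ` carrier_vec n"
  have inv: "inv\<^bsub>add_monoid ?V\<^esub> a \<in> ?N" if m: "a \<in> ?N" for a
  proof -
    obtain u where u: "u \<in> carrier_vec n" "a = row_mult u A" using m by blast
    have "inv\<^bsub>add_monoid ?V\<^esub> a = row_mult (- 1 \<cdot>\<^sub>v u) A"
      unfolding u(2) r(2)[OF u(1)] using i[OF r(3)] by (simp only: a_inv_def)
    moreover have "- 1 \<cdot>\<^sub>v u \<in> carrier_vec n" using u by simp
    ultimately show ?thesis by blast
  qed
  have add: "a \<otimes>\<^bsub>add_monoid ?V\<^esub> b \<in> ?N" if m: "a \<in> ?N" "b \<in> ?N" for a b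
  proof -
    obtain u v where u: "u \<in> carrier_vec n" "a = row_mult u A" "v \<in> carrier_vec n" "b = row_mult v A"
      using m by blast
    have "a \<otimes>\<^bsub>add_monoid ?V\<^esub> b = row_mult (u + v) A"
      unfolding u(2,4) r(1)[OF u(1,3)] by (simp add: module_vec_simps)
    moreover have "u + v \<in> carrier_vec n" using u by simp
    ultimately show ?thesis by blast
  qed
  show "additive_subgroup ?N ?V"
    by (intro additive_subgroup.intro group.subgroupI[OF a_group] inv add)
       (use r(3) in \<open>auto simp: module_vec_simps\<close>)
  fix t x assume "x \<in> (\<lambda>v. row_mult v A) ` carrier_vec n"
  then obtain v where v: "v \<in> carrier_vec n" "x = row_mult v A" by blast
  have "t \<cdot>\<^sub>v v \<in> carrier_vec n" using v by simp
  moreover have "t \<odot>\<^bsub>module_vec TYPE('r) n\<^esub> x = row_mult (t \<cdot>\<^sub>v v) A"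
    unfolding v(2) r(2)[OF v(1)] by (simp add: module_vec_simps)
  ultimately show "t \<odot>\<^bsub>module_vec TYPE('r) n\<^esub> x \<in> (\<lambda>v. row_mult v A) ` carrier_vec n"
    by blast
qed

lemma vectorspace_restrict_scalars: assumes "left_module (M:: ('k::differential_field diffop,'m) module)" shows 
  "vectorspace (class_ring :: 'k ring) (restrict_scalars dconst M)"
proof -
  note mm = assms[unfolded left_module_def]
  interpret abelian_group M using mm by auto
  show ?thesis
  unfolding vectorspace_def
  proof (intro conjI moduleI class_field class_cring.is_cring abelian_groupI)
    fix x assume "x \<in> carrier (restrict_scalars dconst M)"
    then show "\<exists>y\<in>carrier (restrict_scalars dconst M). y \<oplus>\<^bsub>restrict_scalars dconst M\<^esub> x = \<zero>\<^bsub>restrict_scalars dconst M\<^esub>"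
      by (intro bexI[of _ "\<ominus>\<^bsub>M\<^esub> x"]) (auto simp: restrict_scalars_def l_neg)
  qed (use mm in \<open>auto simp: restrict_scalars_def dconst_ring_hom add.m_ac\<close>)
qed

lemma field_constant_field: "field (constant_field :: 'k::differential_field ring)"
proof -
  have *: "der (inverse a) = 0" if "der a = 0" for a :: 'k
  proof (cases "a = 0")
    case False
    then have "a * der (inverse a) = 0" using der_mult[of a "inverse a"] that by simp
    with False show ?thesis by simp
  qed simp
  have n: "\<exists>y. der y = 0 \<and> x + y = 0" if "der x = 0" for x :: 'k
    by (rule exI[of _ "-x"]) (use that in \<open>auto simp: der_minus\<close>)
  have d: "domain (constant_field :: 'k::differential_field ring)"
    unfolding constant_field_def
    by (intro domainI cringI abelian_groupI comm_monoidI) 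
       (auto simp: constants_def der_add der_mult algebra_simps n)
  have u: "(\<exists>y. der y = 0 \<and> y * x = 1 \<and> x * y = 1)" if "der x = 0" "x \<noteq> 0" for x :: 'k
    by (rule exI[of _ "inverse x"]) (simp add: that *)
  have "Units (constant_field :: 'k::differential_field ring) = carrier constant_field - {\<zero>\<^bsub>constant_field\<^esub>}"
    unfolding Units_def constant_field_def constants_def using u by (auto simp: Bex_def)
  with d show ?thesis unfolding field_def field_axioms_def by blast
qed

lemma vectorspace_solution_space: assumes M: "left_module (M:: ('k::differential_field diffop,'m) module)" and e: "differential_extension (emb :: 'k \<Rightarrow> 'b::differential_field)"
  shows
  "vectorspace (constant_field :: 'k ring) (solution_space emb M)"
proof -
  have fl: "field (constant_field :: 'k ring)" by (rule field_constant_field)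
  interpret field_hom emb using e by (auto simp: differential_extension_def)
  have cc: "(der ^^ i) (emb c * y) = emb c * (der ^^ i) y" if "der c = 0" for c y i
  proof -
    have "der (emb c) = 0" using e that unfolding differential_extension_def by (metis hom_zero)
    then show ?thesis by (induction i) (auto simp: der_mult)
  qed
  have aa: "(der ^^ i) (x + y) = (der ^^ i) x + (der ^^ i) (y::'b)" for x y i
    by (induction i) (auto simp: der_add)
  have mm: "(der ^^ i) (- x) = - (der ^^ i) (x::'b)" for x  i
    by (induction i) (auto simp: der_minus)
  have zz: "(der ^^ i) 0 = (0::'b)" for i
    by (induction i) (auto)

  let ?N = "extension_module emb" and ?S = "solution_space emb M" and ?C = "constant_field :: 'k ring"
  define act where "act r = smult ?N r" for r
  have a1: "act r (x + y) = act r x + act r y" for r x y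
    by (simp add: act_def extension_module_def aa distrib_left sum.distrib)
  have a2: "act r (emb c * y) = emb c * act r y" if "der c = 0" for r c y
    by (simp add: act_def extension_module_def cc[OF that] sum_distrib_left mult.left_commute)
  have a3: "act r 0 = 0" for r by (simp add: act_def extension_module_def zz)
  have a4: "act r (- y) = - act r y" for r y using a1[of r y "-y"] a3 by (simp add: eq_neg_iff_add_eq_0 add.commute)
  note mm' = M[unfolded left_module_def]
  interpret abelian_group M using mm' by auto
  have H: "f \<in> carrier ?S \<longleftrightarrow> f \<in> extensional (carrier M) \<and>
     (\<forall>x\<in>carrier M. \<forall>y\<in>carrier M. f (x \<oplus>\<^bsub>M\<^esub> y) = f x + f y) \<and>
     (\<forall>r. \<forall>x\<in>carrier M. f (r \<odot>\<^bsub>M\<^esub> x) = act r (f x))" for f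
    unfolding solution_space_def LinearCombinations.module_hom_def act_def by (auto simp: extension_module_def)
  have ops: "add ?S f g = (\<lambda>x\<in>carrier M. f x + g x)" "zero ?S = (\<lambda>x\<in>carrier M. 0)" "smult ?S c f = (\<lambda>x\<in>carrier M. emb c * f x)" for f g c
    by (auto simp: solution_space_def)
  have Cops: "c \<in> carrier ?C \<longleftrightarrow> der c = 0" "add ?C = (+)" "mult ?C = (*)" "one ?C = 1" "zero ?C = 0" for c
    by (auto simp: constant_field_def constants_def)
  have E: "f = g" if "f \<in> carrier ?S" "g \<in> extensional (carrier M)" "\<And>x. x \<in> carrier M \<Longrightarrow> f x = g x" for f g
    using that H extensionalityI by blast
  have cm: "r \<odot>\<^bsub>M\<^esub> x \<in> carrier M" if "x \<in> carrier M" for r x using mm' that by blast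
  have c1: "add ?S f g \<in> carrier ?S" if "f \<in> carrier ?S" "g \<in> carrier ?S" for f g
    using that cm unfolding H ops by (simp add: a1)
  have c2: "zero ?S \<in> carrier ?S" using cm unfolding H ops by (simp add: a3)
  have c3: "smult ?S c f \<in> carrier ?S" if "f \<in> carrier ?S" "der c = 0" for c f
    using that cm unfolding H ops by (simp add: a2 distrib_left)
  have c4: "(\<lambda>x\<in>carrier M. - f x) \<in> carrier ?S" if "f \<in> carrier ?S" for f
    using that cm unfolding H ops by (simp add: a4)
  have ag: "abelian_group ?S"
  proof (rule abelian_groupI)
    fix x assume x: "x \<in> carrier ?S"
    show "\<exists>y\<in>carrier ?S. y \<oplus>\<^bsub>?S\<^esub> x = \<zero>\<^bsub>?S\<^esub>"
      by (rule bexI[OF _ c4[OF x]]) (auto simp: ops)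
    show "\<zero>\<^bsub>?S\<^esub> \<oplus>\<^bsub>?S\<^esub> x = x" using E[OF c1[OF c2 x], of x] x H[of x] by (simp add: ops)
  qed (use c1 c2 in \<open>auto simp: ops fun_eq_iff restrict_def\<close>)
  have "Module.module ?C ?S"
  proof (rule moduleI)
    show "cring ?C" using fl by (simp add: field_def domain_def)
    fix x assume x: "x \<in> carrier ?S"
    show "\<one>\<^bsub>?C\<^esub> \<odot>\<^bsub>?S\<^esub> x = x"
      using E[OF c3[OF x der_1], of x] x H[of x] by (simp add: ops Cops)
  qed (use ag c3 in \<open>auto simp: ops Cops fun_eq_iff restrict_def distrib_left distrib_right hom_mult hom_add mult.assoc\<close>)
  then show ?thesis using fl by (simp add: vectorspace_def)
qed

lemma left_module_extension_module:
  assumes e: "differential_extension (emb :: 'k \<Rightarrow> 'l :: differential_field)"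
  shows "left_module (extension_module emb :: ('k :: differential_field diffop, 'l) module)"
proof -
  interpret field_hom emb using e by (auto simp: differential_extension_def)
  have ed: "der (emb a) = emb (der a)" for a using e by (simp add: differential_extension_def)
  define act where "act p y = (\<Sum>i\<le>degree p. emb (coeff p i) * (der ^^ i) y)" for p y
  have bound: "act p y = (\<Sum>i\<le>n. emb (coeff p i) * (der ^^ i) y)" if "degree p \<le> n" for p y n
    unfolding act_def by (rule sum.mono_neutral_left) (use that in \<open>auto simp: coeff_eq_0\<close>)
  have pow_add: "(der ^^ i) (x + y) = (der ^^ i) x + (der ^^ i) (y :: 'l)" for i x y
    by (induction i) (auto simp: der_add)
  have add_r: "act p (x + y) = act p x + act p y" for p x y
    by (simp add: act_def pow_add distrib_left sum.distrib)
  have add_l: "act (p + q) y = act p y + act q y" for p q y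
  proof -
    let ?n = "max (degree p) (degree q)"
    have "degree (p + q) \<le> ?n" by (rule degree_add_le) auto
    then show ?thesis by (simp add: bound[of _ ?n] hom_add distrib_right sum.distrib)
  qed
  have sm: "act (Polynomial.smult a p) y = emb a * act p y" for a p y
    by (simp add: bound[of "Polynomial.smult a p" "degree p"] act_def sum_distrib_left hom_mult mult.assoc)
  have der_sum: "der (sum f A) = (\<Sum>i\<in>A. der (f i :: 'l))" for f and A :: "nat set"
    by (induction A rule: infinite_finite_induct) (auto simp: der_add)
  have dl: "act (del_left p) y = der (act p y)" for p y
  proof -
    have "act (pCons 0 p) y = (\<Sum>i\<le>Suc (degree p). emb (coeff (pCons 0 p) i) * (der ^^ i) y)"
      by (rule bound) (rule degree_pCons_le)
    also have "\<dots> = (\<Sum>i\<le>degree p. emb (coeff p i) * der ((der ^^ i) y))"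
      by (subst sum.atMost_Suc_shift) simp
    finally have 1: "act (pCons 0 p) y = (\<Sum>i\<le>degree p. emb (coeff p i) * der ((der ^^ i) y))" .
    have "act (map_poly der p) y = (\<Sum>i\<le>degree p. emb (coeff (map_poly der p) i) * (der ^^ i) y)"
      by (rule bound) (simp add: degree_le coeff_map_poly coeff_eq_0)
    then have 2: "act (map_poly der p) y = (\<Sum>i\<le>degree p. der (emb (coeff p i)) * (der ^^ i) y)"
      by (simp add: coeff_map_poly ed)
    show ?thesis
      unfolding del_left_def add_l 1 2 unfolding act_def
      by (simp add: der_sum der_mult sum.distrib add.commute)
  qed
  have dlp: "act ((del_left ^^ i) p) y = (der ^^ i) (act p y)" for i p y
    by (induction i) (auto simp: dl)
  have sum_l: "act (sum f A) y = (\<Sum>i\<in>A. act (f i) y)" for f and A :: "nat set" and y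
    by (induction A rule: infinite_finite_induct) (auto simp: add_l, auto simp: act_def)
  have mult: "act (skew_mult p q) y = act p (act q y)" for p q y
    unfolding skew_mult_def sum_l sm dlp by (simp add: act_def)
  have one: "act 1 y = y" for y by (simp add: act_def)
  have smult_act: "r \<odot>\<^bsub>extension_module emb\<^esub> y = act (poly_of_diffop r) y" for r y
    by (simp add: extension_module_def act_def dcoeff.rep_eq ddegree.rep_eq)
  have "abelian_group (extension_module emb)"
    by (rule abelian_groupI) (auto simp: extension_module_def intro: exI[of _ "- x" for x])
  then show ?thesis
    unfolding left_module_def smult_act
    by (simp add: extension_module_def times_diffop.rep_eq plus_diffop.rep_eq one_diffop.rep_eq
        mult one add_l add_r)
qed

lemma extension_module_simps:
  assumes "differential_extension emb"
  shows "dconst a \<odot>\<^bsub>extension_module emb\<^esub> y = emb a * y"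
    and "ddel \<odot>\<^bsub>extension_module emb\<^esub> y = der y"
proof -
  interpret field_hom emb using assms by (auto simp: differential_extension_def)
  show "dconst a \<odot>\<^bsub>extension_module emb\<^esub> y = emb a * y"
    by (simp add: extension_module_def ddegree.rep_eq dcoeff.rep_eq dconst.rep_eq)
  show "ddel \<odot>\<^bsub>extension_module emb\<^esub> y = der y"
    by (simp add: extension_module_def ddegree.rep_eq dcoeff.rep_eq ddel.rep_eq)
qed


section \<open>Picard--Vessiot and universal extensions\<close>

definition fundamental_matrix ::
    "('k :: differential_field \<Rightarrow> 'l :: differential_field) \<Rightarrow> nat \<Rightarrow> 'k mat \<Rightarrow> 'l mat \<Rightarrow> bool" where
  "fundamental_matrix emb m B F \<longleftrightarrow>
    F \<in> carrier_mat m m \<and> invertible_mat F \<and> map_mat der F = map_mat emb B * F"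

text \<open>\<open>T\<close> is a left module of finite dimension over \<open>k\<close>. The choice of the basis \<open>e\<close> is
  immaterial: a change of basis \<open>P\<close> replaces \<open>F\<close> by \<open>P F\<close>.\<close>

definition picard_vessiot ::
    "('k :: differential_field \<Rightarrow> 'l :: differential_field) \<Rightarrow> ('k diffop, 'm) module \<Rightarrow> bool" where
  "picard_vessiot emb T \<longleftrightarrow>
    differential_extension emb \<and>
    constants = emb ` constants \<and>
    (let V = restrict_scalars dconst T in
      \<exists>m e B F.
        inj_on e {..<m} \<and>
        vectorspace.basis (class_ring :: 'k ring) V (e ` {..<m}) \<and>
        B \<in> carrier_mat m m \<and>
        (\<forall>i<m. ddel \<odot>\<^bsub>T\<^esub> e i = (\<Oplus>\<^bsub>V\<^esub>j\<in>{..<m}. B $$ (i, j) \<odot>\<^bsub>V\<^esub> e j)) \<and>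
        fundamental_matrix emb m B F \<and>
        generate_field (class_ring :: 'l ring) (range emb \<union> elements_mat F) = UNIV)"

definition universal_extension ::
    "('k :: differential_field \<Rightarrow> 'l :: differential_field) \<Rightarrow> bool" where
  "universal_extension emb \<longleftrightarrow>
    differential_extension emb \<and>
    constants = emb ` constants \<and>
    (\<forall>m. \<forall>B\<in>carrier_mat m m. \<exists>F. fundamental_matrix emb m B F) \<and>
    generate_field (class_ring :: 'l ring)
      (range emb \<union>
        \<Union>{elements_mat F | F m B. B \<in> carrier_mat m m \<and> fundamental_matrix emb m B F}) = UNIV"


section \<open>The skew field of fractions and the Dieudonne determinant\<close>

text \<open>The skew field of left fractions of a left Ore domain, given up to unique isomorphism by
  its embedding \<open>\<iota>\<close>.\<close>

definition left_fraction_field :: "('r :: ring_1 \<Rightarrow> 'q :: division_ring) \<Rightarrow> bool" where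
  "left_fraction_field \<iota> \<longleftrightarrow>
    inj_ring_hom \<iota> \<and> (\<forall>q. \<exists>r s. s \<noteq> 0 \<and> q = inverse (\<iota> s) * \<iota> r)"

definition frac_deg ::
    "('k :: differential_field diffop \<Rightarrow> 'q :: division_ring) \<Rightarrow> 'q \<Rightarrow> ereal" where
  "frac_deg \<iota> q = (if q = 0 then \<infinity>
    else THE d. \<exists>r s. r \<noteq> 0 \<and> s \<noteq> 0 \<and> q = inverse (\<iota> s) * \<iota> r \<and>
      d = ereal (real (ddegree r) - real (ddegree s)))"

text \<open>Elements of \<open>Q\<^sup>a\<^sup>b\<close> are the cosets of the commutator subgroup in
  \<open>Q\<^sup>\<times>\<close> and the set \<open>{0}\<close>; they are multiplied elementwise.\<close>

definition commutator_subgroup :: "'q :: division_ring set" where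
  "commutator_subgroup =
    (let G = units_of (class_ring :: 'q ring) in derived G (carrier G))"

definition Qab_class :: "'q :: division_ring \<Rightarrow> 'q set" where
  "Qab_class q = (if q = 0 then {0}
    else commutator_subgroup #>\<^bsub>units_of (class_ring :: 'q ring)\<^esub> q)"

definition Qab_mult :: "'q :: division_ring set \<Rightarrow> 'q set \<Rightarrow> 'q set" where
  "Qab_mult X Y = X <#>\<^bsub>(class_ring :: 'q ring)\<^esub> Y"

definition Qab_deg ::
    "('k :: differential_field diffop \<Rightarrow> 'q :: division_ring) \<Rightarrow> 'q set \<Rightarrow> ereal" where
  "Qab_deg \<iota> X = the_elem (frac_deg \<iota> ` X)"

text \<open>Here \<open>addrow_mat n a i j\<close> is the elementary matrix with \<open>a\<close> at position \<open>(i, j)\<close>, and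
  \<open>multrow_mat n (n - 1) q\<close> is the diagonal matrix with entries \<open>1, \<dots>, 1, q\<close>.\<close>

definition dieudonne_determinant ::
    "nat \<Rightarrow> ('q :: division_ring mat \<Rightarrow> 'q set) \<Rightarrow> bool" where
  "dieudonne_determinant n \<Delta> \<longleftrightarrow>
    (\<forall>X\<in>carrier_mat n n. \<Delta> X \<in> range Qab_class) \<and>
    (\<forall>X\<in>carrier_mat n n. \<forall>Y\<in>carrier_mat n n. \<Delta> (X * Y) = Qab_mult (\<Delta> X) (\<Delta> Y)) \<and>
    (\<forall>X\<in>carrier_mat n n. \<not> invertible_mat X \<longrightarrow> \<Delta> X = Qab_class 0) \<and>
    (\<forall>a i j. i < n \<longrightarrow> j < n \<longrightarrow> i \<noteq> j \<longrightarrow> \<Delta> (addrow_mat n a i j) = Qab_class 1) \<and>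
    (\<forall>q. q \<noteq> 0 \<longrightarrow> \<Delta> (multrow_mat n (n - 1) q) = Qab_class q)"

end

theory Submission
  imports Defs
begin

text \<open>Adding a left multiple of one row of \<open>A\<close> to another changes neither \<open>R\<^sup>n A\<close> nor \<open>deg det A\<close>, and
  the Euclidean algorithm in \<open>R\<close> makes \<open>A\<close> upper triangular in this way.

  If no diagonal entry vanishes, division with remainder shows that the classes of \<open>\<partial>\<^sup>j\<close> times the
  \<open>i\<close>-th unit vector, with \<open>j\<close> below the degree of the \<open>i\<close>-th diagonal entry, form a \<open>k\<close>-basis
  of \<open>M\<close>; their number is \<open>deg det A\<close>.
  Then \<open>M\<close> is torsion, and a fundamental matrix identifies its solutions with vectors of constants.

  If a diagonal entry vanishes, \<open>det A = 0\<close>, and the right Ore condition yields a column \<open>x \<noteq> 0\<close> with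
  \<open>A x = 0\<close>. It may be taken unimodular, hence defines a surjection of \<open>M\<close> onto \<open>R\<close>. So \<open>M\<close> has infinite
  dimension, and \<open>V\<close> contains \<open>Hom(R, l) = l\<close>, in which the powers of a nonconstant element of \<open>k\<close>
  are linearly independent over \<open>C\<close>.\<close>

section \<open>Division with remainder for differential operators\<close>

text \<open>The determinant is given only by axioms, which assign 1 to elementary matrices; these
  act from the left and also preserve \<open>R^n A\<close>. Hence the reduction uses row additions
  alone and stops at a triangular matrix: a diagonal form would call for column operations, which
  need not preserve \<open>R^n A\<close>, and the degree can be read off the diagonal anyway. Left
  and right play different roles. Rows and left ideals need quotients on the left, the null column x
  needs quotients on the right. The left Ore condition is read off from the existence of left
  fractions, whereas the right one is obtained from division with remainder. The extension l serves
  two purposes. In finite dimension it supplies a fundamental matrix, and since its constants come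
  from k, coordinates that are constant in l are scalars for V. In infinite dimension it contains
  the image of k, and solutions taking powers of a nonconstant element as values at one vector are
  independent; characteristic 0 and the nontrivial derivation enter there.\<close>

lemma degree_del_left_pow:
  assumes "p \<noteq> 0"
  shows "degree ((del_left ^^ i) p) = degree p + i"
    and "coeff ((del_left ^^ i) p) (degree p + i) = lead_coeff p"
proof -
  have "degree ((del_left ^^ i) p) = degree p + i
    \<and> coeff ((del_left ^^ i) p) (degree p + i) = lead_coeff p"
  proof (induction i)
    case (Suc i)
    define q where "q = (del_left ^^ i) p"
    have q: "degree q = degree p + i" "coeff q (degree p + i) = lead_coeff p"
      using Suc by (auto simp: q_def)
    have q0: "q \<noteq> 0" using q(2) assms by auto
    \<comment> \<open>Differentiating the coefficients does not raise the degree, so the shift alone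
      determines the leading term.\<close>
    have lt: "degree (map_poly der q) < degree (pCons 0 q)"
      using q0 by (simp add: degree_pCons_eq le_imp_less_Suc degree_le coeff_map_poly coeff_eq_0)
    then have "degree (del_left q) = Suc (degree q)"
      using q0 unfolding del_left_def by (subst degree_add_eq_left) (auto simp: degree_pCons_eq)
    moreover have "coeff (del_left q) (Suc (degree q)) = lead_coeff q"
      by (simp add: del_left_def coeff_map_poly coeff_eq_0)
    ultimately show ?case using q by (simp add: q_def)
  qed simp
  then show "degree ((del_left ^^ i) p) = degree p + i"
    and "coeff ((del_left ^^ i) p) (degree p + i) = lead_coeff p" by auto
qed

text \<open>Only the summand with i = \<open>degree p\<close> reaches the top degree, and
  \<open>del_left\<close> preserves leading coefficients. Hence degrees add and R has no zero
  divisors.\<close>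

lemma skew_mult_lead_coeff:
  assumes "p \<noteq> 0" "q \<noteq> 0"
  shows "degree (skew_mult p q) = degree p + degree q"
    and "coeff (skew_mult p q) (degree p + degree q) = lead_coeff p * lead_coeff q"
proof -
  have "coeff (skew_mult p q) (degree p + degree q)
      = (\<Sum>i\<le>degree p. coeff p i * coeff ((del_left ^^ i) q) (degree p + degree q))"
    by (simp add: skew_mult_def coeff_sum)
  also have "\<dots> = (\<Sum>i\<in>{degree p}. coeff p i * coeff ((del_left ^^ i) q) (degree p + degree q))"
    by (rule sum.mono_neutral_right)
      (auto simp: coeff_eq_0 degree_del_left_pow(1)[OF assms(2)])
  also have "\<dots> = lead_coeff p * lead_coeff q"
    using degree_del_left_pow(2)[OF assms(2), of "degree p"] by (simp add: add.commute)
  finally show lc: "coeff (skew_mult p q) (degree p + degree q) = lead_coeff p * lead_coeff q" .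
  have "degree (skew_mult p q) \<le> degree p + degree q"
    unfolding skew_mult_def
    by (intro degree_sum_le order.trans[OF degree_smult_le])
      (auto simp: degree_del_left_pow(1)[OF assms(2)])
  moreover have "degree p + degree q \<le> degree (skew_mult p q)"
    using lc assms by (intro le_degree) auto
  ultimately show "degree (skew_mult p q) = degree p + degree q" by simp
qed

lemma ddegree_mult:
  "r \<noteq> 0 \<Longrightarrow> s \<noteq> 0 \<Longrightarrow> ddegree (r * s) = ddegree r + ddegree s"
  by transfer (rule skew_mult_lead_coeff(1))

lemma dcoeff_mult_lead:
  "r \<noteq> 0 \<Longrightarrow> s \<noteq> 0 \<Longrightarrow>
    dcoeff (r * s) (ddegree r + ddegree s) = dcoeff r (ddegree r) * dcoeff s (ddegree s)"
  by transfer (rule skew_mult_lead_coeff(2))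

lemma dcoeff_simps [simp]:
  "dcoeff 0 i = 0" "dcoeff (r + s) i = dcoeff r i + dcoeff s i"
  "dcoeff (r - s) i = dcoeff r i - dcoeff s i" "dcoeff (- r) i = - dcoeff r i"
  by (transfer, simp)+

lemma dcoeff_dconst_mult [simp]: "dcoeff (dconst a * r) i = a * dcoeff r i"
  by transfer (simp add: skew_mult_def)

lemma dcoeff_sum: "dcoeff (sum f S) i = (\<Sum>x\<in>S. dcoeff (f x) i)"
  by (induction S rule: infinite_finite_induct) auto

lemma diffop_eqI: "(\<And>i. dcoeff r i = dcoeff s i) \<Longrightarrow> r = s"
  by transfer (rule poly_eqI)

lemma dcoeff_ddegree_eq_0_iff [simp]: "dcoeff r (ddegree r) = 0 \<longleftrightarrow> r = 0"
  by transfer simp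

instance diffop :: (differential_field) ring_1_no_zero_divisors
proof
  fix r s :: "'a diffop"
  assume "r \<noteq> 0" "s \<noteq> 0"
  then show "r * s \<noteq> 0" using dcoeff_mult_lead[of r s] by force
qed

text \<open>The degree shifted by one, with 0 for the zero operator: zero is then smaller than the
  nonzero constants, so division also covers divisors of degree 0, and
  \<open>dsize r \<le> m\<close> says that all coefficients from m on vanish.\<close>

definition dsize :: "'a :: differential_field diffop \<Rightarrow> nat" where
  "dsize r = (if r = 0 then 0 else Suc (ddegree r))"

lemma dsize_eq_0_iff [simp]: "dsize r = 0 \<longleftrightarrow> r = 0"
  by (simp add: dsize_def)

lemma dsize_le_iff: "dsize r \<le> m \<longleftrightarrow> (\<forall>i\<ge>m. dcoeff r i = 0)"
proof
  show "dsize r \<le> m \<Longrightarrow> \<forall>i\<ge>m. dcoeff r i = 0"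
    unfolding dsize_def by transfer (auto split: if_splits intro: coeff_eq_0)
  show "\<forall>i\<ge>m. dcoeff r i = 0 \<Longrightarrow> dsize r \<le> m"
    unfolding dsize_def using dcoeff_ddegree_eq_0_iff[of r]
    by (metis Suc_leI not_less zero_le)
qed

lemma dsize_minus: "dsize (- r) = dsize r"
  unfolding dsize_def by transfer simp

lemma dsize_mult: "r \<noteq> 0 \<Longrightarrow> s \<noteq> 0 \<Longrightarrow> dsize (r * s) = ddegree r + dsize s"
  by (simp add: dsize_def ddegree_mult)

lemma ddel_power_rep: "poly_of_diffop (ddel ^ i) = monom 1 i"
proof (induction i)
  case (Suc i)
  then show ?case
    by (simp add: times_diffop.rep_eq ddel.rep_eq skew_mult_def del_left_def monom_Suc
        map_poly_monom)
qed (simp add: one_diffop.rep_eq)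

lemma dcoeff_ddel_power [simp]: "dcoeff (ddel ^ i) j = (if j = i then 1 else 0)"
  by (simp add: dcoeff.rep_eq ddel_power_rep)

lemma ddegree_dconst_ddel_power: "a \<noteq> 0 \<Longrightarrow> ddegree (dconst a * ddel ^ i) = i"
  by (simp add: ddegree.rep_eq times_diffop.rep_eq ddel_power_rep dconst.rep_eq skew_mult_def
      degree_monom_eq smult_monom)

lemma dsize_diff_less:
  assumes "p \<noteq> 0" "g \<noteq> 0" "ddegree g = ddegree p" "dcoeff g (ddegree g) = dcoeff p (ddegree p)"
  shows "dsize (p - g) < dsize p"
proof -
  have "dcoeff (p - g) i = 0" if "i \<ge> ddegree p" for i
  proof (cases "i = ddegree p")
    case False
    with that have "dsize p \<le> i" "dsize g \<le> i" using assms by (auto simp: dsize_def)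
    then show ?thesis using dsize_le_iff[of p i] dsize_le_iff[of g i] by simp
  qed (use assms in simp)
  then have "dsize (p - g) \<le> ddegree p" by (simp add: dsize_le_iff)
  then show ?thesis using assms by (simp add: dsize_def)
qed

text \<open>One monomial serves both sides: the order of the factors affects only terms of lower
  degree, because leading coefficients commute.\<close>

lemma cancelling_monomial:
  fixes p s :: "'a :: differential_field diffop"
  assumes "s \<noteq> 0" "dsize s \<le> dsize p"
  obtains g where "dsize (p - g * s) < dsize p" "dsize (p - s * g) < dsize p"
proof -
  have p: "p \<noteq> 0" and le: "ddegree s \<le> ddegree p"
    using assms by (auto simp: dsize_def split: if_splits)
  define a where "a = dcoeff p (ddegree p) / dcoeff s (ddegree s)"
  have a: "a \<noteq> 0" using p assms by (simp add: a_def)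
  define g where "g = dconst a * ddel ^ (ddegree p - ddegree s)"
  have dg: "ddegree g = ddegree p - ddegree s" by (simp add: g_def ddegree_dconst_ddel_power a)
  have cg: "dcoeff g (ddegree g) = a"
    unfolding dg by (simp add: g_def)
  have g: "g \<noteq> 0" using cg a by auto
  show thesis
  proof
    show "dsize (p - g * s) < dsize p"
      using dcoeff_mult_lead[OF g assms(1)] cg le dg g assms(1) p
      by (intro dsize_diff_less) (auto simp: ddegree_mult a_def)
    show "dsize (p - s * g) < dsize p"
      using dcoeff_mult_lead[OF assms(1) g] cg le dg g assms(1) p
      by (intro dsize_diff_less) (auto simp: ddegree_mult a_def)
  qed
qed

lemma left_division:
  fixes p s :: "'a :: differential_field diffop"
  assumes "s \<noteq> 0"
  obtains q r where "p = q * s + r" "dsize r < dsize s"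
proof -
  have "\<exists>q r. p = q * s + r \<and> dsize r < dsize s"
  proof (induction "dsize p" arbitrary: p rule: less_induct)
    case less
    show ?case
    proof (cases "dsize p < dsize s")
      case True
      then show ?thesis by (intro exI[of _ 0] exI[of _ p]) simp
    next
      case False
      then obtain g where "dsize (p - g * s) < dsize p"
        using cancelling_monomial[OF assms, of p] by auto
      then obtain q r where "p - g * s = q * s + r" "dsize r < dsize s" using less by blast
      then show ?thesis by (intro exI[of _ "g + q"] exI[of _ r]) (simp add: algebra_simps)
    qed
  qed
  with that show thesis by blast
qed

lemma right_division:
  fixes p s :: "'a :: differential_field diffop"
  assumes "s \<noteq> 0"
  obtains q r where "p = s * q + r" "dsize r < dsize s"
proof -
  have "\<exists>q r. p = s * q + r \<and> dsize r < dsize s"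
  proof (induction "dsize p" arbitrary: p rule: less_induct)
    case less
    show ?case
    proof (cases "dsize p < dsize s")
      case True
      then show ?thesis by (intro exI[of _ 0] exI[of _ p]) simp
    next
      case False
      then obtain g where "dsize (p - s * g) < dsize p"
        using cancelling_monomial[OF assms, of p] by auto
      then obtain q r where "p - s * g = s * q + r" "dsize r < dsize s" using less by blast
      then show ?thesis by (intro exI[of _ "g + q"] exI[of _ r]) (simp add: algebra_simps)
    qed
  qed
  with that show thesis by blast
qed

text \<open>Induction along the Euclidean algorithm: with b = p q + r, a relation r z = p c for the
  smaller pair gives p (q z + c) = b z, and z is nonzero because p c is.\<close>

lemma right_Ore:
  fixes p b :: "'a :: differential_field diffop"
  assumes "p \<noteq> 0"
  obtains z c where "c \<noteq> 0" "p * z = b * c"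
proof -
  have "\<exists>z c. c \<noteq> 0 \<and> p * z = b * c" if "p \<noteq> 0" for b
    using that
  proof (induction "dsize p" arbitrary: p b rule: less_induct)
    case less
    obtain q r where b: "b = p * q + r" and r: "dsize r < dsize p"
      using right_division[OF less.prems] .
    show ?case
    proof (cases "r = 0")
      case True
      then show ?thesis using b by (intro exI[of _ q] exI[of _ 1]) simp
    next
      case False
      obtain z c where zc: "c \<noteq> 0" "r * z = p * c" using less.hyps[OF r False] by blast
      have "z \<noteq> 0" using zc less.prems by auto
      moreover have "p * (q * z + c) = b * z"
        by (simp add: b distrib_left distrib_right mult.assoc zc(2))
      ultimately show ?thesis by blast
    qed
  qed
  with that assms show thesis by blast
qed


section \<open>Degrees in the skew field of fractions\<close>

context
  fixes \<iota> :: "'k :: differential_field diffop \<Rightarrow> 'q :: division_ring"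
  assumes Q: "left_fraction_field \<iota>"
begin

interpretation inj_ring_hom \<iota>
  using Q by (simp add: left_fraction_field_def)

lemma fraction_cases:
  obtains r s where "s \<noteq> 0" "q = inverse (\<iota> s) * \<iota> r"
  using Q unfolding left_fraction_field_def by blast

text \<open>The right fraction \<open>r s^-1\<close> lies in Q and is therefore a left fraction
  \<open>b^-1 a\<close>; clearing denominators gives the relation.\<close>

lemma left_Ore:
  fixes r s :: "'k diffop"
  assumes "s \<noteq> 0"
  obtains a b where "b \<noteq> 0" "b * r = a * s"
proof -
  obtain a b where b: "b \<noteq> 0" and eq: "\<iota> r * inverse (\<iota> s) = inverse (\<iota> b) * \<iota> a"
    by (rule fraction_cases)
  have "\<iota> (b * r) = \<iota> b * (\<iota> r * inverse (\<iota> s)) * \<iota> s"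
    using assms by (simp add: hom_mult mult.assoc)
  also have "\<dots> = \<iota> (a * s)"
    unfolding eq using b by (simp add: hom_mult flip: mult.assoc)
  finally show thesis using that b by simp
qed

text \<open>Well-definedness behind the \<open>THE\<close>: two fractions for the same element are
  compared over a common denominator \<open>b * s' = a * s\<close>, and then
  \<open>b * r' = a * r\<close>.\<close>

lemma frac_deg_fraction:
  assumes "r \<noteq> 0" "s \<noteq> 0"
  shows "frac_deg \<iota> (inverse (\<iota> s) * \<iota> r) = ereal (real (ddegree r) - real (ddegree s))"
proof -
  have "real (ddegree r') - real (ddegree s') = real (ddegree r) - real (ddegree s)"
    if nz: "r' \<noteq> 0" "s' \<noteq> 0" and eq: "inverse (\<iota> s) * \<iota> r = inverse (\<iota> s') * \<iota> r'" for r' s'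
  proof -
    obtain a b where b: "b \<noteq> 0" and ab: "b * s' = a * s"
      by (rule left_Ore[OF assms(2)])
    have a: "a \<noteq> 0" using ab b nz by auto
    have "\<iota> r' = \<iota> s' * (inverse (\<iota> s') * \<iota> r')"
      using nz by (simp flip: mult.assoc)
    then have "\<iota> (b * r') = \<iota> (b * s') * (inverse (\<iota> s') * \<iota> r')"
      by (metis hom_mult mult.assoc)
    also have "\<dots> = \<iota> a * (\<iota> s * (inverse (\<iota> s) * \<iota> r))"
      unfolding ab eq[symmetric] by (simp add: hom_mult mult.assoc)
    also have "\<dots> = \<iota> (a * r)"
      using assms by (simp add: hom_mult flip: mult.assoc[of "\<iota> s"])
    finally have "b * r' = a * r" by simp
    with ab have "ddegree b + ddegree r' = ddegree a + ddegree r"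
      "ddegree b + ddegree s' = ddegree a + ddegree s"
      using ddegree_mult[OF b nz(1)] ddegree_mult[OF a assms(1)]
        ddegree_mult[OF b nz(2)] ddegree_mult[OF a assms(2)] by simp_all
    then show ?thesis by linarith
  qed
  then have "(THE d. \<exists>r' s'. r' \<noteq> 0 \<and> s' \<noteq> 0
      \<and> inverse (\<iota> s) * \<iota> r = inverse (\<iota> s') * \<iota> r'
      \<and> d = ereal (real (ddegree r') - real (ddegree s')))
    = ereal (real (ddegree r) - real (ddegree s))"
    using assms by (intro the_equality) metis+
  moreover have "inverse (\<iota> s) * \<iota> r \<noteq> 0" using assms by simp
  ultimately show ?thesis unfolding frac_deg_def by (simp only: if_False)
qed

lemma frac_deg_0 [simp]: "frac_deg \<iota> 0 = \<infinity>"
  by (simp add: frac_deg_def)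

lemma frac_deg_finite: "q \<noteq> 0 \<Longrightarrow> \<bar>frac_deg \<iota> q\<bar> \<noteq> \<infinity>"
proof -
  assume q: "q \<noteq> 0"
  obtain r s where s: "s \<noteq> 0" "q = inverse (\<iota> s) * \<iota> r" by (rule fraction_cases)
  with q have "r \<noteq> 0" by auto
  with s show ?thesis by (simp add: frac_deg_fraction)
qed

lemma frac_deg_not_MInfty [simp]: "frac_deg \<iota> q \<noteq> - \<infinity>"
  using frac_deg_finite[of q] by (cases "q = 0") auto

lemma frac_deg_embedding: "r \<noteq> 0 \<Longrightarrow> frac_deg \<iota> (\<iota> r) = ereal (real (ddegree r))"
  using frac_deg_fraction[of r 1] by (simp add: ddegree.rep_eq one_diffop.rep_eq)

lemma frac_deg_1 [simp]: "frac_deg \<iota> 1 = 0"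
  using frac_deg_embedding[of 1] by (simp add: ddegree.rep_eq one_diffop.rep_eq)

text \<open>In the product of two fractions the inner factor \<open>r t^-1\<close> has its inverse
  on the wrong side; the left Ore condition rewrites it as \<open>b^-1 a\<close>, and the product
  becomes \<open>(b s)^-1 (a u)\<close>.\<close>

lemma frac_deg_mult: "frac_deg \<iota> (p * q) = frac_deg \<iota> p + frac_deg \<iota> q"
proof (cases "p = 0 \<or> q = 0")
  case False
  obtain r s where s: "s \<noteq> 0" and p: "p = inverse (\<iota> s) * \<iota> r" by (rule fraction_cases)
  obtain u t where t: "t \<noteq> 0" and q: "q = inverse (\<iota> t) * \<iota> u" by (rule fraction_cases)
  have r: "r \<noteq> 0" and u: "u \<noteq> 0" using False p q by auto
  obtain a b where b: "b \<noteq> 0" and ab: "b * r = a * t" by (rule left_Ore[OF t])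
  have a: "a \<noteq> 0" using ab b r by auto
  have "\<iota> r = inverse (\<iota> b) * (\<iota> b * \<iota> r)" using b by (simp flip: mult.assoc)
  also have "\<iota> b * \<iota> r = \<iota> a * \<iota> t" using ab by (metis hom_mult)
  finally have "p * q = inverse (\<iota> (b * s)) * \<iota> (a * u)"
    using b s t by (simp add: p q hom_mult nonzero_inverse_mult_distrib mult.assoc)
      (simp flip: mult.assoc[of "\<iota> t"])
  moreover have "ddegree b + ddegree r = ddegree a + ddegree t"
    using ddegree_mult[OF b r] ddegree_mult[OF a t] ab by simp
  ultimately show ?thesis
    using a b s u t r by (simp add: p q frac_deg_fraction ddegree_mult)
qed auto

lemma frac_deg_inverse:
  assumes "q \<noteq> 0"
  shows "frac_deg \<iota> (inverse q) = - frac_deg \<iota> q"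
  using frac_deg_mult[of q "inverse q"] assms frac_deg_finite[OF assms]
    frac_deg_finite[of "inverse q"]
  by (cases "frac_deg \<iota> q"; cases "frac_deg \<iota> (inverse q)") auto

lemma units_of_class_ring:
  "carrier (units_of (class_ring :: 'q ring)) = - {0}"
  "x \<noteq> 0 \<Longrightarrow> inv\<^bsub>units_of (class_ring :: 'q ring)\<^esub> x = inverse x"
proof -
  show c: "carrier (units_of (class_ring :: 'q ring)) = - {0}"
    by (auto simp: units_of_def Units_def) (metis left_inverse right_inverse)
  have "monoid (class_ring :: 'q ring)"
    by standard (auto simp: mult.assoc)
  then interpret U: group "units_of (class_ring :: 'q ring)" by (rule monoid.units_group)
  show "x \<noteq> 0 \<Longrightarrow> inv\<^bsub>units_of (class_ring :: 'q ring)\<^esub> x = inverse x"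
    by (rule U.inv_equality) (auto simp: c, auto simp: units_of_def)
qed

text \<open>The degree is a homomorphism from the units to a commutative group, hence zero on
  commutators and on the subgroup that they generate.\<close>

lemma commutator_subgroup_deg:
  assumes "c \<in> commutator_subgroup"
  shows "c \<noteq> 0 \<and> frac_deg \<iota> c = 0"
proof -
  let ?G = "units_of (class_ring :: 'q ring)"
  have mult: "x \<otimes>\<^bsub>?G\<^esub> y = x * y" and one: "\<one>\<^bsub>?G\<^esub> = 1" for x y
    by (auto simp: units_of_def)
  have S: "h \<noteq> 0 \<and> frac_deg \<iota> h = 0" if "h \<in> derived_set ?G (carrier ?G)" for h
  proof -
    obtain x y where xy: "x \<noteq> 0" "y \<noteq> 0" "h = x * y * inverse x * inverse y"
      using \<open>h \<in> _\<close> by (auto simp: units_of_class_ring mult)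
    then show ?thesis
      using frac_deg_finite[of x] frac_deg_finite[of y]
      by (cases "frac_deg \<iota> x"; cases "frac_deg \<iota> y")
        (auto simp: frac_deg_mult frac_deg_inverse)
  qed
  have "c \<in> generate ?G (derived_set ?G (carrier ?G))"
    using assms by (simp add: commutator_subgroup_def derived_def Let_def)
  then show ?thesis
  proof induction
    case (inv h)
    then show ?case using S[of h] by (simp add: units_of_class_ring(2) frac_deg_inverse)
  qed (use S in \<open>auto simp: mult one frac_deg_mult\<close>)
qed

lemma Qab_class_deg:
  "Qab_class q \<noteq> {}" "x \<in> Qab_class q \<Longrightarrow> frac_deg \<iota> x = frac_deg \<iota> q"
proof -
  have "1 \<in> (commutator_subgroup :: 'q set)"
    unfolding commutator_subgroup_def derived_def Let_def
    using generate.one[of "units_of (class_ring :: 'q ring)"] by (simp add: units_of_def)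
  then show "Qab_class q \<noteq> {}" by (auto simp: Qab_class_def r_coset_def)
  show "x \<in> Qab_class q \<Longrightarrow> frac_deg \<iota> x = frac_deg \<iota> q"
    using commutator_subgroup_deg
    by (auto simp: Qab_class_def r_coset_def units_of_def frac_deg_mult split: if_splits)
qed

lemma Qab_deg_eqI: "X \<noteq> {} \<Longrightarrow> (\<And>x. x \<in> X \<Longrightarrow> frac_deg \<iota> x = d) \<Longrightarrow> Qab_deg \<iota> X = d"
proof -
  assume "X \<noteq> {}" "\<And>x. x \<in> X \<Longrightarrow> frac_deg \<iota> x = d"
  then have "frac_deg \<iota> ` X = {d}" by auto
  then show ?thesis by (simp add: Qab_deg_def)
qed

lemma Qab_deg_class: "Qab_deg \<iota> (Qab_class q) = frac_deg \<iota> q"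
  by (rule Qab_deg_eqI) (auto simp: Qab_class_deg)

text \<open>\<open>Qab_mult\<close> multiplies sets elementwise, so the claim reduces to
  representatives, all products of which have the same degree; this covers the class of 0 with
  degree \<infinity> as well.\<close>

lemma Qab_deg_mult:
  "X \<in> range Qab_class \<Longrightarrow> Y \<in> range Qab_class \<Longrightarrow>
    Qab_deg \<iota> (Qab_mult X Y) = Qab_deg \<iota> X + Qab_deg \<iota> Y"
proof -
  assume "X \<in> range Qab_class" "Y \<in> range Qab_class"
  then obtain p q where [simp]: "X = Qab_class p" "Y = Qab_class q" by auto
  show ?thesis unfolding Qab_deg_class \<open>X = _\<close> \<open>Y = _\<close>
    by (rule Qab_deg_eqI)
      (use Qab_class_deg(1) in \<open>auto simp: Qab_mult_def set_mult_def frac_deg_mult Qab_class_deg(2)\<close>)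
qed

end


section \<open>Upper triangular matrices\<close>

lemma row_mult_index:
  "j < dim_col A \<Longrightarrow> row_mult v A $ j = (\<Sum>i<dim_row A. v $ i * A $$ (i, j))"
  by (simp add: row_mult_def scalar_prod_def atLeast0LessThan)

text \<open>One step of forward substitution: earlier terms vanish by the assumption on u, later
  ones because T is upper triangular.\<close>

lemma row_mult_upper_triangular:
  assumes "T \<in> carrier_mat n n" "upper_triangular T" "m < n" "\<And>i. i < m \<Longrightarrow> u $ i = 0"
  shows "row_mult u T $ m = u $ m * T $$ (m, m)"
proof -
  have "row_mult u T $ m = (\<Sum>i<n. u $ i * T $$ (i, m))"
    using assms(1,3) by (subst row_mult_index) auto
  also have "\<dots> = (\<Sum>i\<in>{m}. u $ i * T $$ (i, m))"
  proof (rule sum.mono_neutral_right)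
    show "\<forall>i\<in>{..<n} - {m}. u $ i * T $$ (i, m) = 0"
    proof
      fix i assume "i \<in> {..<n} - {m}"
      then consider "i < m" | "m < i" "i < n" by fastforce
      then show "u $ i * T $$ (i, m) = 0"
        using assms(1,3) assms(4)[of i] upper_triangularD[OF assms(2), of m i] by cases auto
    qed
  qed (use assms(3) in auto)
  finally show ?thesis by simp
qed

lemma upper_triangular_row_solve:
  fixes T :: "'r :: ring_1_no_zero_divisors mat"
  assumes T: "T \<in> carrier_mat n n" "upper_triangular T" and "m \<le> n"
    and "\<And>j. j < m \<Longrightarrow> T $$ (j, j) \<noteq> 0" "\<And>j. j < m \<Longrightarrow> row_mult u T $ j = 0"
  shows "j < m \<Longrightarrow> u $ j = 0"
proof (induction j rule: less_induct)
  case (less j)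
  have "row_mult u T $ j = u $ j * T $$ (j, j)"
    by (rule row_mult_upper_triangular[OF T]) (use less assms in auto)
  then show ?case using less.prems assms by auto
qed

text \<open>Let m be the position of the first zero on the diagonal. Row m of an inverse, multiplied
  by T, is the m-th unit row; forward substitution makes its entries before m vanish, so entry m of
  the product would be 0 instead of 1.\<close>

lemma upper_triangular_not_invertible:
  fixes T :: "'r :: ring_1_no_zero_divisors mat"
  assumes T: "T \<in> carrier_mat n n" "upper_triangular T" and "i < n" "T $$ (i, i) = 0"
  shows "\<not> invertible_mat T"
proof
  assume "invertible_mat T"
  then obtain Y where TY: "T * Y = 1\<^sub>m n" and YT: "Y * T = 1\<^sub>m (dim_row Y)"
    using T unfolding invertible_mat_def inverts_mat_def by blast
  \<comment> \<open>\<open>invertible_mat\<close> leaves the size of the inverse open; it follows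
    from the two identity matrices.\<close>
  have "dim_col (T * Y) = n" "dim_col (Y * T) = dim_row Y"
    unfolding TY YT by (rule index_one_mat)+
  then have Y: "Y \<in> carrier_mat n n" using T by auto
  define m where "m = (LEAST i. i < n \<and> T $$ (i, i) = 0)"
  have m: "m < n" "T $$ (m, m) = 0"
    using LeastI[of "\<lambda>i. i < n \<and> T $$ (i, i) = 0" i] assms by (auto simp: m_def)
  have nz: "T $$ (j, j) \<noteq> 0" if "j < m" for j
    using not_less_Least[of j "\<lambda>i. i < n \<and> T $$ (i, i) = 0"] that m by (auto simp: m_def)
  have yT: "row_mult (row Y m) T $ j = (if j = m then 1 else 0)" if "j < n" for j
  proof -
    have "row_mult (row Y m) T $ j = (Y * T) $$ (m, j)"
      using that Y T m by (simp add: row_mult_def)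
    then show ?thesis using YT that Y m by simp
  qed
  have "row Y m $ j = 0" if "j < m" for j
    using upper_triangular_row_solve[OF T, of m "row Y m" j] that m nz yT by simp
  then have "row_mult (row Y m) T $ m = 0"
    using row_mult_upper_triangular[OF T m(1)] m by simp
  with yT[OF m(1)] show False by simp
qed

text \<open>A row exchange in which one row changes sign. Being a product of elementary matrices, it
  leaves both the row module and the degree of the determinant alone.\<close>

definition signed_swap :: "nat \<Rightarrow> nat \<Rightarrow> 'r :: ring_1 mat \<Rightarrow> 'r mat" where
  "signed_swap k l A = addrow 1 k l (addrow (- 1) l k (addrow 1 k l A))"

lemma signed_swap_carrier [simp]: "signed_swap k l A \<in> carrier_mat n n \<longleftrightarrow> A \<in> carrier_mat n n"
  by (auto simp: signed_swap_def)

lemma dim_signed_swap [simp]: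
  "dim_row (signed_swap k l A) = dim_row A" "dim_col (signed_swap k l A) = dim_col A"
  by (auto simp: signed_swap_def)

lemma signed_swap_index:
  "A \<in> carrier_mat n n \<Longrightarrow> k < n \<Longrightarrow> l < n \<Longrightarrow> k \<noteq> l \<Longrightarrow> i < n \<Longrightarrow> j < n \<Longrightarrow>
    signed_swap k l A $$ (i, j)
      = (if i = k then A $$ (l, j) else if i = l then - A $$ (k, j) else A $$ (i, j))"
  by (auto simp: signed_swap_def)

text \<open>Euclid's algorithm on the entries of rows k and l in column c: one round replaces (a, b)
  by (b, - (a mod b)). The premises on B also record that a column vanishing in both rows keeps
  doing so, which protects columns cleared earlier.\<close>

lemma euclid_two_rows:
  fixes P :: "'k :: differential_field diffop mat \<Rightarrow> bool"
  assumes step: "\<And>A a k l. A \<in> carrier_mat n n \<Longrightarrow> k < n \<Longrightarrow> l < n \<Longrightarrow> k \<noteq> l \<Longrightarrow>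
      P (addrow a k l A) \<Longrightarrow> P A"
    and "A \<in> carrier_mat n n" "k < n" "l < n" "k \<noteq> l" "c < n"
    and "\<And>B. B \<in> carrier_mat n n \<Longrightarrow> B $$ (l, c) = 0 \<Longrightarrow>
      (\<And>i j. i < n \<Longrightarrow> j < n \<Longrightarrow> i \<noteq> k \<Longrightarrow> i \<noteq> l \<Longrightarrow> B $$ (i, j) = A $$ (i, j)) \<Longrightarrow>
      (\<And>j. j < n \<Longrightarrow> A $$ (k, j) = 0 \<Longrightarrow> A $$ (l, j) = 0 \<Longrightarrow> B $$ (k, j) = 0 \<and> B $$ (l, j) = 0) \<Longrightarrow> P B"
  shows "P A"
  using assms(2) assms(7)
proof (induction "dsize (A $$ (l, c))" arbitrary: A rule: less_induct)
  case (less A)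
  note A = less.prems(1)
  show ?case
  proof (cases "A $$ (l, c) = 0")
    case True
    then show ?thesis by (intro less.prems) auto
  next
    case False
    obtain q r where qr: "A $$ (k, c) = q * A $$ (l, c) + r" "dsize r < dsize (A $$ (l, c))"
      using left_division[OF False] .
    define B where "B = signed_swap k l (addrow (- q) k l A)"
    have B: "B \<in> carrier_mat n n" using A by (simp add: B_def)
    have ind: "B $$ (i, j) = (if i = k then A $$ (l, j)
        else if i = l then q * A $$ (l, j) - A $$ (k, j) else A $$ (i, j))" if "i < n" "j < n" for i j
      using that A assms(3-5) by (simp add: B_def signed_swap_index[of _ n])
    have "P B"
    proof (rule less.hyps[OF _ B])
      have "B $$ (l, c) = - r" using assms(3-6) qr by (simp add: ind)
      also have "dsize (- r) = dsize r" by (rule dsize_minus)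
      finally show "dsize (B $$ (l, c)) < dsize (A $$ (l, c))" using qr by simp
    next
      fix B' assume "B' \<in> carrier_mat n n" "B' $$ (l, c) = 0"
        "\<And>i j. i < n \<Longrightarrow> j < n \<Longrightarrow> i \<noteq> k \<Longrightarrow> i \<noteq> l \<Longrightarrow> B' $$ (i, j) = B $$ (i, j)"
        "\<And>j. j < n \<Longrightarrow> B $$ (k, j) = 0 \<Longrightarrow> B $$ (l, j) = 0 \<Longrightarrow> B' $$ (k, j) = 0 \<and> B' $$ (l, j) = 0"
      then show "P B'" using assms(3-5) by (intro less.prems) (auto simp: ind)
    qed
    \<comment> \<open>A signed swap is itself three row additions, so \<open>P\<close> is pulled
      back through four of them.\<close>
    then have "P (addrow (- 1) l k (addrow 1 k l (addrow (- q) k l A)))"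
      unfolding B_def signed_swap_def by (rule step[rotated 4]) (use A assms(3-5) in auto)
    then have "P (addrow 1 k l (addrow (- q) k l A))"
      by (rule step[rotated 4]) (use A assms(3-5) in auto)
    then have "P (addrow (- q) k l A)"
      by (rule step[rotated 4]) (use A assms(3-5) in auto)
    then show ?thesis
      by (rule step[rotated 4]) (use A assms(3-5) in auto)
  qed
qed

text \<open>Since \<open>P\<close> can be pulled back along row additions, it suffices to check it
  after elimination. Columns are cleared from the left, each from its bottom entry up to the
  diagonal.\<close>

lemma triangular_induct:
  fixes P :: "'k :: differential_field diffop mat \<Rightarrow> bool"
  assumes step: "\<And>A a k l. A \<in> carrier_mat n n \<Longrightarrow> k < n \<Longrightarrow> l < n \<Longrightarrow> k \<noteq> l \<Longrightarrow>
      P (addrow a k l A) \<Longrightarrow> P A"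
    and tri: "\<And>T. T \<in> carrier_mat n n \<Longrightarrow> upper_triangular T \<Longrightarrow> P T"
    and "A \<in> carrier_mat n n"
  shows "P A"
proof -
  \<comment> \<open>A stage of the elimination, always below the diagonal: columns before
    \<open>c\<close> are done, and column \<open>c\<close> is zero from row \<open>m\<close> on.
    With \<open>m = n\<close> nothing is asked of column \<open>c\<close>.\<close>
  define zero_below where
    "zero_below A c m \<longleftrightarrow> (\<forall>i<n. \<forall>j<n. j < i \<longrightarrow> j < c \<or> j = c \<and> m \<le> i \<longrightarrow> A $$ (i, j) = 0)"
    for A :: "'k diffop mat" and c m
  have columns: "P A" if "A \<in> carrier_mat n n" "zero_below A c n" "c \<le> n" for A c
    using that(3,1,2)
  proof (induction c arbitrary: A rule: inc_induct)
    case base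
    then show ?case by (intro tri) (auto simp: zero_below_def)
  next
    case (step c)
    have "P A" if "A \<in> carrier_mat n n" "zero_below A c m" "c < m" "m \<le> n" for A m
      using that(3,4,1,2)
    proof (induction "m - Suc c" arbitrary: A m)
      case 0
      then have "zero_below A (Suc c) n"
        unfolding zero_below_def by (auto simp: less_Suc_eq)
      then show ?case using step.IH 0 by auto
    next
      case (Suc d)
      define l where "l = m - 1"
      have l: "c < l" "l < n" "m = Suc l" using Suc by (auto simp: l_def)
      \<comment> \<open>Rows c and l both vanish in the columns before c, and the elimination on two
        rows keeps them so.\<close>
      show ?case
      proof (rule euclid_two_rows[OF assms(1), where k = c and l = l and c = c])
        fix B assume B: "B \<in> carrier_mat n n" "B $$ (l, c) = 0"
          "\<And>i j. i < n \<Longrightarrow> j < n \<Longrightarrow> i \<noteq> c \<Longrightarrow> i \<noteq> l \<Longrightarrow> B $$ (i, j) = A $$ (i, j)"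
          "\<And>j. j < n \<Longrightarrow> A $$ (c, j) = 0 \<Longrightarrow> A $$ (l, j) = 0 \<Longrightarrow> B $$ (c, j) = 0 \<and> B $$ (l, j) = 0"
        have "B $$ (i, j) = 0" if ij: "i < n" "j < n" "j < i" "j < c \<or> j = c \<and> l \<le> i" for i j
        proof (cases "i = c \<or> i = l")
          case True
          then show ?thesis
            using B(2) B(4)[OF ij(2)] Suc.prems(4) ij l unfolding zero_below_def by auto
        next
          case False
          then show ?thesis
            using B(3)[OF ij(1,2)] Suc.prems(4) ij l unfolding zero_below_def
            by (metis Suc_leI le_neq_implies_less)
        qed
        then have "zero_below B c l" by (auto simp: zero_below_def)
        then show "P B" using Suc.hyps(2) B(1) l by (intro Suc.hyps(1)[of l]) auto
      qed (use Suc l in auto)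
    qed
    then show ?case using step by auto
  qed
  show ?thesis using assms(3) by (intro columns[of A 0]) (auto simp: zero_below_def)
qed


section \<open>The degree of the Dieudonne determinant\<close>

context
  fixes \<iota> :: "'k :: differential_field diffop \<Rightarrow> 'q :: division_ring"
    and \<Delta> :: "'q mat \<Rightarrow> 'q set" and n :: nat
  assumes Q: "left_fraction_field \<iota>" and det: "dieudonne_determinant n \<Delta>" and n: "n \<ge> 1"
begin

definition det_deg :: "'q mat \<Rightarrow> ereal" where
  "det_deg X = Qab_deg \<iota> (\<Delta> X)"

lemma det_deg_mult:
  "X \<in> carrier_mat n n \<Longrightarrow> Y \<in> carrier_mat n n \<Longrightarrow> det_deg (X * Y) = det_deg X + det_deg Y"
  using det Qab_deg_mult[OF Q, of "\<Delta> X" "\<Delta> Y"]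
  by (auto simp: det_deg_def dieudonne_determinant_def)

lemma det_deg_not_invertible:
  "X \<in> carrier_mat n n \<Longrightarrow> \<not> invertible_mat X \<Longrightarrow> det_deg X = \<infinity>"
  using det Qab_deg_class[OF Q, of 0] frac_deg_0[OF Q]
  by (simp add: det_deg_def dieudonne_determinant_def)

lemma det_deg_one: "det_deg (1\<^sub>m n) = 0"
proof -
  have "multrow_mat n (n - 1) 1 = (1\<^sub>m n :: 'q mat)" by (rule eq_matI) auto
  moreover have "\<Delta> (multrow_mat n (n - 1) 1) = Qab_class 1"
    using det by (simp add: dieudonne_determinant_def)
  ultimately have "\<Delta> (1\<^sub>m n) = Qab_class 1" by simp
  then show ?thesis using Qab_deg_class[OF Q, of 1] frac_deg_1[OF Q] by (simp add: det_deg_def)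
qed

lemma det_deg_addrow:
  assumes "X \<in> carrier_mat n n" "k < n" "l < n" "k \<noteq> l"
  shows "det_deg (addrow a k l X) = det_deg X"
proof -
  have "\<Delta> (addrow_mat n a k l) = Qab_class 1"
    using det assms unfolding dieudonne_determinant_def by blast
  then have "det_deg (addrow_mat n a k l) = 0"
    using Qab_deg_class[OF Q, of 1] frac_deg_1[OF Q] by (simp add: det_deg_def)
  then show ?thesis
    using assms by (simp add: addrow_mat[of X n n] det_deg_mult)
qed

lemma det_deg_signed_swap:
  "X \<in> carrier_mat n n \<Longrightarrow> k < n \<Longrightarrow> l < n \<Longrightarrow> k \<noteq> l \<Longrightarrow> det_deg (signed_swap k l X) = det_deg X"
  by (simp add: signed_swap_def det_deg_addrow)

text \<open>The axioms of \<open>dieudonne_determinant\<close> speak only of scaling the last row.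
  Another row is moved there and back by signed swaps, whose two signs cancel.\<close>

lemma det_deg_multrow:
  assumes X: "X \<in> carrier_mat n n" and k: "k < n" and q: "q \<noteq> 0"
  shows "det_deg (multrow k q X) = frac_deg \<iota> q + det_deg X"
proof -
  have last: "det_deg (multrow (n - 1) q Y) = frac_deg \<iota> q + det_deg Y" if "Y \<in> carrier_mat n n" for Y
  proof -
    have "\<Delta> (multrow_mat n (n - 1) q) = Qab_class q"
      using det q by (simp add: dieudonne_determinant_def)
    then show ?thesis
      using that Qab_deg_class[OF Q, of q]
      by (simp add: multrow_mat[of Y n n] det_deg_mult) (simp add: det_deg_def)
  qed
  show ?thesis
  proof (cases "k = n - 1")
    case False
    define Y where "Y = multrow (n - 1) q (signed_swap k (n - 1) X)"
    have Y: "Y \<in> carrier_mat n n" using X by (simp add: Y_def)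
    have "multrow k q X = signed_swap (n - 1) k Y"
    proof (rule eq_matI)
      fix i j assume "i < dim_row (signed_swap (n - 1) k Y)" "j < dim_col (signed_swap (n - 1) k Y)"
      then show "multrow k q X $$ (i, j) = signed_swap (n - 1) k Y $$ (i, j)"
        using X Y k n False by (auto simp: signed_swap_index[of _ n] Y_def)
    qed (use X Y in auto)
    moreover note Y
    ultimately show ?thesis
      using X k n False last[of "signed_swap k (n - 1) X"]
      by (simp add: det_deg_signed_swap) (simp add: Y_def det_deg_signed_swap)
  qed (use X last in simp)
qed

text \<open>To the right of the diagonal, row r can be cleared by the unit rows below it. The proof
  runs backwards and restores the cleared entries one column at a time.\<close>

lemma det_deg_unit_row:
  assumes T: "T \<in> carrier_mat n n" and r: "r < n"
    and unit_below: "\<And>i j. i < n \<Longrightarrow> j < n \<Longrightarrow> r < i \<Longrightarrow> T $$ (i, j) = (if i = j then 1 else 0)"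
    and row: "\<And>j. j \<le> r \<Longrightarrow> T $$ (r, j) = (if j = r then 1 else 0)"
  shows "det_deg T = det_deg (mat n n (\<lambda>(i, j). if i = r then if j = r then 1 else 0 else T $$ (i, j)))"
proof -
  define U where "U J = mat n n (\<lambda>(i, j). if i = r
    then if j = r then 1 else if j \<in> J then T $$ (r, j) else 0 else T $$ (i, j))" for J
  have U: "U J \<in> carrier_mat n n" for J by (simp add: U_def)
  have "det_deg (U J) = det_deg (U {})" if "finite J" "J \<subseteq> {r<..<n}" for J
    using that
  proof induction
    case (insert j J)
    then have j: "r < j" "j < n" by auto
    have "U (insert j J) = addrow (T $$ (r, j)) r j (U J)"
      using insert.hyps j r unit_below[of j] by (intro eq_matI) (auto simp: U_def)
    then have "det_deg (U (insert j J)) = det_deg (U J)"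
      using det_deg_addrow[OF U r j(2)] j by simp
    then show ?case using insert by simp
  qed simp
  from this[of "{r<..<n}"] have "det_deg (U {r<..<n}) = det_deg (U {})" by blast
  moreover have "U {r<..<n} = T"
  proof (rule eq_matI)
    fix i j assume "i < dim_row T" "j < dim_col T"
    then show "U {r<..<n} $$ (i, j) = T $$ (i, j)"
      using T row[of j] by (cases "j \<le> r") (simp_all add: U_def)
  qed (use T in \<open>simp_all add: U_def\<close>)
  moreover have "U {}
      = mat n n (\<lambda>(i, j). if i = r then if j = r then 1 else 0 else T $$ (i, j))"
    by (rule eq_matI) (auto simp: U_def)
  ultimately show ?thesis by simp
qed

lemma det_deg_upper_triangular:
  assumes "T \<in> carrier_mat n n" "upper_triangular T" "\<And>i. i < n \<Longrightarrow> T $$ (i, i) \<noteq> 0"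
  shows "det_deg T = (\<Sum>i<n. frac_deg \<iota> (T $$ (i, i)))"
proof -
  \<comment> \<open>Generalised to matrices whose rows from r on are those of the identity. In the
    induction step row r is scaled to diagonal entry 1, which costs the degree of that entry, and is
    then cleared by the unit rows below.\<close>
  have "det_deg T = (\<Sum>i<r. frac_deg \<iota> (T $$ (i, i)))"
    if "r \<le> n" "T \<in> carrier_mat n n" "upper_triangular T" "\<And>i. i < r \<Longrightarrow> T $$ (i, i) \<noteq> 0"
      "\<And>i j. i < n \<Longrightarrow> j < n \<Longrightarrow> r \<le> i \<Longrightarrow> T $$ (i, j) = (if i = j then 1 else 0)" for r T
    using that
  proof (induction r arbitrary: T)
    case 0
    then have "T = 1\<^sub>m n" by (intro eq_matI) auto
    then show ?case by (simp add: det_deg_one)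
  next
    case (Suc r)
    define d where "d = T $$ (r, r)"
    have d: "d \<noteq> 0" and r: "r < n" using Suc.prems by (auto simp: d_def)
    define S where "S = multrow r (inverse d) T"
    have S: "S \<in> carrier_mat n n" using Suc.prems by (simp add: S_def)
    have zero: "T $$ (i, j) = 0" if "j < i" "i < n" for i j
      using upper_triangularD[OF Suc.prems(3) that(1)] that(2) Suc.prems(2) by simp
    have "T = multrow r d S"
      by (rule eq_matI) (use Suc.prems(2) d in \<open>auto simp: S_def simp flip: mult.assoc\<close>)
    then have 1: "det_deg T = frac_deg \<iota> d + det_deg S"
      using det_deg_multrow[OF S r d] by simp
    define U where "U = mat n n (\<lambda>(i, j). if i = r then if j = r then 1 else 0 else S $$ (i, j))"
    have Uij: "U $$ (i, j) = (if i = r then if j = r then 1 else 0 else T $$ (i, j))"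
      if "i < n" "j < n" for i j
      using that Suc.prems(2) by (auto simp: U_def S_def)
    have "det_deg S = det_deg U"
      unfolding U_def
    proof (rule det_deg_unit_row[OF S r])
      fix i j assume "i < n" "j < n" "r < i"
      then show "S $$ (i, j) = (if i = j then 1 else 0)"
        using Suc.prems(2,5) by (simp add: S_def)
    next
      fix j assume "j \<le> r"
      then show "S $$ (r, j) = (if j = r then 1 else 0)"
        using Suc.prems(2) zero[of j r] r d by (auto simp: S_def d_def)
    qed
    also have "\<dots> = (\<Sum>i<r. frac_deg \<iota> (U $$ (i, i)))"
    proof (rule Suc.IH)
      show "upper_triangular U"
      proof (rule upper_triangularI)
        fix i j assume "j < i" "i < dim_row U"
        then show "U $$ (i, j) = 0" using zero[of j i] Suc.prems(2) by (auto simp: U_def S_def)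
      qed
      show "U $$ (i, j) = (if i = j then 1 else 0)" if "i < n" "j < n" "r \<le> i" for i j
        using that Suc.prems(5)[of i j] by (auto simp: Uij)
      show "U $$ (i, i) \<noteq> 0" if "i < r" for i
        using that r Suc.prems(4)[of i] by (simp add: Uij)
    qed (use r in \<open>auto simp: U_def\<close>)
    also have "\<dots> = (\<Sum>i<r. frac_deg \<iota> (T $$ (i, i)))"
      using r by (intro sum.cong) (auto simp: Uij)
    finally show ?case using 1 by (simp add: d_def add.commute)
  qed
  from this[of n T] assms show ?thesis by auto
qed

lemma det_deg_embed_addrow:
  assumes "A \<in> carrier_mat n n" "k < n" "l < n" "k \<noteq> l"
  shows "det_deg (map_mat \<iota> (addrow a k l A)) = det_deg (map_mat \<iota> A)"
proof -
  interpret inj_ring_hom \<iota> using Q by (simp add: left_fraction_field_def)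
  have "map_mat \<iota> (addrow a k l A) = addrow (\<iota> a) k l (map_mat \<iota> A)"
    by (rule eq_matI) (use assms in \<open>auto simp: hom_add hom_mult\<close>)
  then show ?thesis using det_deg_addrow[of "map_mat \<iota> A" k l] assms by simp
qed

lemma det_deg_embed_upper_triangular:
  assumes T: "T \<in> carrier_mat n n" "upper_triangular T"
  shows "det_deg (map_mat \<iota> T) = (if \<exists>i<n. T $$ (i, i) = 0 then \<infinity>
    else ereal (real (\<Sum>i<n. ddegree (T $$ (i, i)))))"
proof -
  interpret inj_ring_hom \<iota> using Q by (simp add: left_fraction_field_def)
  have T': "map_mat \<iota> T \<in> carrier_mat n n" "upper_triangular (map_mat \<iota> T)"
    using T upper_triangularD[OF T(2)] by (auto intro!: upper_triangularI)
  show ?thesis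
  proof (cases "\<exists>i<n. T $$ (i, i) = 0")
    case True
    then show ?thesis
      using det_deg_not_invertible[OF T'(1)] upper_triangular_not_invertible[OF T'] T by auto
  next
    case False
    then have "det_deg (map_mat \<iota> T) = (\<Sum>i<n. frac_deg \<iota> (\<iota> (T $$ (i, i))))"
      using det_deg_upper_triangular[OF T'] T by auto
    also have "\<dots> = (\<Sum>i<n. ereal (real (ddegree (T $$ (i, i)))))"
      using False by (intro sum.cong) (auto simp: frac_deg_embedding[OF Q])
    finally show ?thesis using False by simp
  qed
qed

end


section \<open>Bases indexed by an initial segment of the naturals\<close>

context vectorspace
begin

text \<open>Families indexed by numbers rather than sets: matrices, coordinates and the condition in
  \<open>picard_vessiot\<close> refer to basis vectors by their number.\<close>

definition independent_family :: "(nat \<Rightarrow> 'c) \<Rightarrow> nat \<Rightarrow> bool" where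
  "independent_family e m \<longleftrightarrow> (\<forall>c\<in>{..<m} \<rightarrow> carrier K.
    (\<Oplus>\<^bsub>V\<^esub>i\<in>{..<m}. c i \<odot>\<^bsub>V\<^esub> e i) = \<zero>\<^bsub>V\<^esub> \<longrightarrow> (\<forall>i<m. c i = \<zero>\<^bsub>K\<^esub>))"

definition family_basis :: "(nat \<Rightarrow> 'c) \<Rightarrow> nat \<Rightarrow> bool" where
  "family_basis e m \<longleftrightarrow> e \<in> {..<m} \<rightarrow> carrier V \<and> independent_family e m \<and>
    (\<forall>v\<in>carrier V. \<exists>c\<in>{..<m} \<rightarrow> carrier K. v = (\<Oplus>\<^bsub>V\<^esub>i\<in>{..<m}. c i \<odot>\<^bsub>V\<^esub> e i))"

lemma lincomb_family:
  assumes "e \<in> {..<m} \<rightarrow> carrier V" "inj_on e {..<m}" "a \<in> e ` {..<m} \<rightarrow> carrier K"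
  shows "lincomb a (e ` {..<m}) = (\<Oplus>\<^bsub>V\<^esub>i\<in>{..<m}. a (e i) \<odot>\<^bsub>V\<^esub> e i)"
  unfolding lincomb_def by (rule M.finsum_reindex) (use assms in auto)

lemma independent_family_inj:
  assumes e: "e \<in> {..<m} \<rightarrow> carrier V" and ind: "independent_family e m"
  shows "inj_on e {..<m}"
proof (rule inj_onI, rule ccontr)
  fix i j assume ij: "i \<in> {..<m}" "j \<in> {..<m}" "e i = e j" "i \<noteq> j"
  define c where "c k = (if k = i then \<one>\<^bsub>K\<^esub> else if k = j then \<ominus>\<^bsub>K\<^esub> \<one>\<^bsub>K\<^esub> else \<zero>\<^bsub>K\<^esub>)" for k
  have c: "c k \<in> carrier K" for k by (auto simp: c_def)
  define S where "S = {..<m} - {i, j}"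
  have S: "finite S" "S \<subseteq> {..<m}" "i \<notin> S" "j \<notin> S" by (auto simp: S_def)
  have ei: "e i \<in> carrier V" using e ij by auto
  have mem: "(\<lambda>k. c k \<odot>\<^bsub>V\<^esub> e k) \<in> S \<rightarrow> carrier V" using S e c by auto
  have rest: "(\<Oplus>\<^bsub>V\<^esub>k\<in>S. c k \<odot>\<^bsub>V\<^esub> e k) = \<zero>\<^bsub>V\<^esub>"
  proof (rule M.add.finprod_one_eqI)
    fix k assume "k \<in> S"
    then have "e k \<in> carrier V" "c k = \<zero>\<^bsub>K\<^esub>" using S e by (auto simp: c_def)
    then show "c k \<odot>\<^bsub>V\<^esub> e k = \<zero>\<^bsub>V\<^esub>" by (simp add: smult_l_null)
  qed
  have "{..<m} = insert i (insert j S)" using ij by (auto simp: S_def)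
  then have "(\<Oplus>\<^bsub>V\<^esub>k\<in>{..<m}. c k \<odot>\<^bsub>V\<^esub> e k) = c i \<odot>\<^bsub>V\<^esub> e i \<oplus>\<^bsub>V\<^esub> (c j \<odot>\<^bsub>V\<^esub> e j \<oplus>\<^bsub>V\<^esub> \<zero>\<^bsub>V\<^esub>)"
    using S mem ei ij c by (simp add: rest)
  also have "\<dots> = \<zero>\<^bsub>V\<^esub>"
    using ei ij(3,4) by (simp add: c_def smult_l_minus M.r_neg)
  finally have "c i = \<zero>\<^bsub>K\<^esub>"
    using ind c ij unfolding independent_family_def by blast
  then show False by (simp add: c_def)
qed

lemma independent_family_iff:
  assumes e: "e \<in> {..<m} \<rightarrow> carrier V"
  shows "independent_family e m \<longleftrightarrow> inj_on e {..<m} \<and> lin_indpt (e ` {..<m})"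
proof
  assume ind: "independent_family e m"
  have inj: "inj_on e {..<m}" by (rule independent_family_inj[OF e ind])
  moreover have "lin_indpt (e ` {..<m})"
  proof (rule finite_lin_indpt2)
    show "e ` {..<m} \<subseteq> carrier V" using e by auto
    fix a assume a: "a \<in> e ` {..<m} \<rightarrow> carrier K" and 0: "lincomb a (e ` {..<m}) = \<zero>\<^bsub>V\<^esub>"
    have "(\<lambda>i. a (e i)) \<in> {..<m} \<rightarrow> carrier K" using a by auto
    moreover have "(\<Oplus>\<^bsub>V\<^esub>i\<in>{..<m}. a (e i) \<odot>\<^bsub>V\<^esub> e i) = \<zero>\<^bsub>V\<^esub>"
      using lincomb_family[OF e inj a] 0 by simp
    ultimately show "\<forall>v\<in>e ` {..<m}. a v = \<zero>\<^bsub>K\<^esub>"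
      using ind[unfolded independent_family_def, THEN bspec] by auto
  qed simp
  ultimately show "inj_on e {..<m} \<and> lin_indpt (e ` {..<m})" ..
next
  assume "inj_on e {..<m} \<and> lin_indpt (e ` {..<m})"
  then have inj: "inj_on e {..<m}" and li: "lin_indpt (e ` {..<m})" by auto
  show "independent_family e m"
    unfolding independent_family_def
  proof (intro ballI impI allI, rule ccontr)
    fix c i assume c: "c \<in> {..<m} \<rightarrow> carrier K" and i: "i < m" "c i \<noteq> \<zero>\<^bsub>K\<^esub>"
      and 0: "(\<Oplus>\<^bsub>V\<^esub>i\<in>{..<m}. c i \<odot>\<^bsub>V\<^esub> e i) = \<zero>\<^bsub>V\<^esub>"
    define a where "a v = c (the_inv_into {..<m} e v)" for v
    have ae: "a (e i) = c i" if "i < m" for i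
      using the_inv_into_f_f[OF inj, of i] that by (simp add: a_def)
    have a: "a \<in> e ` {..<m} \<rightarrow> carrier K" using c by (auto simp: ae)
    have "lincomb a (e ` {..<m}) = (\<Oplus>\<^bsub>V\<^esub>i\<in>{..<m}. c i \<odot>\<^bsub>V\<^esub> e i)"
      unfolding lincomb_family[OF e inj a] by (rule M.finsum_cong') (use c e ae in \<open>auto simp: Pi_iff\<close>)
    then have "lin_dep (e ` {..<m})"
      using i by (intro lin_dep_crit[of "e ` {..<m}" _ a "e i"]) (use a 0 ae in auto)
    with li show False by simp
  qed
qed

lemma family_basis_iff:
  assumes e: "e \<in> {..<m} \<rightarrow> carrier V"
  shows "family_basis e m \<longleftrightarrow> inj_on e {..<m} \<and> basis (e ` {..<m})"
proof -
  have sub: "e ` {..<m} \<subseteq> carrier V" using e by auto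
  have "gen_set (e ` {..<m}) \<longleftrightarrow>
      (\<forall>v\<in>carrier V. \<exists>c\<in>{..<m} \<rightarrow> carrier K. v = (\<Oplus>\<^bsub>V\<^esub>i\<in>{..<m}. c i \<odot>\<^bsub>V\<^esub> e i))"
    if inj: "inj_on e {..<m}"
  proof -
    have "span (e ` {..<m}) = {\<Oplus>\<^bsub>V\<^esub>i\<in>{..<m}. c i \<odot>\<^bsub>V\<^esub> e i | c. c \<in> {..<m} \<rightarrow> carrier K}"
      (is "_ = ?S")
    proof
      show "span (e ` {..<m}) \<subseteq> ?S"
      proof
        fix v assume "v \<in> span (e ` {..<m})"
        then obtain a where a: "a \<in> e ` {..<m} \<rightarrow> carrier K" "v = lincomb a (e ` {..<m})"
          using finite_span[OF _ sub] by auto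
        moreover have "(\<lambda>i. a (e i)) \<in> {..<m} \<rightarrow> carrier K" using a by auto
        ultimately show "v \<in> ?S" using lincomb_family[OF e inj a(1)]
          by (intro CollectI exI[of _ "\<lambda>i. a (e i)"]) auto
      qed
      show "?S \<subseteq> span (e ` {..<m})"
      proof
        fix v assume "v \<in> ?S"
        then obtain c where c: "c \<in> {..<m} \<rightarrow> carrier K" "v = (\<Oplus>\<^bsub>V\<^esub>i\<in>{..<m}. c i \<odot>\<^bsub>V\<^esub> e i)"
          by auto
        define a where "a v = c (the_inv_into {..<m} e v)" for v
        have ae: "a (e i) = c i" if "i < m" for i
          using the_inv_into_f_f[OF inj, of i] that by (simp add: a_def)
        have a: "a \<in> e ` {..<m} \<rightarrow> carrier K" using c by (auto simp: ae)
        have "v = lincomb a (e ` {..<m})"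
          unfolding lincomb_family[OF e inj a] c(2)
          by (rule M.finsum_cong') (use c e ae in \<open>auto simp: Pi_iff\<close>)
        then show "v \<in> span (e ` {..<m})" using finite_span[OF _ sub] a by auto
      qed
    qed
    then show ?thesis using span_is_subset2[OF sub] by blast
  qed
  then show ?thesis
    using independent_family_iff[OF e] e sub unfolding family_basis_def basis_def by blast
qed

lemma vdim_family_basis:
  assumes "family_basis e m"
  shows "vdim K V = enat m"
proof -
  have e: "e \<in> {..<m} \<rightarrow> carrier V" using assms by (simp add: family_basis_def)
  then have inj: "inj_on e {..<m}" and b: "basis (e ` {..<m})"
    using family_basis_iff assms by auto
  have "dim = m" using dim_basis[OF _ b] card_image[OF inj] by simp
  moreover have "fin_dim" using b unfolding fin_dim_def basis_def by blast
  ultimately show ?thesis by (simp add: vdim_def)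
qed

lemma vdim_infinite:
  assumes "\<And>i. x i \<in> carrier V" "\<And>m. independent_family x m"
  shows "vdim K V = \<infinity>"
proof -
  have "\<not> fin_dim"
  proof
    assume fd: "fin_dim"
    have x: "x \<in> {..<m} \<rightarrow> carrier V" for m using assms(1) by auto
    have "inj_on x {..<Suc dim} \<and> lin_indpt (x ` {..<Suc dim})"
      using independent_family_iff[OF x] assms(2) by blast
    then have "card (x ` {..<Suc dim}) \<le> dim" "card (x ` {..<Suc dim}) = Suc dim"
      using li_le_dim(2)[OF fd, of "x ` {..<Suc dim}"] assms(1) by (auto simp: card_image)
    then show False by simp
  qed
  then show ?thesis by (simp add: vdim_def)
qed

lemma family_basis_induct:
  assumes "family_basis e m" "v \<in> carrier V"
    and zero: "P \<zero>\<^bsub>V\<^esub>"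
    and smult: "\<And>a i. a \<in> carrier K \<Longrightarrow> i < m \<Longrightarrow> P (a \<odot>\<^bsub>V\<^esub> e i)"
    and add: "\<And>x y. x \<in> carrier V \<Longrightarrow> y \<in> carrier V \<Longrightarrow> P x \<Longrightarrow> P y \<Longrightarrow> P (x \<oplus>\<^bsub>V\<^esub> y)"
  shows "P v"
proof -
  obtain c where c: "c \<in> {..<m} \<rightarrow> carrier K" "v = (\<Oplus>\<^bsub>V\<^esub>i\<in>{..<m}. c i \<odot>\<^bsub>V\<^esub> e i)"
    and e: "e \<in> {..<m} \<rightarrow> carrier V"
    using assms by (auto simp: family_basis_def)
  have "P (\<Oplus>\<^bsub>V\<^esub>i\<in>S. c i \<odot>\<^bsub>V\<^esub> e i)" if "finite S" "S \<subseteq> {..<m}" for S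
    using that
  proof induction
    case (insert i S)
    then have "c i \<in> carrier K" "e i \<in> carrier V" "(\<lambda>i. c i \<odot>\<^bsub>V\<^esub> e i) \<in> S \<rightarrow> carrier V"
      using c e by (auto simp: Pi_iff subset_iff)
    with insert show ?case by (auto intro!: add smult M.finsum_closed)
  qed (simp add: zero)
  then show ?thesis by (simp add: c)
qed

text \<open>Coordinates are chosen for each vector; uniqueness of expansions makes the choice
  linear. They serve to define homomorphisms by their values on a basis.\<close>

lemma family_basis_coordinates:
  assumes "family_basis e m"
  obtains co where "\<And>v i. v \<in> carrier V \<Longrightarrow> i < m \<Longrightarrow> co v i \<in> carrier K"
    and "\<And>c i. c \<in> {..<m} \<rightarrow> carrier K \<Longrightarrow> i < m \<Longrightarrow>
      co (\<Oplus>\<^bsub>V\<^esub>i\<in>{..<m}. c i \<odot>\<^bsub>V\<^esub> e i) i = c i"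
    and "\<And>v w i. v \<in> carrier V \<Longrightarrow> w \<in> carrier V \<Longrightarrow> i < m \<Longrightarrow>
      co (v \<oplus>\<^bsub>V\<^esub> w) i = co v i \<oplus>\<^bsub>K\<^esub> co w i"
    and "\<And>a v i. a \<in> carrier K \<Longrightarrow> v \<in> carrier V \<Longrightarrow> i < m \<Longrightarrow>
      co (a \<odot>\<^bsub>V\<^esub> v) i = a \<otimes>\<^bsub>K\<^esub> co v i"
    and "\<And>i j. i < m \<Longrightarrow> j < m \<Longrightarrow> co (e i) j = (if i = j then \<one>\<^bsub>K\<^esub> else \<zero>\<^bsub>K\<^esub>)"
proof -
  have e: "e \<in> {..<m} \<rightarrow> carrier V" and ind: "independent_family e m"
    using assms by (auto simp: family_basis_def)
  define L where "L c = (\<Oplus>\<^bsub>V\<^esub>i\<in>{..<m}. c i \<odot>\<^bsub>V\<^esub> e i)" for c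
  have mem: "(\<lambda>i. d i \<odot>\<^bsub>V\<^esub> e i) \<in> {..<m} \<rightarrow> carrier V" if "d \<in> {..<m} \<rightarrow> carrier K" for d
    using that e by (auto simp: Pi_iff)
  have L: "L c \<in> carrier V" if "c \<in> {..<m} \<rightarrow> carrier K" for c
    unfolding L_def by (rule M.finsum_closed[OF mem[OF that]])
  have Ladd: "L (\<lambda>i. c i \<oplus>\<^bsub>K\<^esub> d i) = L c \<oplus>\<^bsub>V\<^esub> L d"
    if c: "c \<in> {..<m} \<rightarrow> carrier K" and d: "d \<in> {..<m} \<rightarrow> carrier K" for c d
  proof -
    have "L c \<oplus>\<^bsub>V\<^esub> L d = (\<Oplus>\<^bsub>V\<^esub>i\<in>{..<m}. c i \<odot>\<^bsub>V\<^esub> e i \<oplus>\<^bsub>V\<^esub> d i \<odot>\<^bsub>V\<^esub> e i)"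
      unfolding L_def by (rule M.finsum_addf[symmetric, OF mem[OF c] mem[OF d]])
    also have "\<dots> = L (\<lambda>i. c i \<oplus>\<^bsub>K\<^esub> d i)"
      unfolding L_def
      by (rule M.finsum_cong') (use c d e in \<open>auto simp: Pi_iff smult_l_distr\<close>)
    finally show ?thesis ..
  qed
  have Lsmult: "L (\<lambda>i. a \<otimes>\<^bsub>K\<^esub> c i) = a \<odot>\<^bsub>V\<^esub> L c"
    if a: "a \<in> carrier K" and c: "c \<in> {..<m} \<rightarrow> carrier K" for a c
  proof -
    have "a \<odot>\<^bsub>V\<^esub> L c = (\<Oplus>\<^bsub>V\<^esub>i\<in>{..<m}. a \<odot>\<^bsub>V\<^esub> (c i \<odot>\<^bsub>V\<^esub> e i))"
      unfolding L_def by (rule finsum_smult[OF a mem[OF c]])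
    also have "\<dots> = L (\<lambda>i. a \<otimes>\<^bsub>K\<^esub> c i)"
      unfolding L_def
      by (rule M.finsum_cong') (use a c e in \<open>auto simp: Pi_iff smult_assoc1\<close>)
    finally show ?thesis ..
  qed
  have "\<exists>co. \<forall>v\<in>carrier V. co v \<in> {..<m} \<rightarrow> carrier K \<and> v = L (co v)"
    using assms unfolding family_basis_def L_def by (intro bchoice) blast
  then obtain co where co: "\<And>v. v \<in> carrier V \<Longrightarrow> co v \<in> {..<m} \<rightarrow> carrier K"
    "\<And>v. v \<in> carrier V \<Longrightarrow> v = L (co v)" by blast
  have uniq: "co (L c) i = c i" if c: "c \<in> {..<m} \<rightarrow> carrier K" and i: "i < m" for c i
  proof -
    \<comment> \<open>Two expansions of the same vector differ by a linear relation, so all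
      \<open>d i\<close> vanish.\<close>
    define d where "d i = co (L c) i \<ominus>\<^bsub>K\<^esub> c i" for i
    have d: "d \<in> {..<m} \<rightarrow> carrier K" using co(1)[OF L[OF c]] c by (auto simp: d_def Pi_iff)
    have dc: "d i \<oplus>\<^bsub>K\<^esub> c i = co (L c) i" if "i < m" for i
      using co(1)[OF L[OF c]] c that by (auto simp: d_def Pi_iff R.minus_eq R.a_assoc R.l_neg)
    have "L d \<oplus>\<^bsub>V\<^esub> L c = L (co (L c))"
      unfolding Ladd[OF d c, symmetric] L_def[of "\<lambda>i. d i \<oplus>\<^bsub>K\<^esub> c i"] L_def[of "co _"]
      by (rule M.finsum_cong') (use mem[OF co(1)[OF L[OF c]]] dc in auto)
    then have "L d = \<zero>\<^bsub>V\<^esub>"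
      using co(2)[OF L[OF c]] L[OF c] L[OF d] by (metis M.add.r_cancel_one)
    then have "d i = \<zero>\<^bsub>K\<^esub>"
      using ind d i unfolding independent_family_def L_def by blast
    then show ?thesis using dc[OF i] c i by (auto simp: Pi_iff)
  qed
  have unit: "e i = L (\<lambda>j. if i = j then \<one>\<^bsub>K\<^esub> else \<zero>\<^bsub>K\<^esub>)" if i: "i < m" for i
  proof -
    have "L (\<lambda>j. if i = j then \<one>\<^bsub>K\<^esub> else \<zero>\<^bsub>K\<^esub>)
        = (\<Oplus>\<^bsub>V\<^esub>j\<in>{..<m}. if i = j then e j else \<zero>\<^bsub>V\<^esub>)"
      unfolding L_def by (rule M.finsum_cong') (use e in \<open>auto simp: Pi_iff\<close>)
    also have "\<dots> = e i"
      by (rule M.add.finprod_singleton) (use e i in auto)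
    finally show ?thesis ..
  qed
  show thesis
  proof (rule that[of co])
    show "co v i \<in> carrier K" if "v \<in> carrier V" "i < m" for v i
      using co(1) that by (auto simp: Pi_iff)
    show "co (\<Oplus>\<^bsub>V\<^esub>i\<in>{..<m}. c i \<odot>\<^bsub>V\<^esub> e i) i = c i"
      if "c \<in> {..<m} \<rightarrow> carrier K" "i < m" for c i
      using uniq[OF that] by (simp add: L_def)
    show "co (v \<oplus>\<^bsub>V\<^esub> w) i = co v i \<oplus>\<^bsub>K\<^esub> co w i" if "v \<in> carrier V" "w \<in> carrier V" "i < m" for v w i
      using uniq[of "\<lambda>i. co v i \<oplus>\<^bsub>K\<^esub> co w i" i] co(1)[OF that(1)] co(1)[OF that(2)] that
        Ladd[of "co v" "co w"] co(2)[symmetric] by (simp add: Pi_iff)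
    show "co (a \<odot>\<^bsub>V\<^esub> v) i = a \<otimes>\<^bsub>K\<^esub> co v i" if "a \<in> carrier K" "v \<in> carrier V" "i < m" for a v i
      using uniq[of "\<lambda>i. a \<otimes>\<^bsub>K\<^esub> co v i" i] co(1)[OF that(2)] that
        Lsmult[of a "co v"] co(2)[symmetric] by (simp add: Pi_iff)
    show "co (e i) j = (if i = j then \<one>\<^bsub>K\<^esub> else \<zero>\<^bsub>K\<^esub>)" if "i < m" "j < m" for i j
      using uniq[of "\<lambda>j. if i = j then \<one>\<^bsub>K\<^esub> else \<zero>\<^bsub>K\<^esub>" j] that unit[OF that(1)] by simp
  qed
qed

end


section \<open>Cokernels\<close>

definition row_module :: "nat \<Rightarrow> 'r :: ring_1 mat \<Rightarrow> 'r vec set" where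
  "row_module n A = (\<lambda>v. row_mult v A) ` carrier_vec n"

text \<open>The coset of v in terms of vectors, with v as right summand to match
  \<open>a_r_coset\<close>; computations in the quotient are carried out in this form.\<close>

definition coker_class :: "nat \<Rightarrow> 'r :: ring_1 mat \<Rightarrow> 'r vec \<Rightarrow> 'r vec set" where
  "coker_class n A v = (\<lambda>h. h + v) ` row_module n A"

lemma row_module_carrier: "A \<in> carrier_mat n n \<Longrightarrow> h \<in> row_module n A \<Longrightarrow> h \<in> carrier_vec n"
  by (auto simp: row_module_def row_mult_linear(3))

lemma row_module_add:
  "A \<in> carrier_mat n n \<Longrightarrow> g \<in> row_module n A \<Longrightarrow> h \<in> row_module n A \<Longrightarrow> g + h \<in> row_module n A"
  unfolding row_module_def
  by (auto simp: row_mult_linear(1)[symmetric] intro!: imageI)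

lemma row_module_smult:
  "A \<in> carrier_mat n n \<Longrightarrow> h \<in> row_module n A \<Longrightarrow> r \<cdot>\<^sub>v h \<in> row_module n A"
  unfolding row_module_def
  by (auto simp: row_mult_linear(2)[symmetric] intro!: imageI)

lemma row_module_zero: "A \<in> carrier_mat n n \<Longrightarrow> 0\<^sub>v n \<in> row_module n A"
  unfolding row_module_def
  by (rule image_eqI[of _ _ "0\<^sub>v n"]) (auto simp: row_mult_def intro!: eq_vecI)

lemma row_module_uminus:
  "A \<in> carrier_mat n n \<Longrightarrow> h \<in> row_module n A \<Longrightarrow> - h \<in> row_module n A"
proof -
  assume A: "A \<in> carrier_mat n n" and h: "h \<in> row_module n A"
  have "- 1 \<cdot>\<^sub>v h = - h" by (rule eq_vecI) auto
  then show ?thesis using row_module_smult[OF A h, of "- 1"] by simp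
qed

lemma coker_class_eq_iff:
  assumes A: "A \<in> carrier_mat n n" and v: "v \<in> carrier_vec n" and w: "w \<in> carrier_vec n"
  shows "coker_class n A v = coker_class n A w \<longleftrightarrow> v - w \<in> row_module n A"
proof
  assume eq: "coker_class n A v = coker_class n A w"
  have "v \<in> coker_class n A v"
    unfolding coker_class_def using v by (intro image_eqI[OF _ row_module_zero[OF A]]) auto
  then have "v \<in> coker_class n A w" by (simp only: eq)
  then obtain h where h: "h \<in> row_module n A" "v = h + w" by (auto simp: coker_class_def)
  then have "v - w = h" using w row_module_carrier[OF A h(1)] by (intro eq_vecI) auto
  with h show "v - w \<in> row_module n A" by simp
next
  have sub: "coker_class n A v \<subseteq> coker_class n A w"
    if "v - w \<in> row_module n A" "v \<in> carrier_vec n" "w \<in> carrier_vec n" for v w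
  proof
    fix x assume "x \<in> coker_class n A v"
    then obtain h where h: "h \<in> row_module n A" "x = h + v" by (auto simp: coker_class_def)
    then have "x = (h + (v - w)) + w"
      using that row_module_carrier[OF A h(1)] by (intro eq_vecI) auto
    then show "x \<in> coker_class n A w"
      unfolding coker_class_def using row_module_add[OF A h(1) that(1)] by blast
  qed
  assume vw: "v - w \<in> row_module n A"
  have "w - v = - (v - w)" using v w by (intro eq_vecI) auto
  then have "w - v \<in> row_module n A" using row_module_uminus[OF A vw] by simp
  with vw show "coker_class n A v = coker_class n A w" using sub v w by blast
qed

context
  fixes A :: "'r :: ring_1 mat" and n :: nat
  assumes A: "A \<in> carrier_mat n n"
begin

lemma coker_class_alt:
  "v \<in> carrier_vec n \<Longrightarrow> row_module n A +>\<^bsub>module_vec TYPE('r) n\<^esub> v = coker_class n A v"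
  by (auto simp: a_r_coset_def' coker_class_def module_vec_simps)

lemma cokernel_carrier: "carrier (cokernel_module n A) = coker_class n A ` carrier_vec n"
proof -
  have "carrier (cokernel_module n A)
      = (\<Union>v\<in>carrier_vec n. {row_module n A +>\<^bsub>module_vec TYPE('r) n\<^esub> v})"
    by (simp add: cokernel_module_def quotient_module_def A_RCOSETS_def' row_module_def
        module_vec_simps)
  then show ?thesis by (auto simp: coker_class_alt)
qed

lemma cokernel_zero: "\<zero>\<^bsub>cokernel_module n A\<^esub> = coker_class n A (0\<^sub>v n)"
proof -
  have "h + 0\<^sub>v n = h" if "h \<in> row_module n A" for h
    using row_module_carrier[OF A that] by simp
  then show ?thesis
    by (auto simp: cokernel_module_def quotient_module_def coker_class_def row_module_def)
qed

lemma cokernel_add: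
  assumes v: "v \<in> carrier_vec n" and w: "w \<in> carrier_vec n"
  shows "coker_class n A v \<oplus>\<^bsub>cokernel_module n A\<^esub> coker_class n A w = coker_class n A (v + w)"
proof -
  have "coker_class n A v \<oplus>\<^bsub>cokernel_module n A\<^esub> coker_class n A w
      = (\<Union>x\<in>coker_class n A v. \<Union>y\<in>coker_class n A w. {x + y})"
    by (simp add: cokernel_module_def quotient_module_def set_add_def' module_vec_simps)
  also have "\<dots> = coker_class n A (v + w)"
  proof (rule equalityI; rule subsetI)
    fix z assume "z \<in> (\<Union>x\<in>coker_class n A v. \<Union>y\<in>coker_class n A w. {x + y})"
    then obtain g h where gh: "g \<in> row_module n A" "h \<in> row_module n A" "z = (g + v) + (h + w)"
      by (auto simp: coker_class_def)
    then have "z = (g + h) + (v + w)"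
      using v w row_module_carrier[OF A gh(1)] row_module_carrier[OF A gh(2)]
      by (intro eq_vecI) (auto simp: ac_simps)
    then show "z \<in> coker_class n A (v + w)"
      using row_module_add[OF A gh(1,2)] by (auto simp: coker_class_def)
  next
    fix z assume "z \<in> coker_class n A (v + w)"
    then obtain h where h: "h \<in> row_module n A" "z = h + (v + w)" by (auto simp: coker_class_def)
    then have "z = (h + v) + (0\<^sub>v n + w)"
      using v w row_module_carrier[OF A h(1)] by (intro eq_vecI) (auto simp: ac_simps)
    then show "z \<in> (\<Union>x\<in>coker_class n A v. \<Union>y\<in>coker_class n A w. {x + y})"
      using h(1) row_module_zero[OF A] unfolding coker_class_def by blast
  qed
  finally show ?thesis .
qed

text \<open>The scalar action of \<open>quotient_module\<close> is a union over all representatives;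
  the row module is stable under r, so all cosets in the union coincide.\<close>

lemma cokernel_smult:
  assumes v: "v \<in> carrier_vec n"
  shows "r \<odot>\<^bsub>cokernel_module n A\<^esub> coker_class n A v = coker_class n A (r \<cdot>\<^sub>v v)"
proof -
  have eq: "coker_class n A (r \<cdot>\<^sub>v x) = coker_class n A (r \<cdot>\<^sub>v v)" if x: "x \<in> coker_class n A v" for x
  proof -
    obtain h where h: "h \<in> row_module n A" "x = h + v" using x by (auto simp: coker_class_def)
    have hc: "h \<in> carrier_vec n" by (rule row_module_carrier[OF A h(1)])
    then have "r \<cdot>\<^sub>v x - r \<cdot>\<^sub>v v = r \<cdot>\<^sub>v h"
      using v h by (intro eq_vecI) (auto simp: distrib_left)
    then have "r \<cdot>\<^sub>v x - r \<cdot>\<^sub>v v \<in> row_module n A"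
      using row_module_smult[OF A h(1), of r] by simp
    moreover have "r \<cdot>\<^sub>v x \<in> carrier_vec n" "r \<cdot>\<^sub>v v \<in> carrier_vec n" using v hc h(2) by simp_all
    ultimately show ?thesis using coker_class_eq_iff[OF A] by blast
  qed
  have carrier: "x \<in> carrier_vec n" if "x \<in> coker_class n A v" for x
    using that v row_module_carrier[OF A] by (auto simp: coker_class_def)
  have v_mem: "v \<in> coker_class n A v"
    unfolding coker_class_def using v by (intro image_eqI[OF _ row_module_zero[OF A]]) auto
  have const: "row_module n A +>\<^bsub>module_vec TYPE('r) n\<^esub> (r \<cdot>\<^sub>v x) = coker_class n A (r \<cdot>\<^sub>v v)"
    if x: "x \<in> coker_class n A v" for x
  proof -
    have "r \<cdot>\<^sub>v x \<in> carrier_vec n" using carrier[OF x] by simp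
    then show ?thesis using coker_class_alt eq[OF x] by simp
  qed
  have "(\<Union>x\<in>coker_class n A v. row_module n A +>\<^bsub>module_vec TYPE('r) n\<^esub> (r \<cdot>\<^sub>v x))
      = coker_class n A (r \<cdot>\<^sub>v v)"
    by (rule UN_constant_eq[OF v_mem]) (use const in blast)
  then show ?thesis
    unfolding cokernel_module_def quotient_module_def row_module_def[symmetric]
    by (simp add: coker_class_alt[OF v] module_vec_simps)
qed

end

lemma cokernel_module_eq:
  "row_module n A = row_module n B \<Longrightarrow> cokernel_module n A = cokernel_module n B"
  by (simp add: cokernel_module_def row_module_def)

lemma row_module_mult_subset:
  assumes "E \<in> carrier_mat n n" "A \<in> carrier_mat n n"
  shows "row_module n (E * A) \<subseteq> row_module n A"
proof
  fix w assume "w \<in> row_module n (E * A)"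
  then obtain v where v: "v \<in> carrier_vec n" "w = row_mult v (E * A)" by (auto simp: row_module_def)
  have "row_mult v (E * A) = row_mult (row_mult v E) A"
  proof (rule eq_vecI)
    fix j assume "j < dim_vec (row_mult (row_mult v E) A)"
    then have j: "j < n" using assms by (simp add: row_mult_def)
    have "row_mult v (E * A) $ j = (\<Sum>i<n. v $ i * (\<Sum>k<n. E $$ (i, k) * A $$ (k, j)))"
      using assms j by (subst row_mult_index) (auto simp: scalar_prod_def atLeast0LessThan)
    also have "\<dots> = (\<Sum>k<n. (\<Sum>i<n. v $ i * E $$ (i, k)) * A $$ (k, j))"
      unfolding sum_distrib_left sum_distrib_right
      by (subst sum.swap) (simp add: mult.assoc)
    also have "\<dots> = row_mult (row_mult v E) A $ j"
      using assms j by (simp add: row_mult_index)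
    finally show "row_mult v (E * A) $ j = row_mult (row_mult v E) A $ j" .
  qed (use assms in \<open>simp add: row_mult_def\<close>)
  then show "w \<in> row_module n A"
    using v row_mult_linear(3)[OF assms(1)] by (auto simp: row_module_def)
qed

lemma row_module_addrow:
  assumes A: "A \<in> carrier_mat n n" "k < n" "l < n" "k \<noteq> l"
  shows "row_module n (addrow a k l A) = row_module n A"
proof
  show "row_module n (addrow a k l A) \<subseteq> row_module n A"
    using row_module_mult_subset[of "addrow_mat n a k l" n A] A by (simp add: addrow_mat[of A n n])
  have "A = addrow (- a) k l (addrow a k l A)"
    by (rule eq_matI) (use A in auto)
  also have "\<dots> = addrow_mat n (- a) k l * addrow a k l A"
    using A by (intro addrow_mat) auto
  finally have "A = addrow_mat n (- a) k l * addrow a k l A" .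
  then show "row_module n A \<subseteq> row_module n (addrow a k l A)"
    using row_module_mult_subset[of "addrow_mat n (- a) k l" n "addrow a k l A"] A by simp
qed

lemma cokernel_finsum:
  fixes A :: "'k :: differential_field diffop mat"
    and c :: "nat \<Rightarrow> 'k" and m :: nat
  assumes A: "A \<in> carrier_mat n n" and v: "\<And>i. v i \<in> carrier_vec n"
  defines "W \<equiv> restrict_scalars dconst (cokernel_module n A)"
  shows "(\<Oplus>\<^bsub>W\<^esub>i\<in>{..<m}. c i \<odot>\<^bsub>W\<^esub> coker_class n A (v i))
    = coker_class n A (vec n (\<lambda>j. \<Sum>i<m. dconst (c i) * v i $ j))"
proof -
  interpret vectorspace class_ring W
    unfolding W_def by (rule vectorspace_restrict_scalars[OF left_module_cokernel_module[OF A]])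
  have cl: "coker_class n A w \<in> carrier W" if "w \<in> carrier_vec n" for w
    using that by (simp add: W_def restrict_scalars_def cokernel_carrier[OF A])
  have sm: "a \<odot>\<^bsub>W\<^esub> coker_class n A w = coker_class n A (dconst a \<cdot>\<^sub>v w)" if "w \<in> carrier_vec n" for a w
    using that by (simp add: W_def restrict_scalars_def cokernel_smult[OF A])
  have ad: "coker_class n A x \<oplus>\<^bsub>W\<^esub> coker_class n A y = coker_class n A (x + y)"
    if "x \<in> carrier_vec n" "y \<in> carrier_vec n" for x y
    using that by (simp add: W_def restrict_scalars_def cokernel_add[OF A])
  show ?thesis
  proof (induction m)
    case 0
    have "\<zero>\<^bsub>W\<^esub> = coker_class n A (0\<^sub>v n)"
      by (simp add: W_def restrict_scalars_def cokernel_zero[OF A])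
    then show ?case by (simp add: zero_vec_def)
  next
    case (Suc m)
    have eq: "dconst (c m) \<cdot>\<^sub>v v m + vec n (\<lambda>j. \<Sum>i<m. dconst (c i) * v i $ j)
        = vec n (\<lambda>j. \<Sum>i<Suc m. dconst (c i) * v i $ j)"
      by (rule eq_vecI) (use v[of m] in \<open>auto simp: add.commute\<close>)
    have "(\<Oplus>\<^bsub>W\<^esub>i\<in>insert m {..<m}. c i \<odot>\<^bsub>W\<^esub> coker_class n A (v i))
        = c m \<odot>\<^bsub>W\<^esub> coker_class n A (v m) \<oplus>\<^bsub>W\<^esub> (\<Oplus>\<^bsub>W\<^esub>i\<in>{..<m}. c i \<odot>\<^bsub>W\<^esub> coker_class n A (v i))"
      by (rule M.finsum_insert) (use cl v in \<open>auto simp: sm\<close>)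
    also have "\<dots> = coker_class n A (vec n (\<lambda>j. \<Sum>i<Suc m. dconst (c i) * v i $ j))"
      unfolding Suc.IH unfolding sm[OF v] using v[of m] by (subst ad) (auto simp: eq)
    finally show ?case by (simp add: lessThan_Suc)
  qed
qed


section \<open>The cokernel of a triangular matrix\<close>

text \<open>Division proceeds from left to right: a multiple of row r of \<open>T\<close> changes
  entries from column r on only, so remainders reached earlier persist.\<close>

lemma row_reduce:
  fixes T :: "'k :: differential_field diffop mat"
  assumes T: "T \<in> carrier_mat n n" "upper_triangular T" and nz: "\<And>i. i < n \<Longrightarrow> T $$ (i, i) \<noteq> 0"
    and v: "v \<in> carrier_vec n"
  obtains u where "u \<in> carrier_vec n"
    "\<And>j. j < n \<Longrightarrow> dsize (v $ j - row_mult u T $ j) \<le> ddegree (T $$ (j, j))"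
proof -
  have "\<exists>u\<in>carrier_vec n. \<forall>j<r. dsize (v $ j - row_mult u T $ j) \<le> ddegree (T $$ (j, j))"
    if "r \<le> n" for r
    using that
  proof (induction r)
    case 0
    show ?case by (intro bexI[of _ "0\<^sub>v n"]) auto
  next
    case (Suc r)
    then obtain u where u: "u \<in> carrier_vec n"
      "\<And>j. j < r \<Longrightarrow> dsize (v $ j - row_mult u T $ j) \<le> ddegree (T $$ (j, j))" by auto
    have r: "r < n" using Suc.prems by simp
    obtain q s where qs: "v $ r - row_mult u T $ r = q * T $$ (r, r) + s" "dsize s < dsize (T $$ (r, r))"
      using left_division[OF nz[OF r]] .
    define q' where "q' = q \<cdot>\<^sub>v unit_vec n r"
    have q': "q' \<in> carrier_vec n" by (simp add: q'_def)
    have row: "row_mult (u + q') T $ j = row_mult u T $ j + row_mult q' T $ j" if "j < n" for j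
      using row_mult_linear(1)[OF T(1) u(1) q'] row_mult_linear(3)[OF T(1), of q'] that by simp
    have low: "row_mult q' T $ j = 0" if "j < r" for j
      using row_mult_upper_triangular[OF T, of j q'] that r by (simp add: q'_def)
    have diag: "row_mult q' T $ r = q * T $$ (r, r)"
      using row_mult_upper_triangular[OF T r, of q'] r by (simp add: q'_def)
    have "dsize (v $ j - row_mult (u + q') T $ j) \<le> ddegree (T $$ (j, j))" if "j < Suc r" for j
    proof (cases "j = r")
      case True
      have "v $ r - row_mult (u + q') T $ r = s"
        using qs(1) by (simp add: row[OF r] diag algebra_simps)
      then show ?thesis using qs(2) nz[OF r] True by (simp add: dsize_def[of "T $$ _"])
    next
      case False
      then show ?thesis using that u(2)[of j] r by (simp add: row low)
    qed
    then show ?case using u(1) q' by (intro bexI[of _ "u + q'"]) auto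
  qed
  from this[of n] that show thesis by auto
qed

text \<open>Uniqueness of remainders: once the earlier entries of u are known to vanish, entry j of
  the product is \<open>u $ j * T $$ (j, j)\<close>, which is either 0 or of degree at least that of
  the diagonal entry.\<close>

lemma row_module_reduced_eq_0:
  fixes T :: "'k :: differential_field diffop mat"
  assumes T: "T \<in> carrier_mat n n" "upper_triangular T" and nz: "\<And>i. i < n \<Longrightarrow> T $$ (i, i) \<noteq> 0"
    and small: "\<And>j. j < n \<Longrightarrow> dsize (row_mult u T $ j) \<le> ddegree (T $$ (j, j))"
    and j: "j < n"
  shows "row_mult u T $ j = 0"
proof -
  have u0: "u $ j = 0" if "j < n" for j
    using that
  proof (induction j rule: less_induct)
    case (less j)
    have eq: "row_mult u T $ j = u $ j * T $$ (j, j)"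
      by (rule row_mult_upper_triangular[OF T]) (use less in auto)
    show ?case
    proof (rule ccontr)
      assume "u $ j \<noteq> 0"
      then have "dsize (row_mult u T $ j) = ddegree (u $ j) + Suc (ddegree (T $$ (j, j)))"
        using dsize_mult[of "u $ j" "T $$ (j, j)"] nz[OF less.prems] eq by (simp add: dsize_def)
      then show False using small[OF less.prems] by simp
    qed
  qed
  have "row_mult u T $ j = u $ j * T $$ (j, j)"
    by (rule row_mult_upper_triangular[OF T j]) (use u0 j in auto)
  then show ?thesis using u0[OF j] by simp
qed

lemma cokernel_triangular_basis:
  fixes T :: "'k :: differential_field diffop mat"
  assumes T: "T \<in> carrier_mat n n" "upper_triangular T" and nz: "\<And>i. i < n \<Longrightarrow> T $$ (i, i) \<noteq> 0"
  obtains e where "vectorspace.family_basis (class_ring :: 'k ring)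
    (restrict_scalars dconst (cokernel_module n T)) e (\<Sum>i<n. ddegree (T $$ (i, i)))"
proof -
  let ?W = "restrict_scalars dconst (cokernel_module n T)"
  interpret vectorspace "class_ring :: 'k ring" ?W
    by (rule vectorspace_restrict_scalars[OF left_module_cokernel_module[OF T(1)]])
  define d where "d i = ddegree (T $$ (i, i))" for i
  define m where "m = (\<Sum>i<n. d i)"
  \<comment> \<open>The label (i, k) stands for \<partial> to the power k times the i-th unit
    vector; \<open>h\<close> numbers the labels.\<close>
  define I where "I = (SIGMA i:{..<n}. {..<d i})"
  have "card I = m" "finite I" by (auto simp: I_def m_def)
  then obtain h where h: "bij_betw h {..<m} I"
    using ex_bij_betw_nat_finite[of I] by (auto simp: atLeast0LessThan)
  have inj: "h p = h q \<longleftrightarrow> p = q" if "p < m" "q < m" for p q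
    using bij_betw_imp_inj_on[OF h] that by (auto simp: inj_on_def)
  have h_mem: "fst (h p) < n" "snd (h p) < d (fst (h p))" if "p < m" for p
  proof -
    have "h p \<in> I" using bij_betwE[OF h] that by auto
    then show "fst (h p) < n" "snd (h p) < d (fst (h p))" by (auto simp: I_def)
  qed
  have h_surj: "\<exists>p<m. h p = (j, k)" if "j < n" "k < d j" for j k
  proof -
    have "(j, k) \<in> h ` {..<m}"
      unfolding bij_betw_imp_surj_on[OF h] using that by (simp add: I_def)
    then show ?thesis by auto
  qed
  define b where "b p = ddel ^ snd (h p) \<cdot>\<^sub>v (unit_vec n (fst (h p)) :: 'k diffop vec)" for p
  have b: "b p \<in> carrier_vec n" for p by (simp add: b_def)
  \<comment> \<open>The reduced vector with coefficient \<open>c p\<close> at label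
    \<open>h p\<close> and no other coefficients.\<close>
  define w where "w c = vec n (\<lambda>j. \<Sum>p<m. dconst (c p) * b p $ j)" for c
  have w: "w c \<in> carrier_vec n" for c by (simp add: w_def)
  have coeff: "dcoeff (w c $ j) k = (\<Sum>p<m. if h p = (j, k) then c p else 0)" if "j < n" for c j k
  proof -
    have "dcoeff (b p $ j) k = (if h p = (j, k) then 1 else 0)" for p
      using that by (cases "h p") (auto simp: b_def unit_vec_def)
    then show ?thesis using that by (auto simp: w_def dcoeff_sum intro!: sum.cong)
  qed
  have coeff_h: "dcoeff (w c $ fst (h p)) (snd (h p)) = c p" if "p < m" for c p
  proof -
    have "dcoeff (w c $ fst (h p)) (snd (h p)) = (\<Sum>q<m. if q = p then c q else 0)"
      unfolding coeff[OF h_mem(1)[OF that]] using that by (intro sum.cong) (auto simp: inj)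
    then show ?thesis using that by simp
  qed
  have coeff_0: "dcoeff (w c $ j) k = 0" if "j < n" "d j \<le> k" for c j k
    unfolding coeff[OF that(1)]
  proof (intro sum.neutral ballI)
    fix p assume "p \<in> {..<m}"
    then have "h p \<noteq> (j, k)" using h_mem(2)[of p] that(2) by auto
    then show "(if h p = (j, k) then c p else 0) = 0" by simp
  qed
  have lin: "(\<Oplus>\<^bsub>?W\<^esub>p\<in>{..<m}. c p \<odot>\<^bsub>?W\<^esub> coker_class n T (b p)) = coker_class n T (w c)" for c
    unfolding w_def by (rule cokernel_finsum[OF T(1) b])
  have "family_basis (\<lambda>p. coker_class n T (b p)) m"
    unfolding family_basis_def independent_family_def
  proof (intro conjI ballI impI allI)
    show "(\<lambda>p. coker_class n T (b p)) \<in> {..<m} \<rightarrow> carrier ?W"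
      using b by (auto simp: restrict_scalars_def cokernel_carrier[OF T(1)])
  next
    fix c p assume "(\<Oplus>\<^bsub>?W\<^esub>p\<in>{..<m}. c p \<odot>\<^bsub>?W\<^esub> coker_class n T (b p)) = \<zero>\<^bsub>?W\<^esub>" and p: "p < m"
    then have "coker_class n T (w c) = coker_class n T (0\<^sub>v n)"
      unfolding lin by (simp add: restrict_scalars_def cokernel_zero[OF T(1)])
    then have "w c - 0\<^sub>v n \<in> row_module n T"
      using coker_class_eq_iff[OF T(1) w] by simp
    moreover have "w c - 0\<^sub>v n = w c" using w by simp
    ultimately obtain u where u: "w c = row_mult u T" by (auto simp: row_module_def)
    have "row_mult u T $ j = 0" if "j < n" for j
    proof (rule row_module_reduced_eq_0[OF T nz _ that])
      fix j assume "j < n"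
      then show "dsize (row_mult u T $ j) \<le> ddegree (T $$ (j, j))"
        using coeff_0[of j _ c] unfolding dsize_le_iff u d_def by blast
    qed
    then show "c p = \<zero>\<^bsub>class_ring\<^esub>"
      using coeff_h[OF p, of c] h_mem(1)[OF p] by (simp add: u)
  next
    fix X assume "X \<in> carrier ?W"
    then obtain v where v: "v \<in> carrier_vec n" "X = coker_class n T v"
      by (auto simp: restrict_scalars_def cokernel_carrier[OF T(1)])
    obtain u where u: "u \<in> carrier_vec n"
      "\<And>j. j < n \<Longrightarrow> dsize (v $ j - row_mult u T $ j) \<le> d j"
      using row_reduce[OF T nz v(1)] unfolding d_def by blast
    \<comment> \<open>The coefficients are read off from the remainder of v.\<close>
    define c where "c p = dcoeff (v $ fst (h p) - row_mult u T $ fst (h p)) (snd (h p))" for p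
    have wc: "w c $ j = v $ j - row_mult u T $ j" if j: "j < n" for j
    proof (rule diffop_eqI)
      fix k
      show "dcoeff (w c $ j) k = dcoeff (v $ j - row_mult u T $ j) k"
      proof (cases "k < d j")
        case True
        then obtain p where "p < m" "h p = (j, k)" using h_surj[OF j] by blast
        then show ?thesis using coeff_h[of p c] by (simp add: c_def)
      next
        case False
        then show ?thesis
          using u(2)[OF j] coeff_0[OF j, of k c] unfolding dsize_le_iff by simp
      qed
    qed
    have "v - w c = row_mult u T"
      using v(1) w[of c] wc row_mult_linear(3)[OF T(1), of u] by (intro eq_vecI) auto
    then have "X = coker_class n T (w c)"
      using u(1) unfolding v(2) coker_class_eq_iff[OF T(1) v(1) w] row_module_def by blast
    then show "\<exists>c\<in>{..<m} \<rightarrow> carrier class_ring.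
        X = (\<Oplus>\<^bsub>?W\<^esub>p\<in>{..<m}. c p \<odot>\<^bsub>?W\<^esub> coker_class n T (b p))"
      unfolding lin by (intro bexI[of _ c]) auto
  qed
  then show thesis using that unfolding m_def d_def by blast
qed

text \<open>Back substitution, upwards from row i. It starts with the i-th unit vector, which solves
  the rows from i on because \<open>T $$ (i, i)\<close> and all entries below it vanish.\<close>

lemma triangular_null_vector:
  fixes T :: "'k :: differential_field diffop mat"
  assumes T: "T \<in> carrier_mat n n" "upper_triangular T" and i: "i < n" "T $$ (i, i) = 0"
    and nz: "\<And>j. j < i \<Longrightarrow> T $$ (j, j) \<noteq> 0"
  obtains x where "x i \<noteq> 0" "\<And>r. r < n \<Longrightarrow> (\<Sum>j<n. T $$ (r, j) * x j) = 0"
proof -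
  have "\<exists>x. x i \<noteq> 0 \<and> (\<forall>j>i. x j = 0) \<and> (\<forall>r. i - k \<le> r \<longrightarrow> r < n \<longrightarrow> (\<Sum>j<n. T $$ (r, j) * x j) = 0)"
    if "k \<le> i" for k
    using that
  proof (induction k)
    case 0
    have "(\<Sum>j<n. T $$ (r, j) * (if j = i then 1 else 0)) = 0" if "i \<le> r" "r < n" for r
    proof -
      have "(\<Sum>j<n. T $$ (r, j) * (if j = i then 1 else 0)) = (\<Sum>j<n. if j = i then T $$ (r, j) else 0)"
        by (rule sum.cong) auto
      also have "\<dots> = T $$ (r, i)" using i by simp
      also have "\<dots> = 0"
        using i that upper_triangularD[OF T(2), of i r] T(1) by (cases "r = i") auto
      finally show ?thesis .
    qed
    then show ?case by (intro exI[of _ "\<lambda>j. if j = i then 1 else 0"]) auto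
  next
    case (Suc k)
    then obtain x where x: "x i \<noteq> 0" "\<And>j. j > i \<Longrightarrow> x j = 0"
      "\<And>r. i - k \<le> r \<Longrightarrow> r < n \<Longrightarrow> (\<Sum>j<n. T $$ (r, j) * x j) = 0" by auto
    define s where "s = i - Suc k"
    have s: "s < i" "s < n" "Suc s = i - k" using Suc.prems i by (auto simp: s_def)
    \<comment> \<open>Row s can be solved for its diagonal unknown after multiplying the other
      entries on the right by a nonzero c. This preserves the rows already solved, and these have
      entry 0 in column s.\<close>
    obtain z c where zc: "c \<noteq> 0" "T $$ (s, s) * z = - (\<Sum>j\<in>{..<n} - {s}. T $$ (s, j) * x j) * c"
      using right_Ore[OF nz[OF s(1)]] .
    define y where "y j = (if j = s then z else x j * c)" for j
    have split: "(\<Sum>j<n. T $$ (r, j) * y j)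
        = T $$ (r, s) * z + (\<Sum>j\<in>{..<n} - {s}. T $$ (r, j) * x j) * c" for r
    proof -
      have "(\<Sum>j<n. T $$ (r, j) * y j) = T $$ (r, s) * y s + (\<Sum>j\<in>{..<n} - {s}. T $$ (r, j) * y j)"
        using s by (intro sum.remove) auto
      also have "(\<Sum>j\<in>{..<n} - {s}. T $$ (r, j) * y j) = (\<Sum>j\<in>{..<n} - {s}. T $$ (r, j) * x j * c)"
        by (rule sum.cong) (auto simp: y_def mult.assoc)
      finally show ?thesis by (simp add: y_def sum_distrib_right)
    qed
    have "(\<Sum>j<n. T $$ (r, j) * y j) = 0" if r: "s \<le> r" "r < n" for r
    proof (cases "r = s")
      case True
      then show ?thesis unfolding True split zc(2) by simp
    next
      case False
      have 0: "T $$ (r, s) = 0"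
        using upper_triangularD[OF T(2), of s r] T(1) r False by auto
      have "(\<Sum>j<n. T $$ (r, j) * x j) = T $$ (r, s) * x s + (\<Sum>j\<in>{..<n} - {s}. T $$ (r, j) * x j)"
        using s by (intro sum.remove) auto
      then have "(\<Sum>j\<in>{..<n} - {s}. T $$ (r, j) * x j) = 0"
        using x(3)[of r] s r False by (simp add: 0)
      then show ?thesis unfolding split by (simp add: 0)
    qed
    then show ?case
      using x(1,2) zc(1) s by (intro exI[of _ y]) (auto simp: y_def s_def)
  qed
  from this[of i] that show thesis by auto
qed

text \<open>A nonzero null vector is made unimodular by dividing it on the right by a generator of the
  left ideal spanned by its entries.\<close>

lemma unimodular_null_vector:
  fixes x :: "nat \<Rightarrow> 'k :: differential_field diffop"
  assumes "i < n" "x i \<noteq> 0"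
  obtains y u where "u \<in> carrier_vec n" "(\<Sum>j<n. u $ j * y j) = 1"
    "\<And>v. (\<Sum>j<n. v $ j * x j) = 0 \<Longrightarrow> (\<Sum>j<n. v $ j * y j) = 0"
proof -
  define p where "p v = (\<Sum>j<n. v $ j * x j)" for v
  have p_unit: "p (unit_vec n j) = x j" if "j < n" for j
  proof -
    have "p (unit_vec n j) = (\<Sum>k<n. if k = j then x k else 0)"
      unfolding p_def by (rule sum.cong) (use that in auto)
    then show ?thesis using that by simp
  qed
  have p_diff: "p (v - q \<cdot>\<^sub>v w) = p v - q * p w"
    if "v \<in> carrier_vec n" "w \<in> carrier_vec n" for v w q
  proof -
    have "p (v - q \<cdot>\<^sub>v w) = (\<Sum>j<n. v $ j * x j - q * (w $ j * x j))"
      unfolding p_def by (rule sum.cong) (use that in \<open>auto simp: left_diff_distrib mult.assoc\<close>)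
    then show ?thesis by (simp add: p_def sum_subtractf sum_distrib_left)
  qed
  define good where "good w \<longleftrightarrow> w \<in> carrier_vec n \<and> p w \<noteq> 0" for w
  have "good (unit_vec n i)" using assms p_unit by (simp add: good_def)
  \<comment> \<open>By division with remainder, a nonzero value of p of least size generates the
    left ideal of all values of p.\<close>
  define u where "u = arg_min (\<lambda>w. dsize (p w)) good"
  have u: "good u"
    unfolding u_def by (rule arg_min_natI) fact
  have u_min: "dsize (p u) \<le> dsize (p w)" if "good w" for w
    unfolding u_def by (rule arg_min_nat_le) fact
  have uc: "u \<in> carrier_vec n" and pu: "p u \<noteq> 0" using u by (auto simp: good_def)
  have "\<exists>q. x j = q * p u" if j: "j < n" for j
  proof -
    obtain q r where qr: "x j = q * p u + r" "dsize r < dsize (p u)" using left_division[OF pu] .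
    have "p (unit_vec n j - q \<cdot>\<^sub>v u) = r"
      using p_diff[of "unit_vec n j" u q] uc p_unit[OF j] qr(1) by simp
    then have "\<not> good (unit_vec n j - q \<cdot>\<^sub>v u)" using u_min[of "unit_vec n j - q \<cdot>\<^sub>v u"] qr(2) by auto
    then have "r = 0" using uc \<open>p (unit_vec n j - q \<cdot>\<^sub>v u) = r\<close> by (auto simp: good_def)
    then show ?thesis using qr(1) by auto
  qed
  then have "\<forall>j. \<exists>q. j < n \<longrightarrow> x j = q * p u" by blast
  from choice[OF this] obtain y where y: "\<And>j. j < n \<Longrightarrow> x j = y j * p u" by blast
  have py: "p v = (\<Sum>j<n. v $ j * y j) * p u" for v
    unfolding sum_distrib_right p_def[of v] by (rule sum.cong) (use y in \<open>auto simp: mult.assoc\<close>)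
  show thesis
  proof
    show "u \<in> carrier_vec n" by (rule uc)
    \<comment> \<open>The factorisation \<open>py\<close>, applied to u itself, can be cancelled by
      \<open>p u\<close> on the right; hence y is unimodular.\<close>
    have "(\<Sum>j<n. u $ j * y j) * p u = 1 * p u"
      unfolding mult_1 by (rule py[symmetric])
    then show "(\<Sum>j<n. u $ j * y j) = 1" using pu mult_right_cancel by blast
    fix v assume "(\<Sum>j<n. v $ j * x j) = 0"
    then have "(\<Sum>j<n. v $ j * y j) * p u = 0" unfolding py[symmetric] by (simp add: p_def)
    then show "(\<Sum>j<n. v $ j * y j) = 0" using pu by simp
  qed
qed


section \<open>Solution spaces\<close>

lemma der_of_nat [simp]: "der (of_nat k :: 'a :: differential_field) = 0"
  by (induction k) (auto simp: der_add)

lemma der_sum: "der (sum f S) = (\<Sum>x\<in>S. der (f x :: 'a :: differential_field))"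
  by (induction S rule: infinite_finite_induct) (auto simp: der_add)

lemma der_poly:
  fixes a :: "'a :: differential_field"
  shows "(\<And>i. der (coeff p i) = 0) \<Longrightarrow> der (poly p a) = poly (pderiv p) a * der a"
proof (induction p)
  case (pCons c p)
  have "der (coeff p i) = 0" for i using pCons.prems[of "Suc i"] by simp
  moreover have "der c = 0" using pCons.prems[of 0] by simp
  ultimately show ?case
    using pCons.IH by (simp add: pderiv_pCons der_add der_mult algebra_simps)
qed simp

text \<open>By the chain rule, a polynomial with constant coefficients that vanishes at a has a
  derivative that also vanishes at a, because \<open>der a\<close> is nonzero. This permits descent
  on the degree.\<close>

lemma nonconstant_transcendental:
  fixes a :: "'a :: {differential_field, field_char_0}"
  assumes a: "der a \<noteq> 0"
  shows "(\<And>i. der (coeff p i) = 0) \<Longrightarrow> poly p a = 0 \<Longrightarrow> p = 0"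
proof (induction "degree p" arbitrary: p rule: less_induct)
  case less
  show ?case
  proof (cases "degree p = 0")
    case True
    then show ?thesis using less.prems(2) by (auto elim: degree_eq_zeroE)
  next
    case False
    have "der (poly p a) = poly (pderiv p) a * der a" by (rule der_poly) (rule less.prems(1))
    then have "poly (pderiv p) a = 0" using less.prems(2) a by simp
    moreover have "der (coeff (pderiv p) i) = 0" for i
      by (simp add: coeff_pderiv der_mult less.prems(1) del: of_nat_Suc)
    moreover have "degree (pderiv p) < degree p" using False by (simp add: degree_pderiv)
    ultimately have "pderiv p = 0" using less.hyps by blast
    \<comment> \<open>Characteristic 0 enters here: a vanishing \<open>pderiv\<close> forces degree
      0.\<close>
    then show ?thesis using False by (simp add: pderiv_eq_0_iff)
  qed
qed

lemma powers_independent: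
  fixes a :: "'a :: {differential_field, field_char_0}"
  assumes a: "der a \<noteq> 0" and c: "\<And>j. j < m \<Longrightarrow> der (c j) = 0"
    and sum: "(\<Sum>j<m. c j * a ^ j) = 0" and j: "j < m"
  shows "c j = 0"
proof -
  define p where "p = (\<Sum>j<m. monom (c j) j)"
  have coeff: "coeff p i = (if i < m then c i else 0)" for i
    by (auto simp: p_def coeff_sum)
  have "poly p a = 0" using sum by (simp add: p_def poly_sum poly_monom)
  then have "p = 0" using c by (intro nonconstant_transcendental[OF a]) (simp_all add: coeff)
  then show ?thesis using coeff[of j] j by simp
qed

section \<open>Operators acting on a single vector of a left module\<close>

lemma left_moduleD:
  assumes "left_module M"
  shows "abelian_group M"
    and "x \<in> carrier M \<Longrightarrow> r \<odot>\<^bsub>M\<^esub> x \<in> carrier M"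
    and "x \<in> carrier M \<Longrightarrow> 1 \<odot>\<^bsub>M\<^esub> x = x"
    and "x \<in> carrier M \<Longrightarrow> (r * s) \<odot>\<^bsub>M\<^esub> x = r \<odot>\<^bsub>M\<^esub> (s \<odot>\<^bsub>M\<^esub> x)"
    and "x \<in> carrier M \<Longrightarrow> (r + s) \<odot>\<^bsub>M\<^esub> x = r \<odot>\<^bsub>M\<^esub> x \<oplus>\<^bsub>M\<^esub> (s \<odot>\<^bsub>M\<^esub> x)"
    and "x \<in> carrier M \<Longrightarrow> y \<in> carrier M \<Longrightarrow> r \<odot>\<^bsub>M\<^esub> (x \<oplus>\<^bsub>M\<^esub> y) = r \<odot>\<^bsub>M\<^esub> x \<oplus>\<^bsub>M\<^esub> (r \<odot>\<^bsub>M\<^esub> y)"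
  using assms unfolding left_module_def by blast+

lemma left_module_zero_smult:
  assumes M: "left_module M" and x: "x \<in> carrier M"
  shows "0 \<odot>\<^bsub>M\<^esub> x = \<zero>\<^bsub>M\<^esub>"
proof -
  interpret abelian_group M by (rule left_moduleD(1)[OF M])
  have "0 \<odot>\<^bsub>M\<^esub> x \<oplus>\<^bsub>M\<^esub> 0 \<odot>\<^bsub>M\<^esub> x = 0 \<odot>\<^bsub>M\<^esub> x"
    using left_moduleD(5)[OF M x, of 0 0] by simp
  then show ?thesis using left_moduleD(2)[OF M x, of 0] by (metis add.l_cancel_one)
qed

lemma operator_finsum:
  fixes M :: "('k :: differential_field diffop, 'm) module" and c :: "nat \<Rightarrow> 'k" and N :: nat
  assumes M: "left_module M" and x: "x \<in> carrier M"
  shows "(\<Oplus>\<^bsub>restrict_scalars dconst M\<^esub>j\<in>{..<N}. c j \<odot>\<^bsub>restrict_scalars dconst M\<^esub> (ddel ^ j \<odot>\<^bsub>M\<^esub> x))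
    = (\<Sum>j<N. dconst (c j) * ddel ^ j) \<odot>\<^bsub>M\<^esub> x"
proof -
  let ?W = "restrict_scalars dconst M"
  interpret W: vectorspace "class_ring :: 'k ring" ?W
    by (rule vectorspace_restrict_scalars[OF M])
  note lm = left_moduleD[OF M]
  show ?thesis
  proof (induction N)
    case 0
    have "\<zero>\<^bsub>restrict_scalars dconst M\<^esub> = \<zero>\<^bsub>M\<^esub>" by (simp add: restrict_scalars_def)
    then show ?case by (simp add: left_module_zero_smult[OF M x])
  next
    case (Suc N)
    have "(\<Oplus>\<^bsub>?W\<^esub>j\<in>insert N {..<N}. c j \<odot>\<^bsub>?W\<^esub> (ddel ^ j \<odot>\<^bsub>M\<^esub> x))
        = c N \<odot>\<^bsub>?W\<^esub> (ddel ^ N \<odot>\<^bsub>M\<^esub> x) \<oplus>\<^bsub>?W\<^esub> (\<Oplus>\<^bsub>?W\<^esub>j\<in>{..<N}. c j \<odot>\<^bsub>?W\<^esub> (ddel ^ j \<odot>\<^bsub>M\<^esub> x))"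
      by (rule W.M.finsum_insert) (auto simp: restrict_scalars_def lm(2) x)
    also have "\<dots> = (dconst (c N) * ddel ^ N) \<odot>\<^bsub>M\<^esub> x \<oplus>\<^bsub>M\<^esub> (\<Sum>j<N. dconst (c j) * ddel ^ j) \<odot>\<^bsub>M\<^esub> x"
      unfolding Suc by (simp add: restrict_scalars_def lm(4) x)
    also have "\<dots> = (\<Sum>j<Suc N. dconst (c j) * ddel ^ j) \<odot>\<^bsub>M\<^esub> x"
      by (simp add: lm(5)[OF x, symmetric] add.commute)
    finally show ?case by (simp add: lessThan_Suc)
  qed
qed

lemma dcoeff_operator:
  "dcoeff (\<Sum>j<N. dconst (c j) * ddel ^ j) i = (if i < N then c i else 0)"
proof -
  have "dcoeff (\<Sum>j<N. dconst (c j) * ddel ^ j) i = (\<Sum>j<N. if j = i then c j else 0)"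
    unfolding dcoeff_sum by (rule sum.cong) auto
  then show ?thesis by simp
qed

text \<open>The map \<pi> turns an operator applied to u back into that operator, so the powers of
  \<partial> applied to u are independent over k.\<close>

lemma vdim_free_quotient:
  fixes M :: "('k :: differential_field diffop, 'm) module" and \<pi> :: "'m \<Rightarrow> 'k diffop"
  assumes M: "left_module M"
    and smult: "\<And>r x. x \<in> carrier M \<Longrightarrow> \<pi> (r \<odot>\<^bsub>M\<^esub> x) = r * \<pi> x"
    and u: "u \<in> carrier M" "\<pi> u = 1"
  shows "vdim (class_ring :: 'k ring) (restrict_scalars dconst M) = \<infinity>"
proof -
  let ?W = "restrict_scalars dconst M"
  interpret W: vectorspace "class_ring :: 'k ring" ?W
    by (rule vectorspace_restrict_scalars[OF M])
  show ?thesis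
  proof (rule W.vdim_infinite)
    show "ddel ^ j \<odot>\<^bsub>M\<^esub> u \<in> carrier ?W" for j
      by (simp add: restrict_scalars_def left_moduleD(2)[OF M] u)
    fix N
    show "W.independent_family (\<lambda>j. ddel ^ j \<odot>\<^bsub>M\<^esub> u) N"
      unfolding W.independent_family_def operator_finsum[OF M u(1)]
    proof (intro ballI impI allI)
      fix c :: "nat \<Rightarrow> 'k" and i
      assume "(\<Sum>j<N. dconst (c j) * ddel ^ j) \<odot>\<^bsub>M\<^esub> u = \<zero>\<^bsub>?W\<^esub>" and i: "i < N"
      \<comment> \<open>Zero is written as a multiple of u, since \<pi> is only known to respect
        scalars.\<close>
      then have "(\<Sum>j<N. dconst (c j) * ddel ^ j) \<odot>\<^bsub>M\<^esub> u = 0 \<odot>\<^bsub>M\<^esub> u"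
        by (simp add: restrict_scalars_def left_module_zero_smult[OF M u(1)])
      then have "\<pi> ((\<Sum>j<N. dconst (c j) * ddel ^ j) \<odot>\<^bsub>M\<^esub> u) = \<pi> (0 \<odot>\<^bsub>M\<^esub> u)" by (rule arg_cong)
      then have "(\<Sum>j<N. dconst (c j) * ddel ^ j) = 0"
        unfolding smult[OF u(1)] u(2) by simp
      then show "c i = \<zero>\<^bsub>class_ring\<^esub>"
        using dcoeff_operator[of c N i] i by simp
    qed
  qed
qed

section \<open>Homomorphisms into the extension field\<close>

context
  fixes M :: "('k :: differential_field diffop, 'm) module"
    and emb :: "'k \<Rightarrow> 'l :: differential_field"
  assumes M: "left_module M" and ext: "differential_extension emb"
begin

interpretation field_hom emb
  using ext by (simp add: differential_extension_def)

interpretation M: abelian_group M by (rule left_moduleD(1)[OF M])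

interpretation S: vectorspace "constant_field :: 'k ring" "solution_space emb M"
  by (rule vectorspace_solution_space[OF M ext])

interpretation W: vectorspace "class_ring :: 'k ring" "restrict_scalars dconst M"
  by (rule vectorspace_restrict_scalars[OF M])

text \<open>R is generated by k and \<partial>, so compatibility with these already gives linearity
  over R, by expanding an operator in powers of \<partial>.\<close>

lemma solution_iff:
  "f \<in> carrier (solution_space emb M) \<longleftrightarrow> f \<in> extensional (carrier M) \<and>
    (\<forall>x\<in>carrier M. \<forall>y\<in>carrier M. f (x \<oplus>\<^bsub>M\<^esub> y) = f x + f y) \<and>
    (\<forall>a. \<forall>x\<in>carrier M. f (dconst a \<odot>\<^bsub>M\<^esub> x) = emb a * f x) \<and>
    (\<forall>x\<in>carrier M. f (ddel \<odot>\<^bsub>M\<^esub> x) = der (f x))"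
proof -
  have "f (r \<odot>\<^bsub>M\<^esub> x) = r \<odot>\<^bsub>extension_module emb\<^esub> f x"
    if add: "\<And>x y. x \<in> carrier M \<Longrightarrow> y \<in> carrier M \<Longrightarrow> f (x \<oplus>\<^bsub>M\<^esub> y) = f x + f y"
      and const: "\<And>a x. x \<in> carrier M \<Longrightarrow> f (dconst a \<odot>\<^bsub>M\<^esub> x) = emb a * f x"
      and del: "\<And>x. x \<in> carrier M \<Longrightarrow> f (ddel \<odot>\<^bsub>M\<^esub> x) = der (f x)"
      and x: "x \<in> carrier M" for r x
  proof -
    note m = left_moduleD[OF M]
    have pow: "f (ddel ^ i \<odot>\<^bsub>M\<^esub> x) = (der ^^ i) (f x)" for i
      by (induction i) (simp_all add: m(2,3,4) x del)
    have zero: "f (0 \<odot>\<^bsub>M\<^esub> x) = 0" using const[OF x, of 0] by (simp add: dconst_ring_hom)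
    have sum: "f (sum g I \<odot>\<^bsub>M\<^esub> x) = (\<Sum>i\<in>I. f (g i \<odot>\<^bsub>M\<^esub> x))" for g and I :: "nat set"
      by (induction I rule: infinite_finite_induct) (simp_all add: zero m(2,5) x add)
    have "f (r \<odot>\<^bsub>M\<^esub> x) = (\<Sum>i\<le>ddegree r. f ((dconst (dcoeff r i) * ddel ^ i) \<odot>\<^bsub>M\<^esub> x))"
      by (subst diffop_expand[of r]) (rule sum)
    also have "\<dots> = (\<Sum>i\<le>ddegree r. emb (dcoeff r i) * (der ^^ i) (f x))"
      by (simp add: m(2,4) x const pow)
    finally show ?thesis by (simp add: extension_module_def)
  qed
  then show ?thesis
    unfolding solution_space_def LinearCombinations.module_hom_def
    by (auto simp: extension_module_simps[OF ext]) (auto simp: extension_module_def)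
qed

lemma solution_sum:
  fixes m :: nat
  assumes "\<And>j. j < m \<Longrightarrow> f j \<in> carrier (solution_space emb M)"
    and "\<And>j. j < m \<Longrightarrow> c j \<in> carrier (constant_field :: 'k ring)" and x: "x \<in> carrier M"
  shows "(\<Oplus>\<^bsub>solution_space emb M\<^esub>j\<in>{..<m}. c j \<odot>\<^bsub>solution_space emb M\<^esub> f j) x
    = (\<Sum>j<m. emb (c j) * f j x)"
  using assms(1,2)
proof (induction m)
  case 0
  have "\<zero>\<^bsub>solution_space emb M\<^esub> x = 0" using x by (simp add: solution_space_def)
  then show ?case by simp
next
  case (Suc m)
  have "(\<Oplus>\<^bsub>solution_space emb M\<^esub>j\<in>insert m {..<m}. c j \<odot>\<^bsub>solution_space emb M\<^esub> f j)
      = c m \<odot>\<^bsub>solution_space emb M\<^esub> f m \<oplus>\<^bsub>solution_space emb M\<^esub>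
        (\<Oplus>\<^bsub>solution_space emb M\<^esub>j\<in>{..<m}. c j \<odot>\<^bsub>solution_space emb M\<^esub> f j)"
    by (rule S.M.finsum_insert) (use Suc.prems in \<open>auto intro!: S.smult_closed\<close>)
  moreover have "(c m \<odot>\<^bsub>solution_space emb M\<^esub> f m \<oplus>\<^bsub>solution_space emb M\<^esub> g) x = emb (c m) * f m x + g x"
    for g using x by (simp add: solution_space_def)
  ultimately show ?case using Suc by (simp add: lessThan_Suc add.commute)
qed

text \<open>An element of l determines a homomorphism from R to l, and composing with \<pi> gives a
  solution. Independence of the powers of a is a premise because the type of k carries no assumption
  on the characteristic here.\<close>

lemma vdim_solution_space_free_quotient:
  fixes \<pi> :: "'m \<Rightarrow> 'k diffop" and a :: 'k
  assumes add: "\<And>x y. x \<in> carrier M \<Longrightarrow> y \<in> carrier M \<Longrightarrow> \<pi> (x \<oplus>\<^bsub>M\<^esub> y) = \<pi> x + \<pi> y"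
    and smult: "\<And>r x. x \<in> carrier M \<Longrightarrow> \<pi> (r \<odot>\<^bsub>M\<^esub> x) = r * \<pi> x"
    and u: "u \<in> carrier M" "\<pi> u = 1"
    and powers: "\<And>N c j. (\<And>j. j < N \<Longrightarrow> der (c j) = 0) \<Longrightarrow> (\<Sum>j<N. c j * a ^ j) = 0 \<Longrightarrow> j < N \<Longrightarrow> c j = 0"
  shows "vdim (constant_field :: 'k ring) (solution_space emb M) = \<infinity>"
proof (rule S.vdim_infinite)
  let ?S = "solution_space emb M" and ?E = "extension_module emb"
  \<comment> \<open>Its value at u is \<open>emb (a ^ j)\<close>, so a relation between these
    solutions, evaluated at u, becomes a relation between powers of a.\<close>
  define f where "f j = (\<lambda>x\<in>carrier M. \<pi> x \<odot>\<^bsub>?E\<^esub> emb (a ^ j))" for j :: nat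
  note E = left_moduleD[OF left_module_extension_module[OF ext]]
  have E_univ: "y \<in> carrier ?E" "y \<oplus>\<^bsub>?E\<^esub> z = y + z" for y z
    by (simp_all add: extension_module_def)
  show mem: "f j \<in> carrier ?S" for j
    unfolding solution_iff
    using E(4,5)[OF E_univ(1)]
    by (auto simp: f_def left_moduleD[OF M] add smult E_univ(2) extension_module_simps[OF ext])
  fix N
  show "S.independent_family f N"
    unfolding S.independent_family_def
  proof (intro ballI impI allI)
    fix c i
    assume c: "c \<in> {..<N} \<rightarrow> carrier (constant_field :: 'k ring)" and i: "i < N"
      and 0: "(\<Oplus>\<^bsub>?S\<^esub>j\<in>{..<N}. c j \<odot>\<^bsub>?S\<^esub> f j) = \<zero>\<^bsub>?S\<^esub>"
    have "\<zero>\<^bsub>?S\<^esub> u = 0" using u(1) by (simp add: solution_space_def)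
    then have "(\<Sum>j<N. emb (c j) * f j u) = 0"
      using solution_sum[of N f c u] mem c u(1) 0 by (auto simp: Pi_iff)
    then have "emb (\<Sum>j<N. c j * a ^ j) = 0"
      using u E(3)[OF E_univ(1)] by (simp add: f_def hom_sum hom_mult)
    then have "(\<Sum>j<N. c j * a ^ j) = 0" by simp
    then have "c i = 0"
      using c i by (intro powers[of N c]) (auto simp: Pi_iff constant_field_def constants_def)
    then show "c i = \<zero>\<^bsub>constant_field\<^esub>" by (simp add: constant_field_def)
  qed
qed

lemma solution_eqI:
  assumes b: "W.family_basis e m"
    and f: "f \<in> carrier (solution_space emb M)" and g: "g \<in> carrier (solution_space emb M)"
    and eq: "\<And>i. i < m \<Longrightarrow> f (e i) = g (e i)"
  shows "f = g"
proof (rule extensionalityI[of _ "carrier M"])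
  show "f \<in> extensional (carrier M)" "g \<in> extensional (carrier M)"
    using f g by (auto simp: solution_iff)
  fix x assume "x \<in> carrier M"
  then have "x \<in> carrier (restrict_scalars dconst M)" by (simp add: restrict_scalars_def)
  with b show "f x = g x"
  proof (rule W.family_basis_induct)
    have "e \<in> {..<m} \<rightarrow> carrier (restrict_scalars dconst M)"
      using b unfolding W.family_basis_def by (rule conjunct1)
    then have e: "e i \<in> carrier M" if "i < m" for i
      using that by (auto simp: restrict_scalars_def)
    show "f (a \<odot>\<^bsub>restrict_scalars dconst M\<^esub> e i) = g (a \<odot>\<^bsub>restrict_scalars dconst M\<^esub> e i)"
      if "i < m" for a i
      using f g e[OF that] eq[OF that] by (simp add: restrict_scalars_def solution_iff)
    have "f \<zero>\<^bsub>M\<^esub> = f \<zero>\<^bsub>M\<^esub> + f \<zero>\<^bsub>M\<^esub>" "g \<zero>\<^bsub>M\<^esub> = g \<zero>\<^bsub>M\<^esub> + g \<zero>\<^bsub>M\<^esub>"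
      using f g unfolding solution_iff by (metis M.zero_closed M.l_zero)+
    then have "f \<zero>\<^bsub>M\<^esub> = 0" "g \<zero>\<^bsub>M\<^esub> = 0" by (simp_all only: add_cancel_right_right)
    then show "f \<zero>\<^bsub>restrict_scalars dconst M\<^esub> = g \<zero>\<^bsub>restrict_scalars dconst M\<^esub>"
      by (simp add: restrict_scalars_def)
  qed (use f g in \<open>auto simp: restrict_scalars_def solution_iff\<close>)
qed

text \<open>A solution is determined by its values \<open>y\<close> on the basis, which form a solution of
  \<open>y' = B y\<close>. Writing \<open>y = F c\<close> turns this equation into \<open>c' = 0\<close>.\<close>

lemma vdim_solution_space_finite:
  assumes b: "W.family_basis e m" and B: "B \<in> carrier_mat m m"
    and del: "\<And>i. i < m \<Longrightarrow> ddel \<odot>\<^bsub>M\<^esub> e i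
      = (\<Oplus>\<^bsub>restrict_scalars dconst M\<^esub>j\<in>{..<m}. B $$ (i, j) \<odot>\<^bsub>restrict_scalars dconst M\<^esub> e j)"
    and F: "fundamental_matrix emb m B F" and C: "constants = emb ` constants"
  shows "vdim (constant_field :: 'k ring) (solution_space emb M) = enat m"
proof -
  let ?W = "restrict_scalars dconst M" and ?S = "solution_space emb M"
  note m = left_moduleD[OF M]
  have W: "carrier ?W = carrier M" "x \<oplus>\<^bsub>?W\<^esub> y = x \<oplus>\<^bsub>M\<^esub> y" "a \<odot>\<^bsub>?W\<^esub> x = dconst a \<odot>\<^bsub>M\<^esub> x" for x y a
    by (simp_all add: restrict_scalars_def)
  have emb_der: "der (emb a) = emb (der a)" for a
    using ext by (simp add: differential_extension_def)
  have "e \<in> {..<m} \<rightarrow> carrier ?W"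
    using b unfolding W.family_basis_def by (rule conjunct1)
  then have e: "e i \<in> carrier M" if "i < m" for i
    using that by (auto simp: W)
  have Fc: "F \<in> carrier_mat m m" and F': "map_mat der F = map_mat emb B * F"
    and inv: "invertible_mat F" using F by (auto simp: fundamental_matrix_def)
  obtain G where FG: "F * G = 1\<^sub>m m" and GF: "G * F = 1\<^sub>m (dim_row G)"
    using inv Fc unfolding invertible_mat_def inverts_mat_def by auto
  have Gc: "G \<in> carrier_mat m m"
    using arg_cong[OF FG, of dim_col] arg_cong[OF GF, of dim_col] Fc by auto
  then have GF: "G * F = 1\<^sub>m m" using GF by simp
  have derF: "der (F $$ (i, j)) = (\<Sum>k<m. emb (B $$ (i, k)) * F $$ (k, j))" if "i < m" "j < m" for i j
  proof -
    have "der (F $$ (i, j)) = (map_mat emb B * F) $$ (i, j)"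
      unfolding F'[symmetric] using Fc that by simp
    then show ?thesis using that B Fc by (simp add: scalar_prod_def atLeast0LessThan)
  qed
  obtain co where
    co_lin: "\<And>c i. i < m \<Longrightarrow> co (\<Oplus>\<^bsub>?W\<^esub>i\<in>{..<m}. c i \<odot>\<^bsub>?W\<^esub> e i) i = c i"
    and co_add: "\<And>v w i. v \<in> carrier M \<Longrightarrow> w \<in> carrier M \<Longrightarrow> i < m \<Longrightarrow> co (v \<oplus>\<^bsub>M\<^esub> w) i = co v i + co w i"
    and co_smult: "\<And>a v i. v \<in> carrier M \<Longrightarrow> i < m \<Longrightarrow> co (dconst a \<odot>\<^bsub>M\<^esub> v) i = a * co v i"
    and co_e: "\<And>i j. i < m \<Longrightarrow> j < m \<Longrightarrow> co (e i) j = (if i = j then 1 else 0)"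
  proof (rule W.family_basis_coordinates[OF b], goal_cases)
    case (1 co)
    show thesis by (rule that[of co]) (use 1 in \<open>auto simp: W\<close>)
  qed
  \<comment> \<open>The k-linear map whose values on the basis form column j of F; these maps will
    be the basis of the solution space.\<close>
  define s where "s j = (\<lambda>x\<in>carrier M. \<Sum>i<m. emb (co x i) * F $$ (i, j))" for j
  have s_add: "s j (x \<oplus>\<^bsub>M\<^esub> y) = s j x + s j y" if "x \<in> carrier M" "y \<in> carrier M" for j x y
    using that by (simp add: s_def co_add hom_add distrib_right sum.distrib)
  have s_smult: "s j (dconst a \<odot>\<^bsub>M\<^esub> x) = emb a * s j x" if "x \<in> carrier M" for j a x
    using that by (simp add: s_def m(2) co_smult hom_mult sum_distrib_left mult.assoc)
  have s_e: "s j (e i) = F $$ (i, j)" if "i < m" for i j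
  proof -
    have "s j (e i) = (\<Sum>k<m. emb (co (e i) k) * F $$ (k, j))"
      using e[OF that] by (simp add: s_def)
    also have "\<dots> = (\<Sum>k<m. if k = i then F $$ (k, j) else 0)"
      by (rule sum.cong) (use that in \<open>auto simp: co_e\<close>)
    finally show ?thesis using that by simp
  qed
  \<comment> \<open>Both sides are additive in x, so multiples of basis vectors suffice. For
    \<open>e i\<close> the claim is F' = B F, and the relation \<partial> a = a \<partial> + a'
    extends it to multiples.\<close>
  have s_del: "s j (ddel \<odot>\<^bsub>M\<^esub> x) = der (s j x)" if j: "j < m" and "x \<in> carrier M" for j x
  proof -
    have "x \<in> carrier ?W" using that by (simp add: W)
    with b show ?thesis
    proof (rule W.family_basis_induct)
      have "s j \<zero>\<^bsub>M\<^esub> = s j \<zero>\<^bsub>M\<^esub> + s j \<zero>\<^bsub>M\<^esub>"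
        using s_add[of "\<zero>\<^bsub>M\<^esub>" "\<zero>\<^bsub>M\<^esub>" j] by simp
      then have "s j \<zero>\<^bsub>M\<^esub> = 0" by (simp only: add_cancel_right_right)
      moreover have "ddel \<odot>\<^bsub>M\<^esub> \<zero>\<^bsub>M\<^esub> \<oplus>\<^bsub>M\<^esub> ddel \<odot>\<^bsub>M\<^esub> \<zero>\<^bsub>M\<^esub> = ddel \<odot>\<^bsub>M\<^esub> \<zero>\<^bsub>M\<^esub>"
        using m(6)[of "\<zero>\<^bsub>M\<^esub>" "\<zero>\<^bsub>M\<^esub>" ddel] by simp
      then have "ddel \<odot>\<^bsub>M\<^esub> \<zero>\<^bsub>M\<^esub> = \<zero>\<^bsub>M\<^esub>" using m(2)[of "\<zero>\<^bsub>M\<^esub>"] by (simp add: M.add.l_cancel_one)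
      moreover have "\<zero>\<^bsub>?W\<^esub> = \<zero>\<^bsub>M\<^esub>" by (simp add: restrict_scalars_def)
      ultimately show "s j (ddel \<odot>\<^bsub>M\<^esub> \<zero>\<^bsub>?W\<^esub>) = der (s j \<zero>\<^bsub>?W\<^esub>)" by simp
    next
      fix x y assume "x \<in> carrier ?W" "y \<in> carrier ?W"
        "s j (ddel \<odot>\<^bsub>M\<^esub> x) = der (s j x)" "s j (ddel \<odot>\<^bsub>M\<^esub> y) = der (s j y)"
      then show "s j (ddel \<odot>\<^bsub>M\<^esub> (x \<oplus>\<^bsub>?W\<^esub> y)) = der (s j (x \<oplus>\<^bsub>?W\<^esub> y))"
        by (simp add: W m(2,6) s_add der_add)
    next
      fix a i assume i: "i < m"
      have "s j (ddel \<odot>\<^bsub>M\<^esub> e i) = (\<Sum>k<m. emb (B $$ (i, k)) * F $$ (k, j))"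
        using m(2)[OF e[OF i], of ddel] unfolding s_def del[OF i] by (simp add: co_lin)
      then have de: "s j (ddel \<odot>\<^bsub>M\<^esub> e i) = der (F $$ (i, j))" using derF[OF i j] by simp
      have "ddel \<odot>\<^bsub>M\<^esub> (dconst a \<odot>\<^bsub>M\<^esub> e i)
          = dconst a \<odot>\<^bsub>M\<^esub> (ddel \<odot>\<^bsub>M\<^esub> e i) \<oplus>\<^bsub>M\<^esub> (dconst (der a) \<odot>\<^bsub>M\<^esub> e i)"
        using e[OF i] by (simp flip: m(4)) (simp add: ddel_dconst m(4,5))
      then show "s j (ddel \<odot>\<^bsub>M\<^esub> (a \<odot>\<^bsub>?W\<^esub> e i)) = der (s j (a \<odot>\<^bsub>?W\<^esub> e i))"
        using e[OF i] by (simp add: W s_add s_smult m(2) de s_e[OF i] der_mult emb_der add.commute)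
    qed
  qed
  have s: "s j \<in> carrier ?S" if "j < m" for j
  proof -
    have "s j \<in> extensional (carrier M)" by (simp add: s_def)
    then show ?thesis unfolding solution_iff using s_add s_smult s_del[OF that] by blast
  qed
  have const: "c j \<in> carrier (constant_field :: 'k ring) \<longleftrightarrow> der (c j) = 0" for c :: "nat \<Rightarrow> 'k" and j
    by (simp add: constant_field_def constants_def)
  have comb: "(\<Oplus>\<^bsub>?S\<^esub>j\<in>{..<m}. c j \<odot>\<^bsub>?S\<^esub> s j) (e i) = (F *\<^sub>v vec m (\<lambda>j. emb (c j))) $ i"
    if "c \<in> {..<m} \<rightarrow> carrier (constant_field :: 'k ring)" "i < m" for c i
  proof -
    have "(\<Oplus>\<^bsub>?S\<^esub>j\<in>{..<m}. c j \<odot>\<^bsub>?S\<^esub> s j) (e i) = (\<Sum>j<m. emb (c j) * s j (e i))"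
      using solution_sum[of m s c "e i"] that s e by (auto simp: Pi_iff)
    then show ?thesis
      using that Fc by (simp add: s_e scalar_prod_def atLeast0LessThan mult.commute)
  qed
  have F_inj: "v = 0\<^sub>v m" if "F *\<^sub>v v = 0\<^sub>v m" "v \<in> carrier_vec m" for v
  proof -
    have "v = (G * F) *\<^sub>v v" using that by (simp add: GF)
    also have "\<dots> = G *\<^sub>v (F *\<^sub>v v)" by (rule assoc_mult_mat_vec[OF Gc Fc that(2)])
    also have "\<dots> = 0\<^sub>v m" unfolding that(1) using Gc by (intro eq_vecI) auto
    finally show ?thesis .
  qed
  have "S.family_basis s m"
    unfolding S.family_basis_def S.independent_family_def
  proof (intro conjI ballI impI allI)
    show "s \<in> {..<m} \<rightarrow> carrier ?S" using s by auto
  next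
    fix c i assume c: "c \<in> {..<m} \<rightarrow> carrier (constant_field :: 'k ring)" and i: "i < m"
      and 0: "(\<Oplus>\<^bsub>?S\<^esub>j\<in>{..<m}. c j \<odot>\<^bsub>?S\<^esub> s j) = \<zero>\<^bsub>?S\<^esub>"
    have "F *\<^sub>v vec m (\<lambda>j. emb (c j)) = 0\<^sub>v m"
    proof (rule eq_vecI)
      fix k assume k: "k < dim_vec (0\<^sub>v m)"
      then have "\<zero>\<^bsub>?S\<^esub> (e k) = 0" using e by (simp add: solution_space_def)
      then show "(F *\<^sub>v vec m (\<lambda>j. emb (c j))) $ k = 0\<^sub>v m $ k"
        using comb[OF c, of k] k 0 by simp
    qed (use Fc in simp)
    then have "vec m (\<lambda>j. emb (c j)) = 0\<^sub>v m" by (rule F_inj) simp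
    then have "vec m (\<lambda>j. emb (c j)) $ i = 0\<^sub>v m $ i" by simp
    then show "c i = \<zero>\<^bsub>constant_field\<^esub>" using i by (simp add: constant_field_def)
  next
    fix f assume f: "f \<in> carrier ?S"
    define y where "y = vec m (\<lambda>i. f (e i))"
    define c where "c = G *\<^sub>v y"
    have c: "c \<in> carrier_vec m" using Gc by (simp add: c_def carrier_vecI)
    have "(F * G) *\<^sub>v y = F *\<^sub>v c"
      unfolding c_def by (rule assoc_mult_mat_vec[OF Fc Gc]) (simp add: y_def)
    then have Fcy: "F *\<^sub>v c = y" using FG by (simp add: y_def)
    have y_sum: "f (e i) = (\<Sum>k<m. F $$ (i, k) * c $ k)" if "i < m" for i
    proof -
      have "f (e i) = (F *\<^sub>v c) $ i" using that by (simp add: Fcy y_def)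
      then show ?thesis using that Fc c by (simp add: scalar_prod_def atLeast0LessThan)
    qed
    have der_y: "der (f (e i)) = (\<Sum>k<m. emb (B $$ (i, k)) * f (e k))" if i: "i < m" for i
    proof -
      have "f (\<Oplus>\<^bsub>?W\<^esub>j\<in>S. B $$ (i, j) \<odot>\<^bsub>?W\<^esub> e j) = (\<Sum>j\<in>S. emb (B $$ (i, j)) * f (e j))"
        if "finite S" "S \<subseteq> {..<m}" for S
        using that
      proof induction
        case empty
        have "f \<zero>\<^bsub>M\<^esub> = f \<zero>\<^bsub>M\<^esub> + f \<zero>\<^bsub>M\<^esub>"
          using f unfolding solution_iff by (metis M.zero_closed M.l_zero)
        then have "f \<zero>\<^bsub>M\<^esub> = 0" by (simp only: add_cancel_right_right)
        moreover have "\<zero>\<^bsub>?W\<^esub> = \<zero>\<^bsub>M\<^esub>" by (simp add: restrict_scalars_def)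
        ultimately show ?case by simp
      next
        case (insert k S)
        have mem: "(\<lambda>j. B $$ (i, j) \<odot>\<^bsub>?W\<^esub> e j) \<in> S \<rightarrow> carrier ?W" "B $$ (i, k) \<odot>\<^bsub>?W\<^esub> e k \<in> carrier ?W"
          using insert.prems e by (auto simp: W m(2) subset_iff)
        have "(\<Oplus>\<^bsub>?W\<^esub>j\<in>insert k S. B $$ (i, j) \<odot>\<^bsub>?W\<^esub> e j)
            = B $$ (i, k) \<odot>\<^bsub>?W\<^esub> e k \<oplus>\<^bsub>?W\<^esub> (\<Oplus>\<^bsub>?W\<^esub>j\<in>S. B $$ (i, j) \<odot>\<^bsub>?W\<^esub> e j)"
          by (rule W.M.finsum_insert[OF insert.hyps mem])
        moreover have "(\<Oplus>\<^bsub>?W\<^esub>j\<in>S. B $$ (i, j) \<odot>\<^bsub>?W\<^esub> e j) \<in> carrier M"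
          using W.M.finsum_closed[OF mem(1)] by (simp add: W)
        ultimately show ?case
          using insert f e[of k] by (simp add: W(2,3) m(2) solution_iff)
      qed
      from this[of "{..<m}"] show ?thesis
        using f e[OF i] by (simp add: solution_iff flip: del[OF i])
    qed
    \<comment> \<open>From y = F c follows y' = B F c + F c' = B y + F c', while y' = B y because f
      commutes with \<partial>.\<close>
    have "F *\<^sub>v map_vec der c = 0\<^sub>v m"
    proof (rule eq_vecI)
      fix i assume "i < dim_vec (0\<^sub>v m :: 'l vec)"
      then have i: "i < m" by simp
      have "der (f (e i)) = (\<Sum>k<m. der (F $$ (i, k)) * c $ k) + (\<Sum>k<m. F $$ (i, k) * der (c $ k))"
        unfolding y_sum[OF i] by (simp add: der_sum der_mult sum.distrib)
      also have "(\<Sum>k<m. der (F $$ (i, k)) * c $ k)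
          = (\<Sum>k<m. \<Sum>j<m. emb (B $$ (i, j)) * (F $$ (j, k) * c $ k))"
        using i by (auto simp: derF sum_distrib_right mult.assoc intro!: sum.cong)
      also have "\<dots> = (\<Sum>j<m. emb (B $$ (i, j)) * f (e j))"
        by (subst sum.swap) (auto simp: y_sum sum_distrib_left intro!: sum.cong)
      also have "\<dots> = der (f (e i))" using der_y[OF i] by simp
      finally have "(\<Sum>k<m. F $$ (i, k) * der (c $ k)) = 0" by simp
      then show "(F *\<^sub>v map_vec der c) $ i = 0\<^sub>v m $ i"
        using i Fc c by (simp add: scalar_prod_def atLeast0LessThan)
    qed (use Fc in simp)
    then have "map_vec der c = 0\<^sub>v m" by (rule F_inj) (use c in simp)
    then have "map_vec der c $ j = 0\<^sub>v m $ j" for j by simp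
    then have "der (c $ j) = 0" if "j < m" for j
      using that c by (metis carrier_vecD index_map_vec(1) index_zero_vec(1))
    \<comment> \<open>Here the absence of new constants is used: coordinates that are constant in l
      become scalars from k.\<close>
    then have "c $ j \<in> emb ` constants" if "j < m" for j
      using that by (simp flip: C) (simp add: constants_def)
    then have "\<forall>j. \<exists>a. j < m \<longrightarrow> c $ j = emb a \<and> der a = 0" by (auto simp: constants_def)
    from choice[OF this] obtain a where a: "\<And>j. j < m \<Longrightarrow> c $ j = emb (a j) \<and> der (a j) = 0" by blast
    have ac: "a \<in> {..<m} \<rightarrow> carrier (constant_field :: 'k ring)" using a const by auto
    have "vec m (\<lambda>j. emb (a j)) = c" using a c by (intro eq_vecI) auto
    then have "f (e i) = (\<Oplus>\<^bsub>?S\<^esub>j\<in>{..<m}. a j \<odot>\<^bsub>?S\<^esub> s j) (e i)" if "i < m" for i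
      using comb[OF ac that] that Fcy by (simp add: y_def)
    then have "f = (\<Oplus>\<^bsub>?S\<^esub>j\<in>{..<m}. a j \<odot>\<^bsub>?S\<^esub> s j)"
      using ac s by (intro solution_eqI[OF b f] S.M.finsum_closed) (auto intro!: S.smult_closed simp: Pi_iff)
    then show "\<exists>c\<in>{..<m} \<rightarrow> carrier (constant_field :: 'k ring). f = (\<Oplus>\<^bsub>?S\<^esub>j\<in>{..<m}. c j \<odot>\<^bsub>?S\<^esub> s j)"
      using ac by blast
  qed
  then show ?thesis by (rule S.vdim_family_basis)
qed

end


section \<open>The three invariants\<close>

text \<open>Both alternatives depend on \<open>A\<close> only through its row module and the degree
  of its determinant, which row additions preserve; so the disjunction can be transported by
  \<open>triangular_induct\<close>. In the second one, y is a linear functional on row vectors that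
  kills the row module and takes the value 1 at u.\<close>

lemma cokernel_dichotomy:
  fixes A :: "'k :: differential_field diffop mat"
  assumes Q: "left_fraction_field \<iota>" and det: "dieudonne_determinant n \<Delta>" and n: "n \<ge> 1"
    and A: "A \<in> carrier_mat n n"
  shows "(\<exists>e m. vectorspace.family_basis (class_ring :: 'k ring)
        (restrict_scalars dconst (cokernel_module n A)) e m
      \<and> Qab_deg \<iota> (\<Delta> (map_mat \<iota> A)) = ereal (real m))
    \<or> (\<exists>u y. u \<in> carrier_vec n \<and> (\<Sum>j<n. u $ j * y j) = 1
      \<and> (\<forall>w\<in>row_module n A. (\<Sum>j<n. w $ j * y j) = 0)
      \<and> Qab_deg \<iota> (\<Delta> (map_mat \<iota> A)) = \<infinity>)"
    (is "?P A")
proof (rule triangular_induct[where P = ?P, OF _ _ A])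
  note dd = det_deg_def[OF Q det n]
  fix B :: "'k diffop mat" and a k l
  assume *: "B \<in> carrier_mat n n" "k < n" "l < n" "k \<noteq> l" and P: "?P (addrow a k l B)"
  have row: "row_module n (addrow a k l B) = row_module n B" by (rule row_module_addrow[OF *])
  have deg: "Qab_deg \<iota> (\<Delta> (map_mat \<iota> (addrow a k l B))) = Qab_deg \<iota> (\<Delta> (map_mat \<iota> B))"
    using det_deg_embed_addrow[OF Q det n *] by (simp only: dd)
  show "?P B" using P unfolding row deg cokernel_module_eq[OF row] .
next
  note dd = det_deg_def[OF Q det n]
  fix T :: "'k diffop mat"
  assume T: "T \<in> carrier_mat n n" "upper_triangular T"
  note deg = det_deg_embed_upper_triangular[OF Q det n T, unfolded dd]
  show "?P T"
  proof (cases "\<exists>i<n. T $$ (i, i) = 0")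
    case False
    then obtain e where "vectorspace.family_basis (class_ring :: 'k ring)
        (restrict_scalars dconst (cokernel_module n T)) e (\<Sum>i<n. ddegree (T $$ (i, i)))"
      using cokernel_triangular_basis[OF T] by blast
    moreover have "Qab_deg \<iota> (\<Delta> (map_mat \<iota> T)) = ereal (real (\<Sum>i<n. ddegree (T $$ (i, i))))"
      unfolding deg using False by (simp only: if_False)
    ultimately show ?thesis by blast
  next
    case True
    \<comment> \<open>The first zero on the diagonal, so that the rows above it can be solved for
      their diagonal unknowns.\<close>
    define i where "i = (LEAST i. i < n \<and> T $$ (i, i) = 0)"
    have i: "i < n" "T $$ (i, i) = 0"
      using LeastI_ex[OF True] by (auto simp: i_def)
    have "T $$ (j, j) \<noteq> 0" if "j < i" for j
      using not_less_Least[of j "\<lambda>i. i < n \<and> T $$ (i, i) = 0"] that i(1) by (auto simp: i_def)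
    then obtain x where x: "x i \<noteq> 0" "\<And>r. r < n \<Longrightarrow> (\<Sum>j<n. T $$ (r, j) * x j) = 0"
      using triangular_null_vector[OF T i] by blast
    obtain y u where u: "u \<in> carrier_vec n" "(\<Sum>j<n. u $ j * y j) = 1"
      and y: "\<And>v. (\<Sum>j<n. v $ j * x j) = 0 \<Longrightarrow> (\<Sum>j<n. v $ j * y j) = 0"
      using unimodular_null_vector[where x = x, OF i(1) x(1)] by blast
    have "(\<Sum>j<n. w $ j * x j) = 0" if "w \<in> row_module n T" for w
    proof -
      obtain v where v: "w = row_mult v T" using \<open>w \<in> _\<close> by (auto simp: row_module_def)
      have "(\<Sum>j<n. w $ j * x j) = (\<Sum>j<n. \<Sum>r<n. v $ r * (T $$ (r, j) * x j))"
        unfolding v using T(1)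
        by (intro sum.cong) (auto simp: row_mult_index sum_distrib_right mult.assoc)
      also have "\<dots> = (\<Sum>r<n. v $ r * (\<Sum>j<n. T $$ (r, j) * x j))"
        by (subst sum.swap) (simp add: sum_distrib_left)
      also have "\<dots> = 0" using x(2) by simp
      finally show ?thesis .
    qed
    then have "\<forall>w\<in>row_module n T. (\<Sum>j<n. w $ j * y j) = 0" using y by blast
    moreover have "Qab_deg \<iota> (\<Delta> (map_mat \<iota> T)) = \<infinity>"
      unfolding deg using True by (simp only: if_True)
    ultimately show ?thesis using u by blast
  qed
qed

text \<open>The functional given by y vanishes on the row module and so descends to cosets;
  evaluating it at an arbitrarily chosen representative is then well defined.\<close>

lemma cokernel_free_quotient:
  fixes A :: "'k :: differential_field diffop mat"
  assumes A: "A \<in> carrier_mat n n" and u: "u \<in> carrier_vec n" "(\<Sum>j<n. u $ j * y j) = 1"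
    and null: "\<And>w. w \<in> row_module n A \<Longrightarrow> (\<Sum>j<n. w $ j * y j) = 0"
  obtains \<pi> x where "x \<in> carrier (cokernel_module n A)" "\<pi> x = 1"
    "\<And>x y. x \<in> carrier (cokernel_module n A) \<Longrightarrow> y \<in> carrier (cokernel_module n A) \<Longrightarrow>
      \<pi> (x \<oplus>\<^bsub>cokernel_module n A\<^esub> y) = \<pi> x + \<pi> y"
    "\<And>r x. x \<in> carrier (cokernel_module n A) \<Longrightarrow> \<pi> (r \<odot>\<^bsub>cokernel_module n A\<^esub> x) = r * \<pi> x"
proof -
  define p where "p v = (\<Sum>j<n. v $ j * y j)" for v
  have p_add: "p (v + w) = p v + p w" if "w \<in> carrier_vec n" for v w
    using that by (simp add: p_def distrib_right sum.distrib)
  have p_smult: "p (r \<cdot>\<^sub>v v) = r * p v" if "v \<in> carrier_vec n" for r v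
    using that by (simp add: p_def sum_distrib_left mult.assoc)
  define \<pi> where "\<pi> X = p (SOME v. v \<in> carrier_vec n \<and> X = coker_class n A v)" for X
  have \<pi>: "\<pi> (coker_class n A v) = p v" if v: "v \<in> carrier_vec n" for v
  proof -
    define w where "w = (SOME w. w \<in> carrier_vec n \<and> coker_class n A v = coker_class n A w)"
    have w: "w \<in> carrier_vec n" "coker_class n A v = coker_class n A w"
      using someI[of "\<lambda>w. w \<in> carrier_vec n \<and> coker_class n A v = coker_class n A w" v] v
      unfolding w_def by auto
    then have "v - w \<in> row_module n A" using coker_class_eq_iff[OF A v w(1)] by simp
    then have "p (v - w) = 0" unfolding p_def by (rule null)
    moreover have "v = (v - w) + w" using v w(1) by (intro eq_vecI) auto
    ultimately have "p v = p w" using p_add[OF w(1), of "v - w"] by simp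
    then show ?thesis by (simp add: \<pi>_def w_def)
  qed
  show thesis
  proof (rule that[of "coker_class n A u" \<pi>])
    show "coker_class n A u \<in> carrier (cokernel_module n A)" using u by (simp add: cokernel_carrier[OF A])
    show "\<pi> (coker_class n A u) = 1" using u by (simp add: \<pi> p_def)
  next
    fix X Y assume "X \<in> carrier (cokernel_module n A)" "Y \<in> carrier (cokernel_module n A)"
    then obtain v w where "v \<in> carrier_vec n" "X = coker_class n A v" "w \<in> carrier_vec n" "Y = coker_class n A w"
      by (auto simp: cokernel_carrier[OF A])
    then show "\<pi> (X \<oplus>\<^bsub>cokernel_module n A\<^esub> Y) = \<pi> X + \<pi> Y" by (simp add: cokernel_add[OF A] \<pi> p_add)
  next
    fix r X assume "X \<in> carrier (cokernel_module n A)"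
    then obtain v where "v \<in> carrier_vec n" "X = coker_class n A v"
      by (auto simp: cokernel_carrier[OF A])
    then show "\<pi> (r \<odot>\<^bsub>cokernel_module n A\<^esub> X) = r * \<pi> X" by (simp add: cokernel_smult[OF A] \<pi> p_smult)
  qed
qed

text \<open>The operators \<open>1, \<partial>, \<partial>\<^sup>2, \<dots>\<close> applied to an element of a finite-dimensional module are linearly
  dependent, so that every element is torsion.\<close>

lemma torsion_module_finite:
  fixes M :: "('k :: differential_field diffop, 'm) module"
  assumes M: "left_module M"
    and b: "vectorspace.family_basis (class_ring :: 'k ring) (restrict_scalars dconst M) e m"
  shows "torsion_module M = M"
proof -
  let ?W = "restrict_scalars dconst M"
  interpret W: vectorspace "class_ring :: 'k ring" ?W
    by (rule vectorspace_restrict_scalars[OF M])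
  have "\<exists>r. r \<noteq> 0 \<and> r \<odot>\<^bsub>M\<^esub> x = \<zero>\<^bsub>M\<^esub>" if x: "x \<in> carrier M" for x
  proof -
    define z where "z j = ddel ^ j \<odot>\<^bsub>M\<^esub> x" for j
    have z: "z j \<in> carrier ?W" for j by (simp add: z_def restrict_scalars_def left_moduleD(2)[OF M] x)
    have sum: "(\<Oplus>\<^bsub>?W\<^esub>j\<in>{..<N}. c j \<odot>\<^bsub>?W\<^esub> z j) = (\<Sum>j<N. dconst (c j) * ddel ^ j) \<odot>\<^bsub>M\<^esub> x" for c N
      unfolding z_def by (rule operator_finsum[OF M x])
    have "\<not> (\<forall>N. W.independent_family z N)"
      using W.vdim_infinite[of z] z W.vdim_family_basis[OF b] by auto
    then obtain N c i where "i < N" "c i \<noteq> 0" and 0: "(\<Oplus>\<^bsub>?W\<^esub>j\<in>{..<N}. c j \<odot>\<^bsub>?W\<^esub> z j) = \<zero>\<^bsub>?W\<^esub>"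
      unfolding W.independent_family_def by auto
    define r where "r = (\<Sum>j<N. dconst (c j) * ddel ^ j)"
    have "dcoeff r i = c i" using \<open>i < N\<close> by (simp add: r_def dcoeff_operator)
    with \<open>c i \<noteq> 0\<close> have "r \<noteq> 0" by auto
    moreover have "r \<odot>\<^bsub>M\<^esub> x = \<zero>\<^bsub>M\<^esub>"
      using 0 unfolding sum r_def by (simp add: restrict_scalars_def)
    ultimately show ?thesis by blast
  qed
  then have "{x \<in> carrier M. \<exists>r. r \<noteq> 0 \<and> r \<odot>\<^bsub>M\<^esub> x = \<zero>\<^bsub>M\<^esub>} = carrier M" by blast
  then show ?thesis unfolding torsion_module_def by simp
qed

theorem corollary2p3:
  fixes n :: nat
    and A :: "'k :: {differential_field, field_char_0} diffop mat"
    and emb :: "'k \<Rightarrow> 'l :: differential_field"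
    and \<iota> :: "'k diffop \<Rightarrow> 'q :: division_ring"
    and \<Delta> :: "'q mat \<Rightarrow> 'q set"
  defines "M \<equiv> cokernel_module n A"
  defines "V \<equiv> solution_space emb M"
  assumes nontrivial: "\<exists>a :: 'k. der a \<noteq> 0"
    and n: "n \<ge> 1"
    and A: "A \<in> carrier_mat n n"
    and l: "picard_vessiot emb (torsion_module M) \<or> universal_extension emb"
    and Q: "left_fraction_field \<iota>"
    and det: "dieudonne_determinant n \<Delta>"
  shows "vdim (constant_field :: 'k ring) V
           = vdim (class_ring :: 'k ring) (restrict_scalars dconst M)
       \<and> ereal_of_enat (vdim (class_ring :: 'k ring) (restrict_scalars dconst M))
           = Qab_deg \<iota> (\<Delta> (map_mat \<iota> A))"
proof -
  have M: "left_module M" unfolding M_def by (rule left_module_cokernel_module[OF A])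
  have ext: "differential_extension emb" and C: "constants = emb ` constants"
    using l by (auto simp: picard_vessiot_def universal_extension_def)
  let ?W = "restrict_scalars dconst M"
  interpret W: vectorspace "class_ring :: 'k ring" ?W
    by (rule vectorspace_restrict_scalars[OF M])
  from cokernel_dichotomy[OF Q det n A] consider
      (finite) e m where "W.family_basis e m" "Qab_deg \<iota> (\<Delta> (map_mat \<iota> A)) = ereal (real m)"
    | (infinite) u y where "u \<in> carrier_vec n" "(\<Sum>j<n. u $ j * y j) = 1"
        "\<forall>w\<in>row_module n A. (\<Sum>j<n. w $ j * y j) = 0" "Qab_deg \<iota> (\<Delta> (map_mat \<iota> A)) = \<infinity>"
    unfolding M_def by blast
  then show ?thesis
  proof cases
    case finite
    have dim: "vdim (class_ring :: 'k ring) ?W = enat m"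
      by (rule W.vdim_family_basis[OF finite(1)])
    \<comment> \<open>Both kinds of extension lead to the same data: a basis of M, the matrix of
      \<partial> in it, and a fundamental matrix.\<close>
    have "\<exists>e' m' B F. W.family_basis e' m' \<and> B \<in> carrier_mat m' m'
      \<and> (\<forall>i<m'. ddel \<odot>\<^bsub>M\<^esub> e' i = (\<Oplus>\<^bsub>?W\<^esub>j\<in>{..<m'}. B $$ (i, j) \<odot>\<^bsub>?W\<^esub> e' j))
      \<and> fundamental_matrix emb m' B F"
      using l
    proof
      \<comment> \<open>M is torsion in this case, so the basis in the Picard-Vessiot condition is a
        basis of M itself.\<close>
      assume "picard_vessiot emb (torsion_module M)"
      then obtain e' m' B F where *: "inj_on e' {..<m'}" "W.basis (e' ` {..<m'})" "B \<in> carrier_mat m' m'"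
        "\<forall>i<m'. ddel \<odot>\<^bsub>M\<^esub> e' i = (\<Oplus>\<^bsub>?W\<^esub>j\<in>{..<m'}. B $$ (i, j) \<odot>\<^bsub>?W\<^esub> e' j)"
        "fundamental_matrix emb m' B F"
        unfolding torsion_module_finite[OF M finite(1)] picard_vessiot_def Let_def by blast
      moreover have "e' \<in> {..<m'} \<rightarrow> carrier ?W" using *(2) by (auto simp: W.basis_def)
      ultimately show ?thesis using W.family_basis_iff by blast
    next
      assume univ: "universal_extension emb"
      have e: "ddel \<odot>\<^bsub>M\<^esub> e i \<in> carrier ?W" if "i < m" for i
      proof -
        have "e \<in> {..<m} \<rightarrow> carrier ?W"
          using finite(1) unfolding W.family_basis_def by (rule conjunct1)
        then show ?thesis using that left_moduleD(2)[OF M] by (auto simp: restrict_scalars_def)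
      qed
      have "\<forall>i. \<exists>c. i < m \<longrightarrow> ddel \<odot>\<^bsub>M\<^esub> e i = (\<Oplus>\<^bsub>?W\<^esub>j\<in>{..<m}. c j \<odot>\<^bsub>?W\<^esub> e j)"
        using finite(1) e unfolding W.family_basis_def by blast
      from choice[OF this] obtain c where
        c: "\<And>i. i < m \<Longrightarrow> ddel \<odot>\<^bsub>M\<^esub> e i = (\<Oplus>\<^bsub>?W\<^esub>j\<in>{..<m}. c i j \<odot>\<^bsub>?W\<^esub> e j)" by blast
      define B where "B = mat m m (\<lambda>(i, j). c i j)"
      have B: "B \<in> carrier_mat m m" by (simp add: B_def)
      have eB: "ddel \<odot>\<^bsub>M\<^esub> e i = (\<Oplus>\<^bsub>?W\<^esub>j\<in>{..<m}. B $$ (i, j) \<odot>\<^bsub>?W\<^esub> e j)" if i: "i < m" for i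
        unfolding c[OF i]
      proof (rule W.M.finsum_cong')
        show "(\<lambda>j. B $$ (i, j) \<odot>\<^bsub>?W\<^esub> e j) \<in> {..<m} \<rightarrow> carrier ?W"
          using finite(1) by (auto simp: W.family_basis_def intro!: W.smult_closed)
      qed (use i in \<open>auto simp: B_def\<close>)
      obtain F where "fundamental_matrix emb m B F"
        using univ B unfolding universal_extension_def by blast
      then show ?thesis using finite(1) B eB by blast
    qed
    then obtain e' m' B F where *: "W.family_basis e' m'" "B \<in> carrier_mat m' m'"
      "\<And>i. i < m' \<Longrightarrow> ddel \<odot>\<^bsub>M\<^esub> e' i = (\<Oplus>\<^bsub>?W\<^esub>j\<in>{..<m'}. B $$ (i, j) \<odot>\<^bsub>?W\<^esub> e' j)"
      "fundamental_matrix emb m' B F" by blast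
    have "vdim (constant_field :: 'k ring) V = enat m'"
      unfolding V_def by (rule vdim_solution_space_finite[OF M ext * C])
    \<comment> \<open>The basis \<open>e'\<close> may differ from \<open>e\<close>; the lengths
      agree because both equal the dimension of M.\<close>
    moreover have "enat m' = enat m" using W.vdim_family_basis[OF *(1)] dim by simp
    ultimately show ?thesis using dim finite(2) by simp
  next
    case infinite
    obtain a :: 'k where a: "der a \<noteq> 0" using nontrivial by blast
    obtain \<pi> x where \<pi>: "x \<in> carrier M" "\<pi> x = 1"
      "\<And>x y. x \<in> carrier M \<Longrightarrow> y \<in> carrier M \<Longrightarrow> \<pi> (x \<oplus>\<^bsub>M\<^esub> y) = \<pi> x + \<pi> y"
      "\<And>r x. x \<in> carrier M \<Longrightarrow> \<pi> (r \<odot>\<^bsub>M\<^esub> x) = r * \<pi> x"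
    proof (rule cokernel_free_quotient[OF A infinite(1,2)], goal_cases)
      case (1 w)
      then show ?case using infinite(3) by blast
    next
      case (2 \<pi> x)
      show thesis by (rule that[of x \<pi>]) (use 2 in \<open>simp_all add: M_def\<close>)
    qed
    have "vdim (class_ring :: 'k ring) ?W = \<infinity>"
      by (rule vdim_free_quotient[OF M, of \<pi> x]) (simp_all add: \<pi>)
    moreover have "vdim (constant_field :: 'k ring) V = \<infinity>"
      unfolding V_def
    proof (rule vdim_solution_space_free_quotient[OF M ext, of \<pi> x a])
      show "c j = 0" if "\<And>j. j < N \<Longrightarrow> der (c j) = 0" "(\<Sum>j<N. c j * a ^ j) = 0" "j < N" for N c j
        using powers_independent[OF a that] .
    qed (simp_all add: \<pi>)
    ultimately show ?thesis using infinite(4) by simp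
  qed
qed

end
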